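(* Let $G$ be a finite simple graph, let $\pi=\{W_1,\ldots,W_r\}$ be a clique partition of $G$, and let $n_1,\ldots,n_r$ be positive integers. Then the multi-clique-whiskered graph $G^\pi[n_1,\ldots,n_r]$ is vertex decomposable, and hence sequentially Cohen--Macaulay.
   Context: A clique partition $\pi=\{W_1,\ldots,W_r\}$ of $G$ is a family of cliques (vertex sets inducing complete subgraphs) whose disjoint union is $V(G)$. The multi-clique-whiskered graph $G^\pi[n_1,\ldots,n_r]$ has vertex set $V(G)\cup\{w_{i,k}:1\le i\le r,\ 1\le k\le n_i\}$ (new vertices $w_{i,k}$) and edge set $E(G)\cup\bigcup_{i=1}^r\{\{x,w_{i,k}\}: x\in W_i,\ 1\le k\le n_i\}$. The independence complex $\Delta(\Gamma)$ of a graph $\Gamma$ is the simplicial complex of independent sets of $\Gamma$. A simplicial complex $\Delta$ on a finite vertex set $V$ is vertex decomposable if either $\Delta$ is a simplex $\langle V\rangle$ or $\Delta=\emptyset$, or there is a vertex $x\in V$ such that $\mathrm{link}_\Delta(\{x\})=\{F\in\Delta: x\notin F,\ F\cup\{x\}\in\Delta\}$ and $\mathrm{del}_\Delta(\{x\})=\{F\in\Delta: x\notin F\}$ are vertex decomposable and every facet of $\mathrm{del}_\Delta(\{x\})$ is a facet of $\Delta$. A graph is vertex decomposable if its independence complex is. A graded module $M$ over a polynomial ring $S$ over a field $\Bbbk$ is sequentially Cohen--Macaulay if there is a filtration $0=M_0\subset M_1\subset\cdots\subset M_t=M$ by graded submodules with each $M_i/M_{i-1}$ Cohen--Macaulay and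 $\dim M_i/M_{i-1}<\dim M_{i+1}/M_i$ for all $i$. A graph $\Gamma$ is sequentially Cohen--Macaulay if $\Bbbk[V(\Gamma)]/I(\Gamma)$ is, where $I(\Gamma)$ is the edge ideal, generated by $uv$ for $\{u,v\}\in E(\Gamma)$; $\Bbbk$ is an arbitrary field. *)

theory Defs
  imports
    "HOL-Library.Disjoint_Sets"
    "HOL-Library.Ramsey"
    "HOL-Library.Poly_Mapping"
    "HOL-Library.Extended_Real"
    "HOL-Algebra.Module"
    "HOL-Algebra.QuotRing"
begin

section \<open>Graphs and the multi-clique-whiskering construction\<close>

type_synonym 'a graph = "'a set \<times> 'a set set"

abbreviation verts :: "'a graph \<Rightarrow> 'a set" where "verts \<equiv> fst"
abbreviation edges :: "'a graph \<Rightarrow> 'a set set" where "edges \<equiv> snd"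

definition finite_simple_graph :: "'a graph \<Rightarrow> bool" where
  "finite_simple_graph G \<longleftrightarrow> finite (verts G) \<and> (\<forall>e\<in>edges G. e \<subseteq> verts G \<and> card e = 2)"

text \<open>The parts are \<open>W 1, \<dots>, W r\<close>. As the empty vertex set induces a (trivial) complete graph,
  empty parts are not excluded.\<close>

definition clique_partition :: "'a graph \<Rightarrow> nat \<Rightarrow> (nat \<Rightarrow> 'a set) \<Rightarrow> bool" where
  "clique_partition G r W \<longleftrightarrow>
     (\<forall>i\<in>{1..r}. clique (W i) (edges G)) \<and>
     disjoint_family_on W {1..r} \<and>
     (\<Union>i\<in>{1..r}. W i) = verts G"

text \<open>Old vertices are tagged by \<open>Inl\<close>; the new vertex \<open>w\<^sub>i\<^sub>,\<^sub>k\<close> is \<open>Inr (i, k)\<close>.\<close>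

definition multi_clique_whiskered ::
    "'a graph \<Rightarrow> nat \<Rightarrow> (nat \<Rightarrow> 'a set) \<Rightarrow> (nat \<Rightarrow> nat) \<Rightarrow> ('a + nat \<times> nat) graph" where
  "multi_clique_whiskered G r W n =
     (Inl ` verts G \<union> {Inr (i, k) | i k. i \<in> {1..r} \<and> k \<in> {1..n i}},
      image Inl ` edges G \<union>
        {{Inl x, Inr (i, k)} | x i k. i \<in> {1..r} \<and> x \<in> W i \<and> k \<in> {1..n i}})"


section \<open>Vertex decomposability\<close>

definition simplicial_complex :: "'a set \<Rightarrow> 'a set set \<Rightarrow> bool" where
  "simplicial_complex V \<Delta> \<longleftrightarrow> finite V \<and> \<Delta> \<subseteq> Pow V \<and> (\<forall>F\<in>\<Delta>. \<forall>F'\<subseteq>F. F' \<in> \<Delta>)"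

definition link :: "'a set set \<Rightarrow> 'a \<Rightarrow> 'a set set" where
  "link \<Delta> x = {F \<in> \<Delta>. x \<notin> F \<and> insert x F \<in> \<Delta>}"

definition deletion :: "'a set set \<Rightarrow> 'a \<Rightarrow> 'a set set" where
  "deletion \<Delta> x = {F \<in> \<Delta>. x \<notin> F}"

definition facets :: "'a set set \<Rightarrow> 'a set set" where
  "facets \<Delta> = {F \<in> \<Delta>. \<forall>F'\<in>\<Delta>. F \<subseteq> F' \<longrightarrow> F' = F}"

text \<open>A complex is a pair of a finite vertex set \<open>V\<close> and a family of faces; elements of \<open>V\<close> need not
  be faces. Link and deletion of \<open>x\<close> are complexes on \<open>V - {x}\<close>. The empty complex
  in the second rule is the void one, without even the empty face (it is, for instance, the link
  of a vertex that is not a face).\<close>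

inductive vertex_decomposable :: "'a set \<Rightarrow> 'a set set \<Rightarrow> bool" where
  simplex: "finite V \<Longrightarrow> vertex_decomposable V (Pow V)"
| void: "finite V \<Longrightarrow> vertex_decomposable V {}"
| shed: "\<lbrakk>simplicial_complex V \<Delta>; x \<in> V;
          vertex_decomposable (V - {x}) (link \<Delta> x);
          vertex_decomposable (V - {x}) (deletion \<Delta> x);
          facets (deletion \<Delta> x) \<subseteq> facets \<Delta>\<rbrakk>
         \<Longrightarrow> vertex_decomposable V \<Delta>"

definition independence_complex :: "'a graph \<Rightarrow> 'a set set" where
  "independence_complex G = {F. F \<subseteq> verts G \<and> indep F (edges G)}"

definition vertex_decomposable_graph :: "'a graph \<Rightarrow> bool" where
  "vertex_decomposable_graph G \<longleftrightarrow> vertex_decomposable (verts G) (independence_complex G)"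


section \<open>Dimension and depth of modules\<close>

text \<open>The values are extended reals so that the zero ring and the zero module get dimension
  \<open>-\<infinity>\<close> (the supremum of the empty set).\<close>

definition krull_dim :: "('a, 'b) ring_scheme \<Rightarrow> ereal" where
  "krull_dim R = Sup {ereal (real n) | n.
     \<exists>P. (\<forall>i\<le>n. primeideal (P i) R) \<and> (\<forall>i<n. P i \<subset> P (Suc i))}"

definition annihilator :: "('a, 'c) ring_scheme \<Rightarrow> ('a, 'm, 'd) module_scheme \<Rightarrow> 'a set" where
  "annihilator R M = {a \<in> carrier R. \<forall>x\<in>carrier M. a \<odot>\<^bsub>M\<^esub> x = \<zero>\<^bsub>M\<^esub>}"

definition module_dim :: "('a, 'c) ring_scheme \<Rightarrow> ('a, 'm, 'd) module_scheme \<Rightarrow> ereal" where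
  "module_dim R M = krull_dim (R Quot annihilator R M)"

text \<open>Module records extend ring records; multiplication and one of a module that is not an algebra
  are irrelevant and left unspecified.\<close>

definition quot_module ::
    "('a, 'm, 'd) module_scheme \<Rightarrow> 'm set \<Rightarrow> ('a, 'm set) module" where
  "quot_module M N =
     \<lparr>carrier = a_rcosets\<^bsub>M\<^esub> N, mult = undefined, one = undefined,
      zero = N, add = set_add M,
      smult = (\<lambda>a X. \<Union>x\<in>X. N +>\<^bsub>M\<^esub> (a \<odot>\<^bsub>M\<^esub> x))\<rparr>"

definition self_module :: "('a, 'c) ring_scheme \<Rightarrow> ('a, 'a) module" where
  "self_module R =
     \<lparr>carrier = carrier R, mult = mult R, one = one R, zero = zero R, add = add R,
      smult = mult R\<rparr>"

definition finitely_generated :: "('a, 'c) ring_scheme \<Rightarrow> ('a, 'm, 'd) module_scheme \<Rightarrow> bool" where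
  "finitely_generated R M \<longleftrightarrow>
     (\<exists>A. finite A \<and> A \<subseteq> carrier M \<and>
        (\<forall>x\<in>carrier M. \<exists>c\<in>A \<rightarrow> carrier R. x = (\<Oplus>\<^bsub>M\<^esub>a\<in>A. c a \<odot>\<^bsub>M\<^esub> a)))"

text \<open>The submodule \<open>(f\<^sub>1, \<dots>, f\<^sub>k) M\<close> for a list \<open>fs = [f\<^sub>1, \<dots>, f\<^sub>k]\<close> of ring elements.\<close>

definition seq_submodule :: "('a, 'm, 'd) module_scheme \<Rightarrow> 'a list \<Rightarrow> 'm set" where
  "seq_submodule M fs =
     {(\<Oplus>\<^bsub>M\<^esub>i\<in>{..<length fs}. (fs ! i) \<odot>\<^bsub>M\<^esub> m i) | m. m \<in> {..<length fs} \<rightarrow> carrier M}"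

definition regular_sequence ::
    "('a, 'c) ring_scheme \<Rightarrow> ('a, 'm, 'd) module_scheme \<Rightarrow> 'a list \<Rightarrow> bool" where
  "regular_sequence R M fs \<longleftrightarrow>
     set fs \<subseteq> carrier R \<and>
     (\<forall>k<length fs. \<forall>X\<in>carrier (quot_module M (seq_submodule M (take k fs))).
        (fs ! k) \<odot>\<^bsub>quot_module M (seq_submodule M (take k fs))\<^esub> X
            = \<zero>\<^bsub>quot_module M (seq_submodule M (take k fs))\<^esub>
          \<longrightarrow> X = \<zero>\<^bsub>quot_module M (seq_submodule M (take k fs))\<^esub>) \<and>
     seq_submodule M fs \<noteq> carrier M"

definition depth ::
    "('a, 'c) ring_scheme \<Rightarrow> 'a set \<Rightarrow> ('a, 'm, 'd) module_scheme \<Rightarrow> ereal" where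
  "depth R J M = Sup {ereal (real (length fs)) | fs. regular_sequence R M fs \<and> set fs \<subseteq> J}"

text \<open>Here \<open>R\<close> is thought of as a positively graded algebra with irrelevant maximal ideal \<open>J\<close>,
  and \<open>M\<close> as a graded module. By convention the zero module is Cohen--Macaulay.\<close>

definition cohen_macaulay ::
    "('a, 'c) ring_scheme \<Rightarrow> 'a set \<Rightarrow> ('a, 'm, 'd) module_scheme \<Rightarrow> bool" where
  "cohen_macaulay R J M \<longleftrightarrow>
     Module.module R M \<and> finitely_generated R M \<and>
     (carrier M = {\<zero>\<^bsub>M\<^esub>} \<or> depth R J M = module_dim R M)"


section \<open>Graded modules and sequential Cohen--Macaulayness\<close>

text \<open>\<open>\<R> d\<close> and \<open>\<M> d\<close> are the degree \<open>d\<close> components of \<open>R\<close> and \<open>M\<close>; the unique \<open>c\<close> below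
  gives the homogeneous components of \<open>x\<close>.\<close>

definition graded_module ::
    "('a, 'c) ring_scheme \<Rightarrow> (int \<Rightarrow> 'a set) \<Rightarrow>
     ('a, 'm, 'd) module_scheme \<Rightarrow> (int \<Rightarrow> 'm set) \<Rightarrow> bool" where
  "graded_module R \<R> M \<M> \<longleftrightarrow>
     Module.module R M \<and>
     (\<forall>d. additive_subgroup (\<M> d) M) \<and>
     (\<forall>d e. \<forall>a\<in>\<R> d. \<forall>x\<in>\<M> e. a \<odot>\<^bsub>M\<^esub> x \<in> \<M> (d + e)) \<and>
     (\<forall>x\<in>carrier M. \<exists>!c. (\<forall>d. c d \<in> \<M> d) \<and> finite {d. c d \<noteq> \<zero>\<^bsub>M\<^esub>} \<and>
        x = (\<Oplus>\<^bsub>M\<^esub>d\<in>{d. c d \<noteq> \<zero>\<^bsub>M\<^esub>}. c d))"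

definition graded_submodule ::
    "'m set \<Rightarrow> ('a, 'c) ring_scheme \<Rightarrow> ('a, 'm, 'd) module_scheme \<Rightarrow> (int \<Rightarrow> 'm set) \<Rightarrow> bool" where
  "graded_submodule N R M \<M> \<longleftrightarrow>
     submodule N R M \<and>
     (\<forall>x\<in>N. \<exists>c. (\<forall>d. c d \<in> N \<inter> \<M> d) \<and> finite {d. c d \<noteq> \<zero>\<^bsub>M\<^esub>} \<and>
        x = (\<Oplus>\<^bsub>M\<^esub>d\<in>{d. c d \<noteq> \<zero>\<^bsub>M\<^esub>}. c d))"

abbreviation subquotient ::
    "('a, 'm, 'd) module_scheme \<Rightarrow> 'm set \<Rightarrow> 'm set \<Rightarrow> ('a, 'm set) module" where
  "subquotient M N N' \<equiv> quot_module (M\<lparr>carrier := N\<rparr>) N'"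

definition sequentially_cohen_macaulay ::
    "('a, 'c) ring_scheme \<Rightarrow> (int \<Rightarrow> 'a set) \<Rightarrow> 'a set \<Rightarrow>
     ('a, 'm, 'd) module_scheme \<Rightarrow> (int \<Rightarrow> 'm set) \<Rightarrow> bool" where
  "sequentially_cohen_macaulay R \<R> J M \<M> \<longleftrightarrow>
     graded_module R \<R> M \<M> \<and> finitely_generated R M \<and>
     (\<exists>t F. F 0 = {\<zero>\<^bsub>M\<^esub>} \<and> F t = carrier M \<and>
        (\<forall>i\<le>t. graded_submodule (F i) R M \<M>) \<and>
        (\<forall>i<t. F i \<subset> F (Suc i)) \<and>
        (\<forall>i<t. cohen_macaulay R J (subquotient M (F (Suc i)) (F i))) \<and>
        (\<forall>i. Suc i < t \<longrightarrow>
           module_dim R (subquotient M (F (Suc i)) (F i))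
             < module_dim R (subquotient M (F (Suc (Suc i))) (F (Suc i)))))"


section \<open>Polynomial rings and edge ideals\<close>

text \<open>Monomials are finitely supported exponent vectors \<open>'v \<Rightarrow>\<^sub>0 nat\<close>, polynomials over
  the field \<open>'k\<close> are finitely supported coefficient functions on monomials, and the polynomial ring
  in the variables \<open>V\<close> consists of those in which only variables from \<open>V\<close> occur.\<close>

type_synonym ('v, 'k) mpoly = "('v \<Rightarrow>\<^sub>0 nat) \<Rightarrow>\<^sub>0 'k"

definition poly_ring :: "'v set \<Rightarrow> ('v, 'k::field) mpoly ring" where
  "poly_ring V =
     \<lparr>carrier = {p. \<forall>m\<in>Poly_Mapping.keys p. Poly_Mapping.keys m \<subseteq> V},
      mult = (*), one = 1, zero = 0, add = (+)\<rparr>"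

definition Var :: "'v \<Rightarrow> ('v, 'k::field) mpoly" where
  "Var v = Poly_Mapping.single (Poly_Mapping.single v 1) 1"

definition mon_degree :: "('v \<Rightarrow>\<^sub>0 nat) \<Rightarrow> nat" where
  "mon_degree m = (\<Sum>v\<in>Poly_Mapping.keys m. Poly_Mapping.lookup m v)"

definition poly_grading :: "'v set \<Rightarrow> int \<Rightarrow> ('v, 'k::field) mpoly set" where
  "poly_grading V d =
     {p \<in> carrier (poly_ring V). \<forall>m\<in>Poly_Mapping.keys p. int (mon_degree m) = d}"

definition irrelevant_ideal :: "'v set \<Rightarrow> ('v, 'k::field) mpoly set" where
  "irrelevant_ideal V = Idl\<^bsub>poly_ring V\<^esub> (Var ` V)"

definition edge_ideal :: "'v graph \<Rightarrow> ('v, 'k::field) mpoly set" where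
  "edge_ideal G = Idl\<^bsub>poly_ring (verts G)\<^esub> {Var u * Var v | u v. {u, v} \<in> edges G}"

definition edge_module :: "'v graph \<Rightarrow> (('v, 'k::field) mpoly, ('v, 'k) mpoly set) module" where
  "edge_module G = quot_module (self_module (poly_ring (verts G))) (edge_ideal G)"

definition edge_module_grading :: "'v graph \<Rightarrow> int \<Rightarrow> ('v, 'k::field) mpoly set set" where
  "edge_module_grading G d =
     (\<lambda>p. edge_ideal G +>\<^bsub>poly_ring (verts G)\<^esub> p) ` poly_grading (verts G) d"

definition sequentially_cohen_macaulay_graph :: "'k::field itself \<Rightarrow> 'v graph \<Rightarrow> bool" where
  "sequentially_cohen_macaulay_graph (_ :: 'k itself) G \<longleftrightarrow>
     sequentially_cohen_macaulay
       (poly_ring (verts G) :: ('v, 'k) mpoly ring)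
       (poly_grading (verts G))
       (irrelevant_ideal (verts G))
       (edge_module G)
       (edge_module_grading G)"

end

theory Submission
  imports Defs "HOL-Library.Set_Algebras" "HOL-Algebra.Ring_Divisibility"
begin

text \<open>
  Let \<open>\<Gamma>\<close> be the whiskered graph, \<open>V\<close> its vertex set, \<open>S\<close> the polynomial ring in the variables \<open>V\<close> and
  \<open>I\<close> the edge ideal of \<open>\<Gamma>\<close>.

  \<^bold>\<open>Vertex decomposability.\<close> Every old vertex \<open>x \<in> W\<^sub>i\<close> is a shedding vertex: suppose that \<open>F\<close> avoids
  \<open>x\<close> and that \<open>F \<union> {x}\<close> is independent. The whiskers of \<open>W\<^sub>i\<close> and the other vertices of \<open>W\<^sub>i\<close> are
  neighbours of \<open>x\<close>, hence not in \<open>F\<close>. As a whisker of \<open>W\<^sub>i\<close> is adjacent only to vertices of \<open>W\<^sub>i\<close>, adding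
  it to \<open>F\<close> gives an independent set without \<open>x\<close>. So \<open>F\<close> is not a facet of the deletion. Link and
  deletion of \<open>x\<close> are complexes of the same kind with fewer old vertices
  (\<open>vertex_decomposable_whiskered_part\<close>).

  \<^bold>\<open>Sequential Cohen--Macaulayness\<close> is proved directly, from a partition of the independence complex
  into intervals. For an independent set \<open>T\<close> of \<open>\<Gamma>\<close> let \<open>A = T \<inter> V(G)\<close>, and let \<open>F\<^sub>A\<close> consist of \<open>A\<close>
  and of all whiskers of those parts that do not meet \<open>A\<close>. The sets with old part \<open>A\<close> are exactly those
  between \<open>A\<close> and \<open>F\<^sub>A\<close>, so the monomials outside \<open>I\<close> form the disjoint union of the cones
  \<open>x\<^sup>A \<cdot> Mon(F\<^sub>A)\<close>, where \<open>Mon(F)\<close> is the set of monomials in the variables \<open>F\<close>. A part newly met by a larger \<open>A\<close>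
  trades its \<open>n\<^sub>i \<ge> 1\<close> whiskers for one vertex, so \<open>|F\<^sub>A|\<close> does not increase with \<open>A\<close>. Consequently the
  monomials of \<open>I\<close> together with those belonging to an \<open>A\<close> with \<open>|F\<^sub>A| < d\<close> span an ideal. These ideals
  give the filtration of \<open>S/I\<close>, and the step from \<open>d\<close> to \<open>d + 1\<close> has a finite filtration with
  factors isomorphic to \<open>S/P\<^sub>F\<close>, where \<open>|F| = d\<close> and \<open>P\<^sub>F\<close> is generated by the variables outside \<open>F\<close>
  (\<open>cone_filtration\<close>, \<open>cone_filtration_stage\<close>).

  A nonzero subquotient \<open>M\<close> of \<open>S\<close> with such a filtration is Cohen--Macaulay of dimension \<open>d\<close>
  (\<open>cohen_macaulay_cone_filtration\<close>), for three reasons.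

  \<^item> The depth is at least \<open>d\<close>: the elementary symmetric polynomials \<open>e\<^sub>d, \<dots>, e\<^sub>1\<close> in all variables, in
    this order, form a regular sequence on \<open>M\<close> (\<open>weakly_regular_elem_syms\<close>). This works over every
    field, although over a finite one there may be too few linear forms. Regularity
    passes from the factors to \<open>M\<close>, so one may take \<open>M = S/P\<^sub>F\<close>. There \<open>e\<^sub>d\<close> acts as the product of the
    variables in \<open>F\<close>, and the quotient by this product is filtered by the \<open>S/P\<^sub>H\<close> with
    \<open>H\<close> obtained from \<open>F\<close> by removing one element; now use induction on \<open>d\<close>.
  \<^item> The dimension is at most \<open>d\<close>: a prime ideal that contains the annihilator of \<open>M\<close> contains all variables
    outside some \<open>F\<close> with \<open>|F| = d\<close>. Given a chain of primes \<open>P\<^sub>0 \<subset> \<dots> \<subset> P\<^sub>n\<close> whose first member is of this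
    kind, choose \<open>y\<^sub>i\<close> in \<open>P\<^sub>i\<^sub>+\<^sub>1\<close> but not in \<open>P\<^sub>i\<close>, involving only variables of \<open>F\<close>. If \<open>n > d\<close>, then these
    elements are algebraically dependent, and carrying an algebraic relation up the chain puts a nonzero
    constant into \<open>P\<^sub>n\<close> (\<open>prime_chain_length_le\<close>).
  \<^item> The depth is at most the dimension, for all modules over commutative rings
    (\<open>depth_le_module_dim\<close>): if \<open>f\<close> is regular on \<open>M/N\<close>, then a prime ideal that contains \<open>f\<close> and the
    annihilator of \<open>M/N\<close> properly contains another prime above this annihilator.
\<close>

section \<open>Prime ideals and Krull dimension of quotient rings\<close>

text \<open>Krull: an ideal maximal among those that contain \<open>I\<close> and avoid a multiplicative set is prime.\<close>

lemma (in cring) exists_primeideal_disjoint: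
  assumes I: "ideal I R" and T: "T \<subseteq> carrier R" "\<one> \<in> T" "\<And>s t. s \<in> T \<Longrightarrow> t \<in> T \<Longrightarrow> s \<otimes> t \<in> T"
    and disj: "I \<inter> T = {}"
  obtains P where "primeideal P R" "I \<subseteq> P" "P \<inter> T = {}"
proof -
  define \<A> where "\<A> = {J. ideal J R \<and> I \<subseteq> J \<and> J \<inter> T = {}}"
  have "\<exists>P\<in>\<A>. \<forall>X\<in>\<A>. P \<subseteq> X \<longrightarrow> X = P"
  proof (rule subset_Zorn_nonempty)
    show "\<A> \<noteq> {}" using I disj by (auto simp: \<A>_def)
  next
    fix C assume C: "C \<noteq> {}" "subset.chain \<A> C"
    then have CA: "C \<subseteq> \<A>" by (auto simp: subset_chain_def)
    have "subset.chain {J. ideal J R} C" using C(2) by (auto simp: subset_chain_def \<A>_def)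
    then have "ideal (\<Union>C) R" using chain_Union_is_ideal[of C] C(1) by simp
    then show "\<Union>C \<in> \<A>" using C(1) CA by (auto simp: \<A>_def)
  qed
  then obtain P where "P \<in> \<A>" and P_max: "\<forall>X\<in>\<A>. P \<subseteq> X \<longrightarrow> X = P" ..
  then have P: "ideal P R" "I \<subseteq> P" "P \<inter> T = {}" by (simp_all add: \<A>_def)
  have max: "X = P" if "ideal X R" "P \<subseteq> X" "X \<inter> T = {}" for X
    using P_max that P(2) by (simp add: \<A>_def)
  interpret P: ideal P R by (rule P(1))
  have meet: "\<exists>t\<in>T. \<exists>m\<in>P. \<exists>x\<in>carrier R. t = m \<oplus> x \<otimes> a" if a: "a \<in> carrier R" "a \<notin> P" for a
  proof -
    have idl: "ideal (P <+> PIdl a) R"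
      using P(1) a cgenideal_ideal add_ideals by blast
    have "\<zero> \<oplus> a \<in> P <+> PIdl a"
      using cgenideal_self[OF a(1)] P.zero_closed unfolding set_add_def' by blast
    then have "a \<in> P <+> PIdl a" using a by simp
    moreover have "P \<subseteq> P <+> PIdl a"
    proof
      fix p assume p: "p \<in> P"
      have "p \<oplus> \<zero> \<in> P <+> PIdl a"
        using p additive_subgroup.zero_closed[OF ideal.axioms(1)[OF cgenideal_ideal[OF a(1)]]]
        unfolding set_add_def' by blast
      then show "p \<in> P <+> PIdl a" using p by simp
    qed
    ultimately have "(P <+> PIdl a) \<inter> T \<noteq> {}" using max[OF idl] a(2) by blast
    then show ?thesis unfolding set_add_def' cgenideal_def by blast
  qed
  have "primeideal P R"
  proof (rule primeidealI[OF P(1) cring_axioms])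
    show "carrier R \<noteq> P" using P(3) T by blast
  next
    fix a b assume ab: "a \<in> carrier R" "b \<in> carrier R" "a \<otimes> b \<in> P"
    show "a \<in> P \<or> b \<in> P"
    proof (rule ccontr)
      assume "\<not> (a \<in> P \<or> b \<in> P)"
      then obtain s t m n x y where s: "s \<in> T" "m \<in> P" "x \<in> carrier R" "s = m \<oplus> x \<otimes> a"
        and t: "t \<in> T" "n \<in> P" "y \<in> carrier R" "t = n \<oplus> y \<otimes> b"
        using meet[OF ab(1)] meet[OF ab(2)] by metis
      have mn: "m \<in> carrier R" "n \<in> carrier R" using s t P.a_Hcarr by blast+
      have "s \<otimes> t = (n \<oplus> y \<otimes> b) \<otimes> m \<oplus> ((x \<otimes> a) \<otimes> n \<oplus> (x \<otimes> y) \<otimes> (a \<otimes> b))"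
        using ab(1,2) s(3) t(3) mn by (simp add: s(4) t(4) l_distr r_distr m_ac a_ac)
      moreover have "n \<oplus> y \<otimes> b \<in> carrier R" "x \<otimes> a \<in> carrier R" "x \<otimes> y \<in> carrier R"
        using ab(1,2) s(3) t(3) mn by simp_all
      then have "(n \<oplus> y \<otimes> b) \<otimes> m \<oplus> ((x \<otimes> a) \<otimes> n \<oplus> (x \<otimes> y) \<otimes> (a \<otimes> b)) \<in> P"
        using P.I_l_closed[OF s(2)] P.I_l_closed[OF t(2)] P.I_l_closed[OF ab(3)] P.a_closed by simp
      ultimately show False using T(3)[OF s(1) t(1)] P(3) by auto
    qed
  qed
  then show thesis using that P by blast
qed

lemma (in cring) primeideal_quot_vimage:
  assumes I: "ideal I R" and P: "primeideal P (R Quot I)"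
  shows "primeideal {r \<in> carrier R. I +> r \<in> P} R" and "I \<subseteq> {r \<in> carrier R. I +> r \<in> P}"
proof -
  interpret I: ideal I R by (rule I)
  interpret P: primeideal P "R Quot I" by (rule P)
  have zero: "I +> r = \<zero>\<^bsub>R Quot I\<^esub>" if "r \<in> I" for r
    using I.a_rcos_const[OF that] by (simp only: FactRing_def ring.simps)
  show "I \<subseteq> {r \<in> carrier R. I +> r \<in> P}"
    using I.a_Hcarr P.zero_closed zero by force
  interpret h: ring_hom_ring R "R Quot I" "(+>) I" by (rule I.rcos_ring_hom_ring)
  show "primeideal {r \<in> carrier R. I +> r \<in> P} R"
  proof (rule primeidealI[OF h.ideal_vimage[OF P.is_ideal] cring_axioms])
    show "carrier R \<noteq> {r \<in> carrier R. I +> r \<in> P}"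
    proof
      assume "carrier R = {r \<in> carrier R. I +> r \<in> P}"
      then have "I +> \<one> \<in> P" using one_closed by blast
      then have "\<one>\<^bsub>R Quot I\<^esub> \<in> P" unfolding h.hom_one .
      then show False using P.one_imp_carrier P.I_notcarr by blast
    qed
  next
    fix a b assume "a \<in> carrier R" "b \<in> carrier R" "a \<otimes> b \<in> {r \<in> carrier R. I +> r \<in> P}"
    then show "a \<in> {r \<in> carrier R. I +> r \<in> P} \<or> b \<in> {r \<in> carrier R. I +> r \<in> P}"
      using P.I_prime[of "I +> a" "I +> b"] by auto
  qed
qed

lemma (in cring) rcos_mem_image_iff:
  assumes I: "ideal I R" and P: "ideal P R" and IP: "I \<subseteq> P" and a: "a \<in> carrier R"
  shows "I +> a \<in> (+>) I ` P \<longleftrightarrow> a \<in> P"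
proof
  interpret I: ideal I R by (rule I)
  interpret P: ideal P R by (rule P)
  assume "I +> a \<in> (+>) I ` P"
  then obtain p where p: "p \<in> P" "I +> a = I +> p" by blast
  then have "a \<in> I +> p" using I.a_rcos_self[OF a] by simp
  then obtain i where "i \<in> I" "a = i \<oplus> p" by (auto simp: a_r_coset_def')
  then show "a \<in> P" using p IP by auto
qed auto

lemma (in cring) primeideal_quot_image:
  assumes I: "ideal I R" and P: "primeideal P R" and IP: "I \<subseteq> P"
  shows "primeideal ((+>) I ` P) (R Quot I)"
proof -
  interpret I: ideal I R by (rule I)
  interpret P: primeideal P R by (rule P)
  have car: "\<exists>a\<in>carrier R. X = I +> a" if "X \<in> carrier (R Quot I)" for X
    using that by (auto simp: FactRing_def A_RCOSETS_def')
  interpret h: ring_hom_ring R "R Quot I" "(+>) I" by (rule I.rcos_ring_hom_ring)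
  show ?thesis
  proof (rule primeidealI)
    show "ideal ((+>) I ` P) (R Quot I)" by (rule ring_ideal_imp_quot_ideal[OF I P.is_ideal])
    show "cring (R Quot I)" using I.quotient_is_cring cring_axioms by blast
    show "carrier (R Quot I) \<noteq> (+>) I ` P"
    proof
      assume *: "carrier (R Quot I) = (+>) I ` P"
      have "I +> \<one> \<in> carrier (R Quot I)" by (rule h.hom_closed[OF one_closed])
      then have "\<one> \<in> P" unfolding * rcos_mem_image_iff[OF I P.is_ideal IP one_closed] .
      then show False using P.one_imp_carrier P.I_notcarr by blast
    qed
  next
    fix X Y assume XY: "X \<in> carrier (R Quot I)" "Y \<in> carrier (R Quot I)" "X \<otimes>\<^bsub>R Quot I\<^esub> Y \<in> (+>) I ` P"
    then obtain a b where ab: "a \<in> carrier R" "b \<in> carrier R" "X = I +> a" "Y = I +> b"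
      using car by metis
    then have "I +> (a \<otimes> b) \<in> (+>) I ` P" using XY(3) h.hom_mult[OF ab(1,2)] by metis
    then have "a \<otimes> b \<in> P" unfolding rcos_mem_image_iff[OF I P.is_ideal IP m_closed[OF ab(1,2)]] .
    then show "X \<in> (+>) I ` P \<or> Y \<in> (+>) I ` P" using P.I_prime ab by blast
  qed
qed

text \<open>By the correspondence of prime ideals, chains in \<open>R/I\<close> may be replaced by chains in \<open>R\<close> above \<open>I\<close>.\<close>

lemma (in cring) krull_dim_quot:
  assumes I: "ideal I R"
  shows "krull_dim (R Quot I) = Sup {ereal (real n) | n.
     \<exists>P. (\<forall>i\<le>n. primeideal (P i) R \<and> I \<subseteq> P i) \<and> (\<forall>i<n. P i \<subset> P (Suc i))}"
proof -
  interpret I: ideal I R by (rule I)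
  have eq: "(\<exists>P. (\<forall>i\<le>n. primeideal (P i) (R Quot I)) \<and> (\<forall>i<n. P i \<subset> P (Suc i))) \<longleftrightarrow>
    (\<exists>P. (\<forall>i\<le>n. primeideal (P i) R \<and> I \<subseteq> P i) \<and> (\<forall>i<n. P i \<subset> P (Suc i)))" (is "?L \<longleftrightarrow> ?R") for n
  proof
    assume ?L
    then obtain P where P: "\<And>i. i \<le> n \<Longrightarrow> primeideal (P i) (R Quot I)" "\<And>i. i < n \<Longrightarrow> P i \<subset> P (Suc i)"
      by blast
    define Q where "Q i = {r \<in> carrier R. I +> r \<in> P i}" for i
    have "Q i \<subset> Q (Suc i)" if i: "i < n" for i
    proof -
      obtain X where X: "X \<in> P (Suc i)" "X \<notin> P i" using P(2)[OF i] by blast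
      have "P (Suc i) \<subseteq> carrier (R Quot I)"
        using P(1)[of "Suc i"] i by (simp add: additive_subgroup.a_subset ideal.axioms(1) primeideal.axioms(1))
      then obtain a where "a \<in> carrier R" "X = I +> a"
        using X by (auto simp: FactRing_def A_RCOSETS_def')
      then have "a \<in> Q (Suc i)" "a \<notin> Q i" using X by (auto simp: Q_def)
      moreover have "Q i \<subseteq> Q (Suc i)" using P(2)[OF i] by (auto simp: Q_def)
      ultimately show ?thesis by blast
    qed
    then show ?R using primeideal_quot_vimage[OF I P(1)] unfolding Q_def by (intro exI[of _ Q]) (auto simp: Q_def)
  next
    assume ?R
    then obtain P where P: "\<And>i. i \<le> n \<Longrightarrow> primeideal (P i) R" "\<And>i. i \<le> n \<Longrightarrow> I \<subseteq> P i"
      "\<And>i. i < n \<Longrightarrow> P i \<subset> P (Suc i)"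
      by blast
    have idl: "ideal (P i) R" if "i \<le> n" for i using P(1)[OF that] by (rule primeideal.axioms(1))
    have "(+>) I ` P i \<subset> (+>) I ` P (Suc i)" if i: "i < n" for i
    proof -
      obtain a where a: "a \<in> P (Suc i)" "a \<notin> P i" using P(3)[OF i] by blast
      then have "a \<in> carrier R" using idl[of "Suc i"] i
        by (meson Suc_leI additive_subgroup.a_Hcarr ideal.axioms(1))
      then have "I +> a \<notin> (+>) I ` P i" using rcos_mem_image_iff[OF I idl P(2)] i a by simp
      then show ?thesis using P(3)[OF i] a by blast
    qed
    then show ?L using primeideal_quot_image[OF I P(1,2)] by (intro exI[of _ "\<lambda>i. (+>) I ` P i"]) auto
  qed
  show ?thesis unfolding krull_dim_def eq ..
qed

section \<open>Quotient modules\<close>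

context module
begin

lemma abelian_subgroup_submodule: "submodule N R M \<Longrightarrow> abelian_subgroup N M"
  by (rule abelian_subgroupI3) (auto intro: additive_subgroupI submodule.axioms(1) M.abelian_group_axioms)

lemma carrier_quot_module: "carrier (quot_module M N) = (\<lambda>x. N +>\<^bsub>M\<^esub> x) ` carrier M"
  by (auto simp: quot_module_def A_RCOSETS_def')

lemma zero_quot_module: "\<zero>\<^bsub>quot_module M N\<^esub> = N"
  by (simp add: quot_module_def)

lemma rcos_eq_iff:
  assumes N: "submodule N R M" and x: "x \<in> carrier M" "y \<in> carrier M"
  shows "N +>\<^bsub>M\<^esub> x = N +>\<^bsub>M\<^esub> y \<longleftrightarrow> x \<ominus>\<^bsub>M\<^esub> y \<in> N"
proof -
  interpret N: abelian_subgroup N M by (rule abelian_subgroup_submodule[OF N])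
  show ?thesis
    using x N.a_repr_independence' N.a_repr_independenceD N.a_rcos_module M.minus_eq by metis
qed

lemma rcos_eq_self_iff:
  assumes N: "submodule N R M" and x: "x \<in> carrier M"
  shows "N +>\<^bsub>M\<^esub> x = N \<longleftrightarrow> x \<in> N"
proof -
  interpret N: abelian_subgroup N M by (rule abelian_subgroup_submodule[OF N])
  show ?thesis using x N.a_rcos_const N.a_rcos_self by blast
qed

lemma add_quot_module:
  assumes N: "submodule N R M" and x: "x \<in> carrier M" "y \<in> carrier M"
  shows "(N +>\<^bsub>M\<^esub> x) \<oplus>\<^bsub>quot_module M N\<^esub> (N +>\<^bsub>M\<^esub> y) = N +>\<^bsub>M\<^esub> (x \<oplus>\<^bsub>M\<^esub> y)"
proof -
  interpret N: abelian_subgroup N M by (rule abelian_subgroup_submodule[OF N])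
  show ?thesis using x by (simp add: quot_module_def N.a_rcos_sum)
qed

lemma smult_quot_module:
  assumes N: "submodule N R M" and a: "a \<in> carrier R" and x: "x \<in> carrier M"
  shows "a \<odot>\<^bsub>quot_module M N\<^esub> (N +>\<^bsub>M\<^esub> x) = N +>\<^bsub>M\<^esub> (a \<odot>\<^bsub>M\<^esub> x)"
proof -
  interpret N: abelian_subgroup N M by (rule abelian_subgroup_submodule[OF N])
  have "N +>\<^bsub>M\<^esub> (a \<odot>\<^bsub>M\<^esub> y) = N +>\<^bsub>M\<^esub> (a \<odot>\<^bsub>M\<^esub> x)" if y: "y \<in> N +>\<^bsub>M\<^esub> x" for y
  proof -
    obtain n where n: "n \<in> N" "y = n \<oplus>\<^bsub>M\<^esub> x" using y by (auto simp: a_r_coset_def')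
    have nc: "n \<in> carrier M" using n N.a_Hcarr by blast
    have "a \<odot>\<^bsub>M\<^esub> y = a \<odot>\<^bsub>M\<^esub> n \<oplus>\<^bsub>M\<^esub> a \<odot>\<^bsub>M\<^esub> x" using n nc a x by (simp add: smult_r_distr)
    moreover have an: "a \<odot>\<^bsub>M\<^esub> n \<in> N" using submodule.smult_closed[OF N a] n by blast
    ultimately have "a \<odot>\<^bsub>M\<^esub> y \<ominus>\<^bsub>M\<^esub> a \<odot>\<^bsub>M\<^esub> x = a \<odot>\<^bsub>M\<^esub> n"
      using a x nc by (simp add: M.minus_eq M.a_assoc M.r_neg)
    then show ?thesis using an rcos_eq_iff[OF N] a x nc n by simp
  qed
  moreover have "x \<in> N +>\<^bsub>M\<^esub> x" using N.a_rcos_self x by blast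
  ultimately have "(\<Union>y\<in>N +>\<^bsub>M\<^esub> x. N +>\<^bsub>M\<^esub> (a \<odot>\<^bsub>M\<^esub> y)) = N +>\<^bsub>M\<^esub> (a \<odot>\<^bsub>M\<^esub> x)"
    by (intro SUP_eq_const) blast+
  then show ?thesis by (simp only: quot_module_def module.simps)
qed

lemma module_quot_module:
  assumes N: "submodule N R M"
  shows "module R (quot_module M N)"
proof -
  let ?Q = "quot_module M N"
  note s = smult_quot_module[OF N] add_quot_module[OF N] smult_closed M.add.m_closed
  have zero: "\<zero>\<^bsub>?Q\<^esub> = N +>\<^bsub>M\<^esub> \<zero>\<^bsub>M\<^esub>"
    using rcos_eq_self_iff[OF N M.zero_closed] submodule.axioms(1)[OF N]
    by (simp add: zero_quot_module subgroup.one_closed[of N "add_monoid M", simplified])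
  have ab: "abelian_group ?Q"
  proof (rule abelian_groupI)
    fix X Y Z
    assume "X \<in> carrier ?Q" "Y \<in> carrier ?Q" "Z \<in> carrier ?Q"
    then obtain x y z where x: "x \<in> carrier M" "y \<in> carrier M" "z \<in> carrier M"
      and X: "X = N +>\<^bsub>M\<^esub> x" "Y = N +>\<^bsub>M\<^esub> y" "Z = N +>\<^bsub>M\<^esub> z"
      by (auto simp: carrier_quot_module)
    show "X \<oplus>\<^bsub>?Q\<^esub> Y \<oplus>\<^bsub>?Q\<^esub> Z = X \<oplus>\<^bsub>?Q\<^esub> (Y \<oplus>\<^bsub>?Q\<^esub> Z)"
      using x by (simp add: X s M.a_assoc)
  next
    fix X Y assume "X \<in> carrier ?Q" "Y \<in> carrier ?Q"
    then obtain x y where x: "x \<in> carrier M" "y \<in> carrier M" and X: "X = N +>\<^bsub>M\<^esub> x" "Y = N +>\<^bsub>M\<^esub> y"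
      by (auto simp: carrier_quot_module)
    show "X \<oplus>\<^bsub>?Q\<^esub> Y \<in> carrier ?Q"
      using x by (simp add: X s carrier_quot_module)
    show "X \<oplus>\<^bsub>?Q\<^esub> Y = Y \<oplus>\<^bsub>?Q\<^esub> X"
      using x by (simp add: X s M.a_comm)
  next
    show "\<zero>\<^bsub>?Q\<^esub> \<in> carrier ?Q"
      by (auto simp: zero carrier_quot_module)
  next
    fix X assume "X \<in> carrier ?Q"
    then obtain x where x: "x \<in> carrier M" and X: "X = N +>\<^bsub>M\<^esub> x"
      by (auto simp: carrier_quot_module)
    show "\<zero>\<^bsub>?Q\<^esub> \<oplus>\<^bsub>?Q\<^esub> X = X"
      using x by (simp add: X s zero)
    show "\<exists>Y\<in>carrier ?Q. Y \<oplus>\<^bsub>?Q\<^esub> X = \<zero>\<^bsub>?Q\<^esub>"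
    proof
      show "(N +>\<^bsub>M\<^esub> (\<ominus>\<^bsub>M\<^esub> x)) \<oplus>\<^bsub>?Q\<^esub> X = \<zero>\<^bsub>?Q\<^esub>"
        using x by (simp add: X s zero M.l_neg)
      show "N +>\<^bsub>M\<^esub> (\<ominus>\<^bsub>M\<^esub> x) \<in> carrier ?Q"
        using x by (simp add: carrier_quot_module)
    qed
  qed
  show ?thesis
  proof (rule moduleI[OF R.cring_axioms ab])
    fix a b X assume ab: "a \<in> carrier R" "b \<in> carrier R" and "X \<in> carrier ?Q"
    then obtain x where x: "x \<in> carrier M" and X: "X = N +>\<^bsub>M\<^esub> x"
      by (auto simp: carrier_quot_module)
    show "(a \<oplus> b) \<odot>\<^bsub>?Q\<^esub> X = a \<odot>\<^bsub>?Q\<^esub> X \<oplus>\<^bsub>?Q\<^esub> b \<odot>\<^bsub>?Q\<^esub> X"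
      using ab x by (simp add: X s smult_l_distr)
    show "(a \<otimes> b) \<odot>\<^bsub>?Q\<^esub> X = a \<odot>\<^bsub>?Q\<^esub> (b \<odot>\<^bsub>?Q\<^esub> X)"
      using ab x by (simp add: X s smult_assoc1)
  next
    fix a X assume a: "a \<in> carrier R" and "X \<in> carrier ?Q"
    then obtain x where x: "x \<in> carrier M" and X: "X = N +>\<^bsub>M\<^esub> x"
      by (auto simp: carrier_quot_module)
    show "a \<odot>\<^bsub>?Q\<^esub> X \<in> carrier ?Q"
      using a x by (simp add: X s carrier_quot_module)
    fix Y assume "Y \<in> carrier ?Q"
    then obtain y where y: "y \<in> carrier M" and Y: "Y = N +>\<^bsub>M\<^esub> y"
      by (auto simp: carrier_quot_module)
    show "a \<odot>\<^bsub>?Q\<^esub> (X \<oplus>\<^bsub>?Q\<^esub> Y) = a \<odot>\<^bsub>?Q\<^esub> X \<oplus>\<^bsub>?Q\<^esub> a \<odot>\<^bsub>?Q\<^esub> Y"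
      using a x y by (simp add: X Y s smult_r_distr)
  next
    fix X assume "X \<in> carrier ?Q"
    then obtain x where x: "x \<in> carrier M" and X: "X = N +>\<^bsub>M\<^esub> x"
      by (auto simp: carrier_quot_module)
    show "\<one> \<odot>\<^bsub>?Q\<^esub> X = X"
      using x by (simp add: X s)
  qed
qed

end

section \<open>Regular sequences and the inequality of depth and dimension\<close>

context module
begin

text \<open>The ideal of the elements of \<open>R\<close> that map \<open>M\<close> into \<open>N\<close>, that is, the annihilator of \<open>M/N\<close>.\<close>

definition colon :: "'c set \<Rightarrow> 'a set" where
  "colon N = {a \<in> carrier R. \<forall>x\<in>carrier M. a \<odot>\<^bsub>M\<^esub> x \<in> N}"

lemma submodule_zero: "submodule {\<zero>\<^bsub>M\<^esub>} R M"
  by (rule submoduleI) auto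

lemma submodule_add_smult:
  assumes N: "submodule N R M" and f: "f \<in> carrier R"
  shows "submodule {n \<oplus>\<^bsub>M\<^esub> f \<odot>\<^bsub>M\<^esub> x | n x. n \<in> N \<and> x \<in> carrier M} R M" (is "submodule ?N R M")
proof (rule submoduleI)
  note E = submoduleE[OF N]
  have sub: "n \<in> carrier M" if "n \<in> N" for n using E(1) that by blast
  have zN: "\<zero>\<^bsub>M\<^esub> \<in> N" using subgroup.one_closed[OF submodule.axioms(1)[OF N]] by simp
  show "?N \<subseteq> carrier M" using f sub by auto
  have "\<zero>\<^bsub>M\<^esub> = \<zero>\<^bsub>M\<^esub> \<oplus>\<^bsub>M\<^esub> f \<odot>\<^bsub>M\<^esub> \<zero>\<^bsub>M\<^esub>" using f by simp
  then show "\<zero>\<^bsub>M\<^esub> \<in> ?N" using zN by blast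
next
  note E = submoduleE[OF N]
  have sub: "n \<in> carrier M" if "n \<in> N" for n using E(1) that by blast
  fix a assume "a \<in> ?N"
  then obtain n x where a: "a = n \<oplus>\<^bsub>M\<^esub> f \<odot>\<^bsub>M\<^esub> x" and n: "n \<in> N" and x: "x \<in> carrier M" by blast
  have "\<ominus>\<^bsub>M\<^esub> a = \<ominus>\<^bsub>M\<^esub> n \<oplus>\<^bsub>M\<^esub> f \<odot>\<^bsub>M\<^esub> (\<ominus>\<^bsub>M\<^esub> x)"
    using n x f sub by (simp add: a M.minus_add smult_r_minus)
  then show "\<ominus>\<^bsub>M\<^esub> a \<in> ?N" using E(3)[OF n] x by blast
  fix b assume "b \<in> ?N"
  then obtain m y where b: "b = m \<oplus>\<^bsub>M\<^esub> f \<odot>\<^bsub>M\<^esub> y" and m: "m \<in> N" and y: "y \<in> carrier M" by blast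
  have "a \<oplus>\<^bsub>M\<^esub> b = (n \<oplus>\<^bsub>M\<^esub> m) \<oplus>\<^bsub>M\<^esub> f \<odot>\<^bsub>M\<^esub> (x \<oplus>\<^bsub>M\<^esub> y)"
    using n m x y f sub by (simp add: a b smult_r_distr M.a_ac)
  then show "a \<oplus>\<^bsub>M\<^esub> b \<in> ?N" using E(5)[OF n m] x y by blast
next
  note E = submoduleE[OF N]
  have sub: "n \<in> carrier M" if "n \<in> N" for n using E(1) that by blast
  fix r a assume r: "r \<in> carrier R" and "a \<in> ?N"
  then obtain n x where a: "a = n \<oplus>\<^bsub>M\<^esub> f \<odot>\<^bsub>M\<^esub> x" and n: "n \<in> N" and x: "x \<in> carrier M" by blast
  have "r \<odot>\<^bsub>M\<^esub> (f \<odot>\<^bsub>M\<^esub> x) = f \<odot>\<^bsub>M\<^esub> (r \<odot>\<^bsub>M\<^esub> x)"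
    using r f x by (simp add: smult_assoc1[symmetric] R.m_comm)
  then have "r \<odot>\<^bsub>M\<^esub> a = r \<odot>\<^bsub>M\<^esub> n \<oplus>\<^bsub>M\<^esub> f \<odot>\<^bsub>M\<^esub> (r \<odot>\<^bsub>M\<^esub> x)"
    using n x f r sub by (simp add: a smult_r_distr)
  then show "r \<odot>\<^bsub>M\<^esub> a \<in> ?N" using E(4)[OF r n] x r by blast
qed

lemma seq_submodule_Nil: "seq_submodule M [] = {\<zero>\<^bsub>M\<^esub>}"
  by (auto simp: seq_submodule_def)

lemma seq_submodule_snoc:
  assumes fs: "set fs \<subseteq> carrier R" and f: "f \<in> carrier R"
  shows "seq_submodule M (fs @ [f]) = {n \<oplus>\<^bsub>M\<^esub> f \<odot>\<^bsub>M\<^esub> x | n x. n \<in> seq_submodule M fs \<and> x \<in> carrier M}"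
proof -
  let ?n = "length fs"
  have split: "(\<Oplus>\<^bsub>M\<^esub>i\<in>{..<length (fs @ [f])}. ((fs @ [f]) ! i) \<odot>\<^bsub>M\<^esub> m i) =
      (\<Oplus>\<^bsub>M\<^esub>i\<in>{..<?n}. (fs ! i) \<odot>\<^bsub>M\<^esub> m i) \<oplus>\<^bsub>M\<^esub> f \<odot>\<^bsub>M\<^esub> m ?n"
    if m: "m \<in> {..<Suc ?n} \<rightarrow> carrier M" for m
  proof -
    have c: "(fs ! i) \<odot>\<^bsub>M\<^esub> m i \<in> carrier M" if "i < ?n" for i
      using m fs that by (intro smult_closed) (auto simp: Pi_iff)
    have "(\<Oplus>\<^bsub>M\<^esub>i\<in>insert ?n {..<?n}. ((fs @ [f]) ! i) \<odot>\<^bsub>M\<^esub> m i) =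
        ((fs @ [f]) ! ?n) \<odot>\<^bsub>M\<^esub> m ?n \<oplus>\<^bsub>M\<^esub> (\<Oplus>\<^bsub>M\<^esub>i\<in>{..<?n}. ((fs @ [f]) ! i) \<odot>\<^bsub>M\<^esub> m i)"
      using c m f by (intro M.finsum_insert) (auto simp: nth_append Pi_iff)
    also have "(\<Oplus>\<^bsub>M\<^esub>i\<in>{..<?n}. ((fs @ [f]) ! i) \<odot>\<^bsub>M\<^esub> m i) = (\<Oplus>\<^bsub>M\<^esub>i\<in>{..<?n}. (fs ! i) \<odot>\<^bsub>M\<^esub> m i)"
      using c by (intro M.finsum_cong') (auto simp: nth_append)
    also have "((fs @ [f]) ! ?n) \<odot>\<^bsub>M\<^esub> m ?n \<oplus>\<^bsub>M\<^esub> \<dots> = \<dots> \<oplus>\<^bsub>M\<^esub> f \<odot>\<^bsub>M\<^esub> m ?n"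
      using c m f by (simp add: M.a_comm Pi_iff)
    finally show ?thesis by (simp add: lessThan_Suc)
  qed
  show ?thesis
  proof (intro equalityI subsetI)
    fix x assume "x \<in> seq_submodule M (fs @ [f])"
    then obtain m where m: "m \<in> {..<Suc ?n} \<rightarrow> carrier M"
      and x: "x = (\<Oplus>\<^bsub>M\<^esub>i\<in>{..<length (fs @ [f])}. ((fs @ [f]) ! i) \<odot>\<^bsub>M\<^esub> m i)"
      unfolding seq_submodule_def by auto
    have "(\<Oplus>\<^bsub>M\<^esub>i\<in>{..<?n}. (fs ! i) \<odot>\<^bsub>M\<^esub> m i) \<in> seq_submodule M fs"
      using m unfolding seq_submodule_def by (auto simp: Pi_iff)
    moreover have "m ?n \<in> carrier M" using m by auto
    ultimately show "x \<in> {n \<oplus>\<^bsub>M\<^esub> f \<odot>\<^bsub>M\<^esub> x | n x. n \<in> seq_submodule M fs \<and> x \<in> carrier M}"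
      unfolding x split[OF m] by blast
  next
    fix x assume "x \<in> {n \<oplus>\<^bsub>M\<^esub> f \<odot>\<^bsub>M\<^esub> x | n x. n \<in> seq_submodule M fs \<and> x \<in> carrier M}"
    then obtain n y where x: "x = n \<oplus>\<^bsub>M\<^esub> f \<odot>\<^bsub>M\<^esub> y" and n: "n \<in> seq_submodule M fs" and y: "y \<in> carrier M"
      by blast
    from n obtain m where m: "m \<in> {..<?n} \<rightarrow> carrier M"
      and n': "n = (\<Oplus>\<^bsub>M\<^esub>i\<in>{..<?n}. (fs ! i) \<odot>\<^bsub>M\<^esub> m i)"
      unfolding seq_submodule_def by blast
    let ?m = "m(?n := y)"
    have m': "?m \<in> {..<Suc ?n} \<rightarrow> carrier M" using m y by (auto simp: Pi_iff)
    have "(\<Oplus>\<^bsub>M\<^esub>i\<in>{..<?n}. (fs ! i) \<odot>\<^bsub>M\<^esub> ?m i) = n"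
      unfolding n' using m fs by (intro M.finsum_cong') (auto simp: Pi_iff intro!: smult_closed)
    then have "x = (\<Oplus>\<^bsub>M\<^esub>i\<in>{..<length (fs @ [f])}. ((fs @ [f]) ! i) \<odot>\<^bsub>M\<^esub> ?m i)"
      unfolding split[OF m'] x by simp
    moreover have "?m \<in> {..<length (fs @ [f])} \<rightarrow> carrier M" using m' by simp
    ultimately show "x \<in> seq_submodule M (fs @ [f])" unfolding seq_submodule_def by blast
  qed
qed

lemma submodule_seq_submodule: "set fs \<subseteq> carrier R \<Longrightarrow> submodule (seq_submodule M fs) R M"
proof (induction fs rule: rev_induct)
  case Nil
  then show ?case by (simp add: seq_submodule_Nil submodule_zero)
next
  case (snoc f fs)
  then show ?case using submodule_add_smult[of "seq_submodule M fs" f] seq_submodule_snoc[of fs f] by simp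
qed

text \<open>The iterated quotients in the definition of a regular sequence are traded for membership in
  submodules of \<open>M\<close>.\<close>

lemma regular_sequence_iff:
  "regular_sequence R M fs \<longleftrightarrow> set fs \<subseteq> carrier R \<and>
     (\<forall>k<length fs. \<forall>x\<in>carrier M. (fs ! k) \<odot>\<^bsub>M\<^esub> x \<in> seq_submodule M (take k fs) \<longrightarrow> x \<in> seq_submodule M (take k fs)) \<and>
     seq_submodule M fs \<noteq> carrier M"
proof (cases "set fs \<subseteq> carrier R")
  case True
  have eq: "(\<forall>X\<in>carrier (quot_module M (seq_submodule M (take k fs))).
        (fs ! k) \<odot>\<^bsub>quot_module M (seq_submodule M (take k fs))\<^esub> X
            = \<zero>\<^bsub>quot_module M (seq_submodule M (take k fs))\<^esub>
          \<longrightarrow> X = \<zero>\<^bsub>quot_module M (seq_submodule M (take k fs))\<^esub>) \<longleftrightarrow>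
     (\<forall>x\<in>carrier M. (fs ! k) \<odot>\<^bsub>M\<^esub> x \<in> seq_submodule M (take k fs) \<longrightarrow> x \<in> seq_submodule M (take k fs))"
    if k: "k < length fs" for k
  proof -
    have N: "submodule (seq_submodule M (take k fs)) R M"
      by (rule submodule_seq_submodule[OF subset_trans[OF set_take_subset True]])
    have f: "fs ! k \<in> carrier R" using True k by auto
    show ?thesis
      unfolding carrier_quot_module zero_quot_module ball_simps
      by (intro ball_cong refl) (simp only: smult_quot_module[OF N f] rcos_eq_self_iff[OF N] smult_closed[OF f])
  qed
  show ?thesis unfolding regular_sequence_def
    by (intro conj_cong refl all_cong) (rule eq)
next
  case False
  then show ?thesis by (simp add: regular_sequence_def)
qed

lemma ideal_colon:
  assumes N: "submodule N R M"
  shows "ideal (colon N) R"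
proof (rule idealI)
  note E = submoduleE[OF N]
  show "ring R" by (rule R.ring_axioms)
  show "subgroup (colon N) (add_monoid R)"
  proof (rule subgroup.intro)
    show "colon N \<subseteq> carrier (add_monoid R)" by (auto simp: colon_def)
    show "x \<otimes>\<^bsub>add_monoid R\<^esub> y \<in> colon N" if "x \<in> colon N" "y \<in> colon N" for x y
      using that E(5) by (auto simp: colon_def smult_l_distr)
    have "\<zero>\<^bsub>M\<^esub> \<in> N" using subgroup.one_closed[OF submodule.axioms(1)[OF N]] by simp
    then show "\<one>\<^bsub>add_monoid R\<^esub> \<in> colon N" by (auto simp: colon_def)
    have "\<ominus> x \<in> colon N" if "x \<in> colon N" for x
      using that E(3) by (auto simp: colon_def smult_l_minus)
    then show "inv\<^bsub>add_monoid R\<^esub> x \<in> colon N" if "x \<in> colon N" for x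
      using that by (simp add: a_inv_def)
  qed
next
  fix a x assume "a \<in> colon N" and x: "x \<in> carrier R"
  then show "x \<otimes> a \<in> colon N" using submoduleE(4)[OF N] by (auto simp: colon_def smult_assoc1)
  then show "a \<otimes> x \<in> colon N" using \<open>a \<in> colon N\<close> x by (simp add: colon_def R.m_comm)
qed

lemma annihilator_eq_colon: "annihilator R M = colon {\<zero>\<^bsub>M\<^esub>}"
  by (simp add: annihilator_def colon_def)

text \<open>The set of all \<open>s f\<^sup>n\<close> with \<open>s \<notin> P\<close> is multiplicative, and it avoids \<open>colon N\<close>: since \<open>f\<close> is regular on
  \<open>M/N\<close>, an element \<open>s f\<^sup>n\<close> of \<open>colon N\<close> would give \<open>s \<in> colon N \<subseteq> P\<close>. A prime above \<open>colon N\<close> that avoids this set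
  lies inside \<open>P\<close> and misses \<open>f\<close>.\<close>

lemma exists_smaller_prime:
  assumes N: "submodule N R M" and f: "f \<in> carrier R"
    and reg: "\<And>x. x \<in> carrier M \<Longrightarrow> f \<odot>\<^bsub>M\<^esub> x \<in> N \<Longrightarrow> x \<in> N"
    and P: "primeideal P R" "colon N \<subseteq> P" "f \<in> P"
  obtains Q where "primeideal Q R" "colon N \<subseteq> Q" "Q \<subset> P"
proof -
  interpret P: primeideal P R by (rule P(1))
  define T where "T = {s \<otimes> f [^] (n::nat) | s n. s \<in> carrier R - P}"
  have oneP: "\<one> \<notin> P" using P.one_imp_carrier P.I_notcarr by blast
  have powreg: "x \<in> N" if "x \<in> carrier M" "f [^] n \<odot>\<^bsub>M\<^esub> x \<in> N" for x and n :: nat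
    using that
  proof (induction n arbitrary: x)
    case (Suc n)
    have "f [^] n \<odot>\<^bsub>M\<^esub> (f \<odot>\<^bsub>M\<^esub> x) \<in> N" using Suc.prems f by (simp add: smult_assoc1)
    then have "f \<odot>\<^bsub>M\<^esub> x \<in> N" using Suc.IH f Suc.prems by simp
    then show ?case using reg Suc.prems by blast
  qed simp
  have "\<exists>Q. primeideal Q R \<and> colon N \<subseteq> Q \<and> Q \<inter> T = {}"
  proof (rule R.exists_primeideal_disjoint[OF ideal_colon[OF N], of T])
    show "T \<subseteq> carrier R" using f by (auto simp: T_def)
    have "\<one> = \<one> \<otimes> f [^] (0::nat)" by simp
    then show "\<one> \<in> T" using oneP unfolding T_def by blast
  next
    fix x y assume "x \<in> T" "y \<in> T"
    then obtain s t and n m :: nat where x: "s \<in> carrier R" "s \<notin> P" "x = s \<otimes> f [^] n"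
      and y: "t \<in> carrier R" "t \<notin> P" "y = t \<otimes> f [^] m" unfolding T_def by blast
    have "x \<otimes> y = (s \<otimes> t) \<otimes> f [^] (n + m)"
      using x(1) y(1) f by (simp add: x(3) y(3) R.nat_pow_mult[symmetric] R.m_ac)
    moreover have "s \<otimes> t \<in> carrier R - P" using P.I_prime x(1,2) y(1,2) by blast
    ultimately show "x \<otimes> y \<in> T" unfolding T_def by blast
  next
    show "colon N \<inter> T = {}"
    proof (rule ccontr)
      assume "colon N \<inter> T \<noteq> {}"
      then obtain s and n :: nat where s: "s \<in> carrier R" "s \<notin> P" "s \<otimes> f [^] n \<in> colon N"
        unfolding T_def by blast
      have "s \<odot>\<^bsub>M\<^esub> x \<in> N" if x: "x \<in> carrier M" for x
      proof -
        have "(s \<otimes> f [^] n) \<odot>\<^bsub>M\<^esub> x \<in> N" using s(3) x by (simp add: colon_def)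
        then have "f [^] n \<odot>\<^bsub>M\<^esub> (s \<odot>\<^bsub>M\<^esub> x) \<in> N"
          using s(1) f x by (simp add: R.m_comm[of s] smult_assoc1)
        then show ?thesis using powreg s(1) x by blast
      qed
      then have "s \<in> colon N" using s(1) by (simp add: colon_def)
      then show False using s(2) P(2) by blast
    qed
  qed blast
  then obtain Q where Q: "primeideal Q R" "colon N \<subseteq> Q" "Q \<inter> T = {}" by blast
  have "f \<in> T"
  proof -
    have "f = \<one> \<otimes> f [^] (1::nat)" using f by simp
    then show ?thesis using oneP unfolding T_def by blast
  qed
  moreover have "Q \<subseteq> P"
  proof
    fix q assume q: "q \<in> Q"
    then have qc: "q \<in> carrier R"
      using Q(1) by (meson additive_subgroup.a_Hcarr ideal.axioms(1) primeideal.axioms(1))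
    show "q \<in> P"
    proof (rule ccontr)
      assume "q \<notin> P"
      moreover have "q = q \<otimes> f [^] (0::nat)" using qc by simp
      ultimately have "q \<in> T" using qc unfolding T_def by blast
      then show False using Q(3) q by blast
    qed
  qed
  ultimately show thesis using that[OF Q(1,2)] Q(3) P(3) by blast
qed

text \<open>Every element of a weakly regular sequence yields one more step of a chain of primes below \<open>P\<close>.\<close>

lemma prime_chain_below:
  assumes "set fs \<subseteq> carrier R"
    and "\<And>k x. k < length fs \<Longrightarrow> x \<in> carrier M \<Longrightarrow> (fs ! k) \<odot>\<^bsub>M\<^esub> x \<in> seq_submodule M (take k fs)
      \<Longrightarrow> x \<in> seq_submodule M (take k fs)"
    and "primeideal P R" "colon (seq_submodule M fs) \<subseteq> P"
  shows "\<exists>C. (\<forall>i\<le>length fs. primeideal (C i) R \<and> annihilator R M \<subseteq> C i) \<and>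
    (\<forall>i<length fs. C i \<subset> C (Suc i)) \<and> C (length fs) = P"
  using assms
proof (induction fs arbitrary: P rule: rev_induct)
  case Nil
  then show ?case
    by (intro exI[of _ "\<lambda>_. P"]) (simp add: seq_submodule_Nil annihilator_eq_colon)
next
  case (snoc f fs)
  let ?N = "seq_submodule M fs"
  have f: "f \<in> carrier R" and fs: "set fs \<subseteq> carrier R" using snoc.prems(1) by auto
  have N: "submodule ?N R M" by (rule submodule_seq_submodule[OF fs])
  have Nc: "n \<in> carrier M" if "n \<in> ?N" for n using submoduleE(1)[OF N] that by blast
  have zN: "\<zero>\<^bsub>M\<^esub> \<in> ?N" using subgroup.one_closed[OF submodule.axioms(1)[OF N]] by simp
  have "n \<in> seq_submodule M (fs @ [f])" if "n \<in> ?N" for n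
  proof -
    have "n = n \<oplus>\<^bsub>M\<^esub> f \<odot>\<^bsub>M\<^esub> \<zero>\<^bsub>M\<^esub>" using Nc that f by simp
    then show ?thesis unfolding seq_submodule_snoc[OF fs f] using that by blast
  qed
  then have "colon ?N \<subseteq> colon (seq_submodule M (fs @ [f]))" by (auto simp: colon_def)
  then have 1: "colon ?N \<subseteq> P" using snoc.prems(4) by blast
  have "f \<odot>\<^bsub>M\<^esub> x \<in> seq_submodule M (fs @ [f])" if "x \<in> carrier M" for x
  proof -
    have "f \<odot>\<^bsub>M\<^esub> x = \<zero>\<^bsub>M\<^esub> \<oplus>\<^bsub>M\<^esub> f \<odot>\<^bsub>M\<^esub> x" using f that by simp
    then show ?thesis unfolding seq_submodule_snoc[OF fs f] using that zN by blast
  qed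
  then have 2: "f \<in> P" using snoc.prems(4) f by (auto simp: colon_def)
  have 3: "x \<in> ?N" if "x \<in> carrier M" "f \<odot>\<^bsub>M\<^esub> x \<in> ?N" for x
    using snoc.prems(2)[of "length fs" x] that by simp
  obtain Q where Q: "primeideal Q R" "colon ?N \<subseteq> Q" "Q \<subset> P"
    by (rule exists_smaller_prime[OF N f 3 snoc.prems(3) 1 2])
  have reg: "x \<in> seq_submodule M (take k fs)"
    if "k < length fs" "x \<in> carrier M" "(fs ! k) \<odot>\<^bsub>M\<^esub> x \<in> seq_submodule M (take k fs)" for k x
    using snoc.prems(2)[of k x] that by (simp add: nth_append)
  obtain C where C: "\<forall>i\<le>length fs. primeideal (C i) R \<and> annihilator R M \<subseteq> C i"
    "\<forall>i<length fs. C i \<subset> C (Suc i)" "C (length fs) = Q"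
    using snoc.IH[OF fs reg Q(1,2)] by blast
  let ?C = "C(Suc (length fs) := P)"
  have "annihilator R M \<subseteq> P" using C(1,3) Q(3) by blast
  then have "(\<forall>i\<le>Suc (length fs). primeideal (?C i) R \<and> annihilator R M \<subseteq> ?C i)"
    using C(1) snoc.prems(3) by (simp add: le_Suc_eq)
  moreover have "\<forall>i<Suc (length fs). ?C i \<subset> ?C (Suc i)"
    using C(2,3) Q(3) by (simp add: less_Suc_eq)
  ultimately show ?case by (intro exI[of _ ?C]) simp
qed

theorem depth_le_module_dim: "depth R J M \<le> module_dim R M"
proof -
  have "ereal (real (length fs)) \<le> module_dim R M" if reg: "regular_sequence R M fs" for fs
  proof -
    note reg = reg[unfolded regular_sequence_iff]
    have N: "submodule (seq_submodule M fs) R M" using reg by (intro submodule_seq_submodule) blast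
    have "\<one> \<notin> colon (seq_submodule M fs)"
      using reg submoduleE(1)[OF N] by (auto simp: colon_def)
    then obtain P where P: "primeideal P R" "colon (seq_submodule M fs) \<subseteq> P"
      using R.exists_primeideal_disjoint[OF ideal_colon[OF N], of "{\<one>}"] by auto
    obtain C where "(\<forall>i\<le>length fs. primeideal (C i) R \<and> annihilator R M \<subseteq> C i) \<and>
      (\<forall>i<length fs. C i \<subset> C (Suc i))"
      using prime_chain_below[OF _ _ P] reg by blast
    moreover have "ideal (annihilator R M) R"
      unfolding annihilator_eq_colon by (rule ideal_colon[OF submodule_zero])
    ultimately show ?thesis
      unfolding module_dim_def R.krull_dim_quot[OF \<open>ideal (annihilator R M) R\<close>]
      by (intro Sup_upper) blast
  qed
  then show ?thesis unfolding depth_def by (intro Sup_least) blast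
qed

end

section \<open>Weakly regular sequences on subquotients of a commutative ring\<close>

text \<open>Additive subgroups of the additive group of a type, without a ring record. The sums and multiples of
  subsets below are those of the set algebra, so \<open>C + f *o B\<close> is the subgroup \<open>C + fB\<close>.\<close>

definition add_subgroup :: "'a::ab_group_add set \<Rightarrow> bool" where
  "add_subgroup A \<longleftrightarrow> 0 \<in> A \<and> (\<forall>x\<in>A. \<forall>y\<in>A. x + y \<in> A) \<and> (\<forall>x\<in>A. - x \<in> A)"

lemma add_subgroupD:
  assumes "add_subgroup A"
  shows "0 \<in> A" "x \<in> A \<Longrightarrow> y \<in> A \<Longrightarrow> x + y \<in> A" "x \<in> A \<Longrightarrow> - x \<in> A" "x \<in> A \<Longrightarrow> y \<in> A \<Longrightarrow> x - y \<in> A"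
  using assms unfolding add_subgroup_def diff_conv_add_uminus by blast+

lemma add_subgroup_plus:
  assumes A: "add_subgroup A" and B: "add_subgroup B"
  shows "add_subgroup (A + B)"
  unfolding add_subgroup_def
proof (intro conjI ballI)
  show "0 \<in> A + B" using set_plus_intro[OF add_subgroupD(1)[OF A] add_subgroupD(1)[OF B]] by simp
next
  fix x y assume "x \<in> A + B" "y \<in> A + B"
  then obtain a b c d where "x = a + b" "y = c + d" "a \<in> A" "b \<in> B" "c \<in> A" "d \<in> B"
    by (metis set_plus_elim)
  then have "x + y = (a + c) + (b + d)" "a + c \<in> A" "b + d \<in> B"
    using add_subgroupD(2)[OF A] add_subgroupD(2)[OF B] by (simp_all add: algebra_simps)
  then show "x + y \<in> A + B" by (metis set_plus_intro)
next
  fix x assume "x \<in> A + B"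
  then obtain a b where "x = a + b" "a \<in> A" "b \<in> B" by (metis set_plus_elim)
  then have "- x = - a + - b" "- a \<in> A" "- b \<in> B"
    using add_subgroupD(3)[OF A] add_subgroupD(3)[OF B] by simp_all
  then show "- x \<in> A + B" by (metis set_plus_intro)
qed

lemma add_subgroup_mult:
  fixes A :: "'r::comm_ring_1 set"
  assumes A: "add_subgroup A"
  shows "add_subgroup (f *o A)"
  unfolding add_subgroup_def
proof (intro conjI ballI)
  have "f * 0 \<in> f *o A" using add_subgroupD(1)[OF A] by (rule set_times_intro2)
  then show "0 \<in> f *o A" by simp
next
  fix x y assume "x \<in> f *o A" "y \<in> f *o A"
  then obtain a b where ab: "a \<in> A" "b \<in> A" "x = f * a" "y = f * b" by (auto simp: elt_set_times_def)
  have "f * (a + b) \<in> f *o A" using add_subgroupD(2)[OF A ab(1,2)] by (rule set_times_intro2)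
  then show "x + y \<in> f *o A" by (simp add: ab algebra_simps)
next
  fix x assume "x \<in> f *o A"
  then obtain a where a: "a \<in> A" "x = f * a" by (auto simp: elt_set_times_def)
  have "f * (- a) \<in> f *o A" using add_subgroupD(3)[OF A a(1)] by (rule set_times_intro2)
  then show "- x \<in> f *o A" by (simp add: a)
qed

lemma plus_absorb:
  assumes B: "add_subgroup B" and A: "A \<subseteq> B" "0 \<in> A"
  shows "A + B = B" "B + A = B"
proof -
  show "A + B = B"
  proof
    show "A + B \<subseteq> B" using add_subgroupD(2)[OF B] A by (auto elim!: set_plus_elim)
    show "B \<subseteq> A + B" using set_zero_plus2[OF A(2)] .
  qed
  then show "B + A = B" by (simp add: add.commute)
qed

text \<open>The list is a regular sequence on the module \<open>B/C\<close>, except that the final quotient may be zero.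
  Passing to \<open>B/C\<close> modulo \<open>f\<close> replaces \<open>C\<close> by \<open>C + fB\<close>; the numerator \<open>B\<close> stays the same.\<close>

fun weakly_regular :: "'r::comm_ring_1 list \<Rightarrow> 'r set \<Rightarrow> 'r set \<Rightarrow> bool" where
  "weakly_regular [] C B \<longleftrightarrow> True"
| "weakly_regular (f # fs) C B \<longleftrightarrow> (\<forall>x\<in>B. f * x \<in> C \<longrightarrow> x \<in> C) \<and> weakly_regular fs (C + f *o B) B"

text \<open>The subgroup \<open>C + f\<^sub>1B + \<dots> + f\<^sub>kB\<close>.\<close>

definition plus_multiples :: "'r::comm_ring_1 set \<Rightarrow> 'r set \<Rightarrow> 'r list \<Rightarrow> 'r set" where
  "plus_multiples B C fs = foldl (\<lambda>C f. C + f *o B) C fs"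

lemma plus_multiples_simps:
  "plus_multiples B C [] = C"
  "plus_multiples B C (f # fs) = plus_multiples B (C + f *o B) fs"
  "plus_multiples B C (fs @ [f]) = plus_multiples B C fs + f *o B"
  by (simp_all add: plus_multiples_def)

lemma weakly_regularD:
  assumes "weakly_regular fs C B" "k < length fs" "x \<in> B"
    "fs ! k * x \<in> plus_multiples B C (take k fs)"
  shows "x \<in> plus_multiples B C (take k fs)"
  using assms
proof (induction fs arbitrary: C k)
  case (Cons f fs)
  then show ?case by (cases k) (auto simp: plus_multiples_simps)
qed simp

text \<open>Invariance under the isomorphism of \<open>B/(B \<inter> C)\<close> with \<open>(B + C)/C\<close>.\<close>

lemma weakly_regular_plus:
  assumes "add_subgroup B" "add_subgroup C" "\<And>f. f \<in> set fs \<Longrightarrow> f *o B \<subseteq> B" "\<And>f. f \<in> set fs \<Longrightarrow> f *o C \<subseteq> C"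
    and "weakly_regular fs (B \<inter> C) B"
  shows "weakly_regular fs C (B + C)"
  using assms
proof (induction fs arbitrary: C)
  case (Cons f fs)
  note B = Cons.prems(1) and C = Cons.prems(2)
  have fB: "f * x \<in> B" if "x \<in> B" for x using Cons.prems(3)[of f] that by auto
  have fC: "f * x \<in> C" if "x \<in> C" for x using Cons.prems(4)[of f] that by auto
  have "x \<in> C" if x: "x \<in> B + C" "f * x \<in> C" for x
  proof -
    obtain b c where bc: "x = b + c" "b \<in> B" "c \<in> C" using x(1) by (rule set_plus_elim)
    have "f * b = f * x - f * c" by (simp add: bc algebra_simps)
    then have "f * b \<in> C" using add_subgroupD(4)[OF C x(2) fC[OF bc(3)]] by metis
    then have "f * b \<in> B \<inter> C" using fB[OF bc(2)] by blast
    then have "b \<in> C" using Cons.prems(5) bc(2) by auto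
    then show ?thesis using bc add_subgroupD(2)[OF C] by simp
  qed
  moreover have "weakly_regular fs (C + f *o (B + C)) (B + C)"
  proof -
    let ?C = "C + f *o B"
    have fBg: "add_subgroup (f *o B)" by (rule add_subgroup_mult[OF B])
    have "f *o C \<subseteq> C" using fC by (auto simp: elt_set_times_def)
    then have "C + f *o C = C"
      using plus_absorb(2)[OF C] add_subgroupD(1)[OF add_subgroup_mult[OF C]] by simp
    then have 1: "C + f *o (B + C) = ?C"
      unfolding set_times_plus_distrib2 by (metis add.assoc add.commute)
    have "f *o B \<subseteq> B" using fB by (auto simp: elt_set_times_def)
    then have "B + f *o B = B" using plus_absorb(2)[OF B] add_subgroupD(1)[OF fBg] by simp
    then have 2: "B + ?C = B + C" by (metis add.assoc add.commute)
    have 3: "B \<inter> ?C = (B \<inter> C) + f *o B"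
    proof (intro equalityI subsetI)
      fix x assume "x \<in> B \<inter> ?C"
      then obtain c b where x: "x \<in> B" "x = c + f * b" "c \<in> C" "b \<in> B"
        by (auto simp: set_plus_def elt_set_times_def)
      then have "c = x - f * b" by simp
      then have "c \<in> B" using add_subgroupD(4)[OF B x(1) fB[OF x(4)]] by metis
      then show "x \<in> (B \<inter> C) + f *o B" using x by (auto simp: elt_set_times_def)
    next
      fix x assume "x \<in> (B \<inter> C) + f *o B"
      then obtain c b where "x = c + f * b" "c \<in> B" "c \<in> C" "b \<in> B"
        by (auto simp: set_plus_def elt_set_times_def)
      then show "x \<in> B \<inter> ?C"
        using fB add_subgroupD(2)[OF B] by (auto simp: elt_set_times_def)
    qed
    have stab: "g *o ?C \<subseteq> ?C" if "g \<in> set fs" for g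
    proof -
      have "g *o ?C = g *o C + f *o (g *o B)"
        by (simp add: set_times_plus_distrib2 set_times_rearrange2 mult.commute)
      also have "\<dots> \<subseteq> ?C"
        using that Cons.prems(3,4)[of g] set_plus_mono2 set_times_mono by (metis list.set_intros(2))
      finally show ?thesis .
    qed
    have "weakly_regular fs (B \<inter> ?C) B" using Cons.prems(5) by (simp add: 3)
    then have "weakly_regular fs ?C (B + ?C)"
      using Cons.prems(3) stab by (intro Cons.IH B add_subgroup_plus C fBg) auto
    then show ?thesis by (simp add: 1 2)
  qed
  ultimately show ?case by simp
qed simp

text \<open>A sequence that is weakly regular on the submodule \<open>N\<^sub>1/N\<^sub>0\<close> and on the quotient \<open>N\<^sub>2/N\<^sub>1\<close> is so on
  \<open>N\<^sub>2/N\<^sub>0\<close>. In the induction step the submodule becomes \<open>(N\<^sub>1 + fN\<^sub>2)/(N\<^sub>0 + fN\<^sub>2)\<close>, which is isomorphic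
  to \<open>N\<^sub>1/(N\<^sub>0 + fN\<^sub>1)\<close> because \<open>f\<close> is regular on \<open>N\<^sub>2/N\<^sub>1\<close>.\<close>

lemma weakly_regular_trans:
  assumes "add_subgroup N0" "add_subgroup N1" "add_subgroup N2" "N0 \<subseteq> N1" "N1 \<subseteq> N2"
    and "\<And>f. f \<in> set fs \<Longrightarrow> f *o N0 \<subseteq> N0" "\<And>f. f \<in> set fs \<Longrightarrow> f *o N1 \<subseteq> N1" "\<And>f. f \<in> set fs \<Longrightarrow> f *o N2 \<subseteq> N2"
    and "weakly_regular fs N0 N1" "weakly_regular fs N1 N2"
  shows "weakly_regular fs N0 N2"
  using assms
proof (induction fs arbitrary: N0 N1)
  case (Cons f fs)
  note N = Cons.prems(1-3)
  have fN: "f * x \<in> N2" if "x \<in> N2" for x using Cons.prems(8)[of f] that by auto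
  have reg1: "x \<in> N0" if "x \<in> N1" "f * x \<in> N0" for x using Cons.prems(9) that by simp
  have reg2: "x \<in> N1" if "x \<in> N2" "f * x \<in> N1" for x using Cons.prems(10) that by simp
  have "x \<in> N0" if "x \<in> N2" "f * x \<in> N0" for x using that reg1 reg2 Cons.prems(4) by blast
  moreover have "weakly_regular fs (N0 + f *o N2) N2"
  proof (rule Cons.IH[where ?N1.0 = "N1 + f *o N2"])
    have fN2: "add_subgroup (f *o N2)" by (rule add_subgroup_mult[OF N(3)])
    show sg: "add_subgroup (N0 + f *o N2)" "add_subgroup (N1 + f *o N2)" "add_subgroup N2"
      by (intro add_subgroup_plus N fN2)+
    show "N0 + f *o N2 \<subseteq> N1 + f *o N2" using Cons.prems(4) by (intro set_plus_mono2) auto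
    show "N1 + f *o N2 \<subseteq> N2"
      using Cons.prems(5) fN add_subgroupD(2)[OF N(3)] by (auto elim!: set_plus_elim simp: elt_set_times_def)
    have comm: "g *o (f *o N2) = f *o (g *o N2)" for g
      by (simp add: set_times_rearrange2 mult.commute)
    show stab: "g *o (N0 + f *o N2) \<subseteq> N0 + f *o N2" "g *o (N1 + f *o N2) \<subseteq> N1 + f *o N2" "g *o N2 \<subseteq> N2"
      if "g \<in> set fs" for g
      unfolding set_times_plus_distrib2 comm
      using that Cons.prems(6-8)[of g] set_plus_mono2 set_times_mono by (metis list.set_intros(2))+
    show "weakly_regular fs (N1 + f *o N2) N2" using Cons.prems(10) by simp
    \<comment> \<open>this is where regularity of \<open>f\<close> on \<open>N\<^sub>2/N\<^sub>1\<close> is used\<close>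
    have eq: "N1 \<inter> (N0 + f *o N2) = N0 + f *o N1"
    proof (intro equalityI subsetI)
      fix x assume "x \<in> N1 \<inter> (N0 + f *o N2)"
      then obtain n y where x: "x \<in> N1" "x = n + f * y" "n \<in> N0" "y \<in> N2"
        by (auto simp: set_plus_def elt_set_times_def)
      then have "f * y = x - n" by simp
      moreover have "n \<in> N1" using x(3) Cons.prems(4) by blast
      ultimately have "f * y \<in> N1" using add_subgroupD(4)[OF N(2) x(1)] by metis
      then have "y \<in> N1" using reg2 x by blast
      then show "x \<in> N0 + f *o N1" using x by (auto simp: elt_set_times_def)
    next
      fix x assume "x \<in> N0 + f *o N1"
      then obtain n y where x: "x = n + f * y" "n \<in> N0" "y \<in> N1"
        by (auto simp: set_plus_def elt_set_times_def)
      moreover have "f * y \<in> N1" using Cons.prems(7)[of f] x by auto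
      ultimately show "x \<in> N1 \<inter> (N0 + f *o N2)"
        using Cons.prems(4,5) add_subgroupD(2)[OF N(2)] by (auto simp: elt_set_times_def)
    qed
    have "weakly_regular fs (N0 + f *o N2) (N1 + (N0 + f *o N2))"
    proof (rule weakly_regular_plus[OF N(2) sg(1)])
      show "weakly_regular fs (N1 \<inter> (N0 + f *o N2)) N1" using Cons.prems(9) by (simp add: eq)
    qed (use Cons.prems(7) stab in auto)
    moreover have "N1 + N0 = N1"
      by (rule plus_absorb(2)[OF N(2) Cons.prems(4) add_subgroupD(1)[OF N(1)]])
    ultimately show "weakly_regular fs (N0 + f *o N2) (N1 + f *o N2)" by (simp add: add.assoc[symmetric])
  qed
  ultimately show ?case by simp
qed simp

section \<open>Modules presented as subquotients of a ring\<close>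

text \<open>The module \<open>Q\<close> is isomorphic to \<open>B/C\<close>, where \<open>C \<subseteq> B\<close> are closed under addition and under
  multiplication by \<open>R\<close>, inside a type whose addition, multiplication
  and zero are those of \<open>R\<close>; the isomorphism is induced by \<open>\<phi>\<close>,
  whose values outside \<open>B\<close> are irrelevant. Closure of \<open>C\<close> under multiplication follows from the other axioms.\<close>

locale presented_module = module R Q for R :: "('r::comm_ring_1, 'z) ring_scheme" and Q :: "('r, 'm, 'y) module_scheme" +
  fixes B C :: "'r set" and \<phi> :: "'r \<Rightarrow> 'm"
  assumes ring_ops: "monoid.mult R = (*)" "add R = (+)" "zero R = 0"
    and add_subgroups: "add_subgroup B" "add_subgroup C" and CB: "C \<subseteq> B"
    and mult_B: "a \<in> carrier R \<Longrightarrow> x \<in> B \<Longrightarrow> a * x \<in> B"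
    and surj: "\<phi> ` B = carrier Q"
    and hom_add: "x \<in> B \<Longrightarrow> y \<in> B \<Longrightarrow> \<phi> (x + y) = \<phi> x \<oplus>\<^bsub>Q\<^esub> \<phi> y"
    and hom_smult: "a \<in> carrier R \<Longrightarrow> x \<in> B \<Longrightarrow> \<phi> (a * x) = a \<odot>\<^bsub>Q\<^esub> \<phi> x"
    and kernel: "x \<in> B \<Longrightarrow> \<phi> x = \<zero>\<^bsub>Q\<^esub> \<longleftrightarrow> x \<in> C"
begin

lemma phi_closed: "x \<in> B \<Longrightarrow> \<phi> x \<in> carrier Q"
  using surj by blast

lemma phi_eqD:
  assumes "x \<in> B" "y \<in> B" "\<phi> x = \<phi> y"
  shows "x - y \<in> C"
proof -
  have mB: "- y \<in> B" using add_subgroupD(3)[OF add_subgroups(1)] assms by blast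
  have "\<phi> (x - y) = \<phi> x \<oplus>\<^bsub>Q\<^esub> \<phi> (- y)" using hom_add[OF assms(1) mB] by simp
  also have "\<dots> = \<phi> (y - y)" using hom_add[OF assms(2) mB] assms(3) by simp
  also have "\<dots> = \<zero>\<^bsub>Q\<^esub>"
    using kernel add_subgroupD(1)[OF add_subgroups(1)] add_subgroupD(1)[OF add_subgroups(2)] by simp
  finally show ?thesis
    using kernel add_subgroupD(4)[OF add_subgroups(1) assms(1,2)] by simp
qed

lemma phi_zero: "\<phi> 0 = \<zero>\<^bsub>Q\<^esub>"
  using kernel add_subgroupD(1)[OF add_subgroups(1)] add_subgroupD(1)[OF add_subgroups(2)] by simp

lemma phi_mem_seq_submodule:
  assumes "set fs \<subseteq> carrier R" "x \<in> B"
  shows "\<phi> x \<in> seq_submodule Q fs \<longleftrightarrow> x \<in> plus_multiples B C fs"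
  using assms
proof (induction fs arbitrary: x rule: rev_induct)
  case Nil
  then show ?case by (simp add: seq_submodule_Nil plus_multiples_simps kernel)
next
  case (snoc f fs)
  let ?P = "plus_multiples B C fs"
  have f: "f \<in> carrier R" and fs: "set fs \<subseteq> carrier R" using snoc.prems by auto
  have sub: "\<exists>y\<in>B. n = \<phi> y" if "n \<in> seq_submodule Q fs" for n
    using submoduleE(1)[OF submodule_seq_submodule[OF fs]] surj that by blast
  have P: "C \<subseteq> ?P \<and> add_subgroup ?P \<and> ?P \<subseteq> B" if "set gs \<subseteq> carrier R" "?P = plus_multiples B C gs" for gs
    unfolding that(2) using that(1)
  proof (induction gs rule: rev_induct)
    case Nil then show ?case using add_subgroups CB by (simp add: plus_multiples_simps)
  next
    case (snoc g gs)
    let ?G = "plus_multiples B C gs"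
    have gB: "add_subgroup (g *o B)" by (rule add_subgroup_mult[OF add_subgroups(1)])
    have "g *o B \<subseteq> B" using snoc.prems mult_B by (auto simp: elt_set_times_def)
    moreover have "?G \<subseteq> B" "add_subgroup ?G" "C \<subseteq> ?G" using snoc by auto
    moreover have "?G \<subseteq> ?G + g *o B"
      using set_zero_plus2[OF add_subgroupD(1)[OF gB], of ?G] by (simp add: add.commute)
    moreover have "add_subgroup (?G + g *o B)" by (intro add_subgroup_plus gB \<open>add_subgroup ?G\<close>)
    moreover have "?G + g *o B \<subseteq> B + B" by (intro set_plus_mono2 \<open>g *o B \<subseteq> B\<close> \<open>?G \<subseteq> B\<close>)
    moreover have "B + B = B" using plus_absorb(1)[OF add_subgroups(1)] add_subgroupD(1)[OF add_subgroups(1)] by blast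
    ultimately show ?case unfolding plus_multiples_simps by blast
  qed
  note P = P[OF fs refl]
  show ?case
  proof
    assume "\<phi> x \<in> seq_submodule Q (fs @ [f])"
    then obtain n q where n: "n \<in> seq_submodule Q fs" and q: "q \<in> carrier Q" and x: "\<phi> x = n \<oplus>\<^bsub>Q\<^esub> f \<odot>\<^bsub>Q\<^esub> q"
      unfolding seq_submodule_snoc[OF fs f] by blast
    obtain y where y: "y \<in> B" "n = \<phi> y" using sub[OF n] by blast
    obtain z where z: "z \<in> B" "q = \<phi> z" using q surj by blast
    have fz: "f * z \<in> B" using mult_B f z by blast
    have yz: "y + f * z \<in> B" using y fz add_subgroupD(2)[OF add_subgroups(1)] by blast
    have "\<phi> x = \<phi> (y + f * z)" using x y z f fz by (simp add: hom_add hom_smult)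
    then have "x - (y + f * z) \<in> C" by (rule phi_eqD[OF snoc.prems(2) yz])
    then have "x - (y + f * z) \<in> ?P" using P by blast
    moreover have "y \<in> ?P" using snoc.IH[OF fs y(1)] n y(2) by simp
    ultimately have "x - (y + f * z) + y \<in> ?P" using P add_subgroupD(2) by blast
    then have "(x - (y + f * z) + y) + f * z \<in> ?P + f *o B"
      using z(1) by (intro set_plus_intro) auto
    then show "x \<in> plus_multiples B C (fs @ [f])" by (simp add: plus_multiples_simps)
  next
    assume "x \<in> plus_multiples B C (fs @ [f])"
    then obtain y z where x: "x = y + f * z" "y \<in> ?P" "z \<in> B"
      by (auto simp: plus_multiples_simps set_plus_def elt_set_times_def)
    have yB: "y \<in> B" using P x(2) by blast
    then have "\<phi> y \<in> seq_submodule Q fs" using snoc.IH[OF fs] x(2) by blast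
    moreover have "\<phi> x = \<phi> y \<oplus>\<^bsub>Q\<^esub> f \<odot>\<^bsub>Q\<^esub> \<phi> z"
      using x yB f mult_B by (simp add: hom_add hom_smult)
    ultimately show "\<phi> x \<in> seq_submodule Q (fs @ [f])"
      unfolding seq_submodule_snoc[OF fs f] using phi_closed[OF x(3)] by blast
  qed
qed

lemma regular_sequenceI:
  assumes fs: "set fs \<subseteq> carrier R" and reg: "weakly_regular fs C B"
    and ne: "\<not> B \<subseteq> plus_multiples B C fs"
  shows "regular_sequence R Q fs"
  unfolding regular_sequence_iff
proof (intro conjI allI impI ballI)
  fix k x assume k: "k < length fs" and x: "x \<in> carrier Q" "fs ! k \<odot>\<^bsub>Q\<^esub> x \<in> seq_submodule Q (take k fs)"
  have tk: "set (take k fs) \<subseteq> carrier R" by (rule subset_trans[OF set_take_subset fs])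
  have f: "fs ! k \<in> carrier R" using fs k by (simp add: subset_iff)
  obtain y where y: "y \<in> B" "x = \<phi> y" using x(1) surj by blast
  have "\<phi> (fs ! k * y) \<in> seq_submodule Q (take k fs)" using x(2) y f by (simp add: hom_smult)
  then have "fs ! k * y \<in> plus_multiples B C (take k fs)"
    using phi_mem_seq_submodule[OF tk mult_B[OF f y(1)]] by blast
  then have "y \<in> plus_multiples B C (take k fs)" by (rule weakly_regularD[OF reg k y(1)])
  then show "x \<in> seq_submodule Q (take k fs)" using phi_mem_seq_submodule[OF tk y(1)] y(2) by blast
next
  obtain x where x: "x \<in> B" "x \<notin> plus_multiples B C fs" using ne by blast
  then have "\<phi> x \<notin> seq_submodule Q fs" using phi_mem_seq_submodule[OF fs x(1)] by blast
  then show "seq_submodule Q fs \<noteq> carrier Q" using phi_closed[OF x(1)] by blast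
qed (rule fs)

lemma annihilator_eq: "annihilator R Q = {a \<in> carrier R. \<forall>x\<in>B. a * x \<in> C}"
proof -
  have "(\<forall>x\<in>carrier Q. a \<odot>\<^bsub>Q\<^esub> x = \<zero>\<^bsub>Q\<^esub>) \<longleftrightarrow> (\<forall>x\<in>B. a * x \<in> C)" if a: "a \<in> carrier R" for a
    unfolding surj[symmetric] ball_simps
    by (intro ball_cong refl) (simp only: hom_smult[OF a, symmetric] kernel[OF mult_B[OF a]])
  then show ?thesis unfolding annihilator_def by (intro Collect_cong conj_cong refl)
qed

lemma hom_sum:
  assumes "finite I" "\<And>i. i \<in> I \<Longrightarrow> g i \<in> B"
  shows "sum g I \<in> B \<and> \<phi> (sum g I) = (\<Oplus>\<^bsub>Q\<^esub>i\<in>I. \<phi> (g i))"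
  using assms
proof (induction I)
  case empty
  then show ?case using add_subgroupD(1)[OF add_subgroups(1)] by (simp add: phi_zero)
next
  case (insert i I)
  then have B: "sum g I \<in> B" "g i \<in> B" and eq: "\<phi> (sum g I) = (\<Oplus>\<^bsub>Q\<^esub>i\<in>I. \<phi> (g i))" by auto
  have "(\<Oplus>\<^bsub>Q\<^esub>i\<in>insert i I. \<phi> (g i)) = \<phi> (g i) \<oplus>\<^bsub>Q\<^esub> (\<Oplus>\<^bsub>Q\<^esub>i\<in>I. \<phi> (g i))"
    using insert.hyps insert.prems by (intro finsum_insert) (auto intro: phi_closed)
  then show ?case
    using insert.hyps hom_add[OF B(2,1)] eq add_subgroupD(2)[OF add_subgroups(1) B(2,1)] by simp
qed

lemma finitely_generatedI:
  assumes A: "finite A" "A \<subseteq> B"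
    and gen: "\<And>x. x \<in> B \<Longrightarrow> \<exists>c. (\<forall>a\<in>A. c a \<in> carrier R) \<and> x - (\<Sum>a\<in>A. c a * a) \<in> C"
  shows "finitely_generated R Q"
  unfolding finitely_generated_def
proof (intro exI[of _ "\<phi> ` A"] conjI ballI)
  show "finite (\<phi> ` A)" "\<phi> ` A \<subseteq> carrier Q" using A phi_closed by auto
  fix q assume "q \<in> carrier Q"
  then obtain x where x: "x \<in> B" "q = \<phi> x" using surj by blast
  obtain c where c: "\<And>a. a \<in> A \<Longrightarrow> c a \<in> carrier R" and xc: "x - (\<Sum>a\<in>A. c a * a) \<in> C"
    using gen[OF x(1)] by blast
  have caB: "c a * a \<in> B" if "a \<in> A" for a using c mult_B A that by blast
  have SB: "(\<Sum>a\<in>S. c a * a) \<in> B" if "S \<subseteq> A" for S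
    using hom_sum[of S "\<lambda>a. c a * a"] caB that finite_subset[OF that A(1)] by blast
  have "\<phi> x = \<phi> (x - (\<Sum>a\<in>A. c a * a)) \<oplus>\<^bsub>Q\<^esub> \<phi> (\<Sum>a\<in>A. c a * a)"
    using hom_add[of "x - (\<Sum>a\<in>A. c a * a)" "\<Sum>a\<in>A. c a * a"] SB xc CB by auto
  also have "\<dots> = \<phi> (\<Sum>a\<in>A. c a * a)"
    using kernel[of "x - (\<Sum>a\<in>A. c a * a)"] xc CB phi_closed[OF SB[OF order_refl]] by auto
  finally have q: "q = \<phi> (\<Sum>a\<in>A. c a * a)" using x by simp
  \<comment> \<open>different generators may have the same image, so their coefficients are added up\<close>
  define d where "d y = (\<Sum>a\<in>{a\<in>A. \<phi> a = y}. c a)" for y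
  have block: "sum c S \<in> carrier R \<and> \<phi> (\<Sum>a\<in>S. c a * a) = sum c S \<odot>\<^bsub>Q\<^esub> y"
    if "finite S" "S \<subseteq> A" "\<And>a. a \<in> S \<Longrightarrow> \<phi> a = y" "y \<in> carrier Q" for S y
    using that
  proof (induction S)
    case empty
    have "0 \<in> carrier R" using R.zero_closed ring_ops by simp
    moreover have "0 \<odot>\<^bsub>Q\<^esub> y = \<zero>\<^bsub>Q\<^esub>" using smult_l_null[of y] empty ring_ops by simp
    ultimately show ?case by (simp add: phi_zero)
  next
    case (insert a S)
    then have IH: "sum c S \<in> carrier R" "\<phi> (\<Sum>a\<in>S. c a * a) = sum c S \<odot>\<^bsub>Q\<^esub> y"
      and a: "a \<in> A" "\<phi> a = y" and S: "S \<subseteq> A" by auto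
    have ca: "c a \<in> carrier R" using c a by blast
    have "c a + sum c S \<in> carrier R" using R.add.m_closed[OF ca IH(1)] ring_ops by simp
    moreover have "\<phi> (c a * a + (\<Sum>a\<in>S. c a * a)) = (c a + sum c S) \<odot>\<^bsub>Q\<^esub> y"
      using hom_add[OF caB[OF a(1)] SB[OF S]] hom_smult[OF ca] a A IH smult_l_distr[OF ca IH(1) insert.prems(3)] ring_ops
      by auto
    ultimately show ?case using insert.hyps by simp
  qed
  have dc: "d y \<in> carrier R" and dblock: "\<phi> (\<Sum>a\<in>{a\<in>A. \<phi> a = y}. c a * a) = d y \<odot>\<^bsub>Q\<^esub> y"
    if y: "y \<in> \<phi> ` A" for y
  proof -
    have "y \<in> carrier Q" using y A(2) phi_closed by blast
    moreover have "finite {a\<in>A. \<phi> a = y}" "{a\<in>A. \<phi> a = y} \<subseteq> A" using A(1) by auto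
    ultimately show "d y \<in> carrier R" "\<phi> (\<Sum>a\<in>{a\<in>A. \<phi> a = y}. c a * a) = d y \<odot>\<^bsub>Q\<^esub> y"
      using block[of "{a\<in>A. \<phi> a = y}" y] unfolding d_def by blast+
  qed
  have "(\<Sum>a\<in>A. c a * a) = (\<Sum>y\<in>\<phi> ` A. \<Sum>a\<in>{a\<in>A. \<phi> a = y}. c a * a)"
    by (rule sum.image_gen[OF A(1)])
  then have "q = \<phi> (\<Sum>y\<in>\<phi> ` A. \<Sum>a\<in>{a\<in>A. \<phi> a = y}. c a * a)" using q by simp
  also have "\<dots> = (\<Oplus>\<^bsub>Q\<^esub>y\<in>\<phi> ` A. \<phi> (\<Sum>a\<in>{a\<in>A. \<phi> a = y}. c a * a))"
    using hom_sum[OF finite_imageI[OF A(1)] SB[OF Collect_restrict]] by (rule conjunct2)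
  also have "\<dots> = (\<Oplus>\<^bsub>Q\<^esub>y\<in>\<phi> ` A. d y \<odot>\<^bsub>Q\<^esub> y)"
  proof (rule finsum_cong'[OF refl])
    show "(\<lambda>y. d y \<odot>\<^bsub>Q\<^esub> y) \<in> \<phi> ` A \<rightarrow> carrier Q" using dc A(2) phi_closed by (intro funcsetI smult_closed) auto
    show "\<phi> (\<Sum>a\<in>{a\<in>A. \<phi> a = y}. c a * a) = d y \<odot>\<^bsub>Q\<^esub> y" if "y \<in> \<phi> ` A" for y
      by (rule dblock[OF that])
  qed
  finally have "q = (\<Oplus>\<^bsub>Q\<^esub>a\<in>\<phi> ` A. d a \<odot>\<^bsub>Q\<^esub> a)" .
  moreover have "d \<in> \<phi> ` A \<rightarrow> carrier R" by (rule funcsetI) (rule dc)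
  ultimately show "\<exists>c\<in>\<phi> ` A \<rightarrow> carrier R. q = (\<Oplus>\<^bsub>Q\<^esub>a\<in>\<phi> ` A. c a \<odot>\<^bsub>Q\<^esub> a)" ..
qed

end

section \<open>Ideals spanned by monomials\<close>

abbreviation keys :: "('a \<Rightarrow>\<^sub>0 'b::zero) \<Rightarrow> 'a set" where
  "keys \<equiv> Poly_Mapping.keys"

abbreviation lookup :: "('a \<Rightarrow>\<^sub>0 'b::zero) \<Rightarrow> 'a \<Rightarrow> 'b" where
  "lookup \<equiv> Poly_Mapping.lookup"

abbreviation single :: "'a \<Rightarrow> 'b \<Rightarrow> ('a \<Rightarrow>\<^sub>0 'b::zero)" where
  "single \<equiv> Poly_Mapping.single"

text \<open>Exponent vectors of the monomials in the variables \<open>V\<close>.\<close>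

definition mons :: "'v set \<Rightarrow> ('v \<Rightarrow>\<^sub>0 nat) set" where
  "mons V = {m. keys m \<subseteq> V}"

text \<open>The linear span of a set of monomials, as the set of polynomials all of whose monomials lie in it.\<close>

definition mon_span :: "('v \<Rightarrow>\<^sub>0 nat) set \<Rightarrow> ('v, 'k::field) mpoly set" where
  "mon_span U = {p. keys p \<subseteq> U}"

text \<open>Sets of monomials in the variables \<open>V\<close> closed under multiplication by such monomials; their spans
  are the monomial ideals.\<close>

definition upset :: "'v set \<Rightarrow> ('v \<Rightarrow>\<^sub>0 nat) set \<Rightarrow> bool" where
  "upset V U \<longleftrightarrow> U \<subseteq> mons V \<and> (\<forall>t\<in>mons V. \<forall>m\<in>U. t + m \<in> U)"

text \<open>The exponents of the multiples of the monomial \<open>a\<close> by monomials in the variables \<open>F\<close>.\<close>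

definition cone :: "('v \<Rightarrow>\<^sub>0 nat) \<Rightarrow> 'v set \<Rightarrow> ('v \<Rightarrow>\<^sub>0 nat) set" where
  "cone a F = (+) a ` mons F"

text \<open>The part of a polynomial that is supported on a given set of monomials.\<close>

definition mon_restrict :: "('v \<Rightarrow>\<^sub>0 nat) set \<Rightarrow> ('v, 'k::field) mpoly \<Rightarrow> ('v, 'k) mpoly" where
  "mon_restrict X p = (\<Sum>m\<in>keys p \<inter> X. single m (lookup p m))"

text \<open>The exponent vector of a squarefree monomial; meaningful for finite \<open>A\<close>.\<close>

definition set_mon :: "'v set \<Rightarrow> 'v \<Rightarrow>\<^sub>0 nat" where
  "set_mon A = (\<Sum>v\<in>A. single v 1)"

lemma keys_add_nat: "keys (a + b) = keys a \<union> keys (b :: 'v \<Rightarrow>\<^sub>0 nat)"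
  by (auto simp: in_keys_iff lookup_add)

lemma mons_add_iff: "a + b \<in> mons V \<longleftrightarrow> a \<in> mons V \<and> b \<in> mons V"
  by (simp add: mons_def keys_add_nat)

lemma zero_in_mons: "0 \<in> mons V"
  by (simp add: mons_def)

lemma mons_mono: "F \<subseteq> V \<Longrightarrow> mons F \<subseteq> mons V"
  by (auto simp: mons_def)

lemma upset_mons: "upset V (mons V)"
  by (simp add: upset_def mons_add_iff)

lemma lookup_set_mon: "finite A \<Longrightarrow> lookup (set_mon A) v = (if v \<in> A then 1 else 0)"
  by (simp add: set_mon_def lookup_sum lookup_single when_def)

lemma keys_set_mon: "finite A \<Longrightarrow> keys (set_mon A) = A"
  by (auto simp: in_keys_iff lookup_set_mon split: if_splits)

lemma set_mon_insert: "finite A \<Longrightarrow> v \<notin> A \<Longrightarrow> set_mon (insert v A) = single v 1 + set_mon A"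
  by (simp add: set_mon_def)

lemma set_mon_empty: "set_mon {} = 0"
  by (simp add: set_mon_def)

lemma mon_decomp_set_mon:
  assumes "finite A" "A \<subseteq> keys m"
  obtains b where "m = set_mon A + b" "keys b \<subseteq> keys m"
proof
  show eq: "m = set_mon A + (m - set_mon A)"
    using assms by (intro poly_mapping_eqI) (auto simp: lookup_add lookup_minus lookup_set_mon in_keys_iff subset_iff)
  show "keys (m - set_mon A) \<subseteq> keys m"
    by (subst (2) eq) (simp add: keys_add_nat)
qed

lemma lookup_mon_restrict: "lookup (mon_restrict X p) m = (if m \<in> X then lookup p m else 0)"
proof -
  have "lookup (mon_restrict X p) m = (\<Sum>n\<in>keys p \<inter> X. if n = m then lookup p n else 0)"
    by (simp add: mon_restrict_def lookup_sum lookup_single when_def)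
  also have "\<dots> = (if m \<in> X then lookup p m else 0)"
    by (auto simp: sum.delta in_keys_iff)
  finally show ?thesis .
qed

lemma keys_mon_restrict: "keys (mon_restrict X p) = keys p \<inter> X"
  by (auto simp: in_keys_iff lookup_mon_restrict split: if_splits)

lemma mon_restrict_split: "p = mon_restrict (- X) p + mon_restrict X p"
  by (rule poly_mapping_eqI) (simp add: lookup_add lookup_mon_restrict)

lemma mon_restrict_id: "keys p \<subseteq> X \<Longrightarrow> mon_restrict X p = p"
  by (rule poly_mapping_eqI) (auto simp: lookup_mon_restrict in_keys_iff)

lemma poly_eq_sum_single: "(p :: ('v, 'k::field) mpoly) = (\<Sum>m\<in>keys p. single m (lookup p m))"
  using mon_restrict_id[of p UNIV] by (simp add: mon_restrict_def)

lemma lookup_single_mult: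
  "lookup (single t c * (p :: ('v, 'k::field) mpoly)) (t + m) = c * lookup p m"
proof -
  have "single t c * p = (\<Sum>n\<in>keys p. single (t + n) (c * lookup p n))"
    by (subst (1) poly_eq_sum_single) (simp add: sum_distrib_left mult_single)
  then have "lookup (single t c * p) (t + m) = (\<Sum>n\<in>keys p. if n = m then c * lookup p n else 0)"
    by (simp add: lookup_sum lookup_single when_def)
  also have "\<dots> = c * lookup p m"
    by (auto simp: sum.delta in_keys_iff)
  finally show ?thesis .
qed

lemma keys_single_mult: "keys (single t c * (p :: ('v, 'k::field) mpoly)) \<subseteq> (+) t ` keys p"
  using keys_mult[of "single t c" p] by (auto split: if_splits)

lemma add_subgroup_mon_span: "add_subgroup (mon_span U)"
  using keys_add unfolding add_subgroup_def mon_span_def by (auto simp: keys_minus dest: subsetD[OF keys_add])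

lemma add_subgroup_sum:
  assumes "add_subgroup A" "\<And>i. i \<in> I \<Longrightarrow> g i \<in> A"
  shows "sum g I \<in> A"
  using assms(2) by (induction I rule: infinite_finite_induct) (auto intro: add_subgroupD[OF assms(1)])

lemma mon_span_mono: "U \<subseteq> U' \<Longrightarrow> mon_span U \<subseteq> mon_span U'"
  by (auto simp: mon_span_def)

lemma single_in_mon_span: "m \<in> U \<Longrightarrow> single m c \<in> mon_span U"
  by (simp add: mon_span_def)

lemma single_in_mon_span_iff: "c \<noteq> 0 \<Longrightarrow> single m c \<in> mon_span U \<longleftrightarrow> m \<in> U"
  by (simp add: mon_span_def)

lemma mon_restrict_in_mon_span: "p \<in> mon_span U \<Longrightarrow> mon_restrict X p \<in> mon_span (U \<inter> X)"
  by (auto simp: mon_span_def keys_mon_restrict)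

lemma mult_in_mon_span:
  assumes "upset V U" "p \<in> mon_span (mons V)" "x \<in> mon_span U"
  shows "p * x \<in> mon_span U"
proof -
  have "keys (p * x) \<subseteq> {a + b | a b. a \<in> keys p \<and> b \<in> keys x}" by (rule keys_mult)
  also have "\<dots> \<subseteq> U" using assms unfolding mon_span_def upset_def by blast
  finally show ?thesis by (simp add: mon_span_def)
qed

lemma mult_set_mon_span:
  assumes "upset V U" "p \<in> mon_span (mons V)"
  shows "p *o mon_span U \<subseteq> mon_span U"
  using mult_in_mon_span[OF assms] by (auto simp: elt_set_times_def)

lemma mon_span_translate: "mon_span ((+) t ` U) = single t 1 *o (mon_span U :: ('v, 'k::field) mpoly set)"
proof (intro equalityI subsetI)
  fix p :: "('v, 'k) mpoly" assume p: "p \<in> mon_span ((+) t ` U)"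
  then obtain g where g: "\<And>m. m \<in> keys p \<Longrightarrow> m = t + g m \<and> g m \<in> U"
    unfolding mon_span_def by (metis (no_types, lifting) image_iff mem_Collect_eq subset_iff)
  define z where "z = (\<Sum>m\<in>keys p. single (g m) (lookup p m))"
  have "single t 1 * z = (\<Sum>m\<in>keys p. single (t + g m) (lookup p m))"
    by (simp add: z_def sum_distrib_left mult_single)
  also have "\<dots> = (\<Sum>m\<in>keys p. single m (lookup p m))"
    using g by (intro sum.cong) auto
  also have "\<dots> = p" by (rule poly_eq_sum_single[symmetric])
  finally have "p = single t 1 * z" by simp
  moreover have "z \<in> mon_span U"
  proof -
    have "keys z \<subseteq> (\<Union>m\<in>keys p. keys (single (g m) (lookup p m)))"
      unfolding z_def by (rule keys_sum)
    also have "\<dots> \<subseteq> U" using g by (auto split: if_splits)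
    finally show ?thesis by (simp add: mon_span_def)
  qed
  ultimately show "p \<in> single t 1 *o mon_span U" by auto
next
  fix p :: "('v, 'k) mpoly" assume "p \<in> single t 1 *o mon_span U"
  then obtain z where "p = single t 1 * z" "z \<in> mon_span U" by (auto simp: elt_set_times_def)
  then show "p \<in> mon_span ((+) t ` U)" using keys_single_mult[of t 1 z] unfolding mon_span_def by blast
qed

lemma cone_translate: "(+) t ` cone a F = cone (a + t) F"
  by (auto simp: cone_def image_image ac_simps)

lemma cone_shift_subset: "keys c \<subseteq> F \<Longrightarrow> cone (a + c) F \<subseteq> cone a F"
proof
  fix m assume c: "keys c \<subseteq> F" and "m \<in> cone (a + c) F"
  then obtain b where "b \<in> mons F" "m = a + (c + b)" by (auto simp: cone_def ac_simps)
  moreover have "c + b \<in> mons F" using c \<open>b \<in> mons F\<close> by (simp add: mons_add_iff) (simp add: mons_def)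
  ultimately show "m \<in> cone a F" by (auto simp: cone_def)
qed

lemma add_in_cone_iff:
  assumes "m \<in> cone a F"
  shows "t + m \<in> cone a F \<longleftrightarrow> keys t \<subseteq> F"
proof -
  obtain b where b: "m = a + b" "keys b \<subseteq> F" using assms by (auto simp: cone_def mons_def)
  have "t + m = a + (t + b)" by (simp add: b ac_simps)
  then have "t + m \<in> cone a F \<longleftrightarrow> t + b \<in> mons F" by (auto simp: cone_def)
  then show ?thesis using b by (simp add: mons_def keys_add_nat)
qed

section \<open>Filtrations by cones of monomials\<close>

text \<open>There are upsets \<open>U = U\<^sub>0 \<subseteq> \<dots> \<subseteq> U\<^sub>s = U'\<close> such that every \<open>U\<^sub>j\<^sub>+\<^sub>1\<close> arises from \<open>U\<^sub>j\<close> by the addition of a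
  disjoint cone over a \<open>d\<close>-element set \<open>F\<close> of variables; meaningful for finite \<open>V\<close>. 
  The subquotient of monomial ideals belonging to a single cone is, up to a shift, the polynomial ring in the variables \<open>F\<close>.\<close>

inductive cone_filtration :: "'v set \<Rightarrow> nat \<Rightarrow> ('v \<Rightarrow>\<^sub>0 nat) set \<Rightarrow> ('v \<Rightarrow>\<^sub>0 nat) set \<Rightarrow> bool"
  for V d where
  base: "upset V U \<Longrightarrow> cone_filtration V d U U"
| add_cone: "cone_filtration V d U U1 \<Longrightarrow> upset V U2 \<Longrightarrow> F \<subseteq> V \<Longrightarrow> card F = d \<Longrightarrow>
    U1 \<inter> cone a F = {} \<Longrightarrow> U2 = U1 \<union> cone a F \<Longrightarrow> cone_filtration V d U U2"

lemma cone_filtration_upset: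
  "cone_filtration V d U U' \<Longrightarrow> upset V U \<and> upset V U' \<and> U \<subseteq> U'"
  by (induction rule: cone_filtration.induct) auto

lemma upset_add_subcone:
  assumes U1: "upset V U1" and U2: "upset V (U1 \<union> cone a F)"
    and disj: "U1 \<inter> cone a F = {}" and c: "keys c \<subseteq> F"
  shows "upset V (U1 \<union> cone (a + c) F)"
  unfolding upset_def
proof (intro conjI ballI)
  note sub = cone_shift_subset[OF c, of a]
  show "U1 \<union> cone (a + c) F \<subseteq> mons V" using sub U2 by (auto simp: upset_def)
  fix t m assume t: "t \<in> mons V" and m: "m \<in> U1 \<union> cone (a + c) F"
  show "t + m \<in> U1 \<union> cone (a + c) F"
  proof (cases "m \<in> U1")
    case True
    then show ?thesis using U1 t by (auto simp: upset_def)
  next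
    case False
    then have mc: "m \<in> cone (a + c) F" "m \<in> cone a F" using m sub by auto
    have "t + m \<in> U1 \<union> cone a F" using U2 t mc by (auto simp: upset_def)
    then show ?thesis using add_in_cone_iff[OF mc(1), of t] add_in_cone_iff[OF mc(2), of t] by auto
  qed
qed

text \<open>The cone over \<open>F\<close> with apex \<open>a\<close>, without its subcone of multiples of \<open>x\<^sup>F\<close>, is the union of
  the cones with apexes \<open>a, a + u\<^sub>1, a + u\<^sub>1 + u\<^sub>2, \<dots>\<close> over \<open>F - {u\<^sub>1}, F - {u\<^sub>2}, \<dots>\<close>, where \<open>u\<^sub>1, u\<^sub>2, \<dots>\<close>
  are the elements of \<open>F\<close>. They are added to the subcone in the reverse order.\<close>

lemma cone_filtration_subcone:
  assumes U1: "upset V U1" and U2: "upset V (U1 \<union> cone a F)"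
    and disj: "U1 \<inter> cone a F = {}" and F: "F \<subseteq> V" "finite F" "card F = Suc d"
  shows "cone_filtration V d (U1 \<union> cone (a + set_mon F) F) (U1 \<union> cone a F)"
proof -
  have "cone_filtration V d (U1 \<union> cone (a + set_mon F) F) (U1 \<union> cone (a + set_mon (F - K)) F)"
    if "finite K" "K \<subseteq> F" for K
    using that
  proof (induction K)
    case empty
    then show ?case
      using upset_add_subcone[OF U1 U2 disj, of "set_mon F"] F by (auto intro: cone_filtration.base simp: keys_set_mon)
  next
    case (insert u K)
    define H where "H = F - insert u K"
    have H: "F - K = insert u H" "u \<notin> H" "finite H" "H \<subseteq> F" "u \<in> F"
      using insert F by (auto simp: H_def)
    let ?a = "a + set_mon H"
    have split: "cone ?a F = cone (a + set_mon (insert u H)) F \<union> cone ?a (F - {u})"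
    proof (intro equalityI subsetI)
      fix m assume "m \<in> cone ?a F"
      then obtain b where b: "m = ?a + b" "keys b \<subseteq> F" by (auto simp: cone_def mons_def)
      show "m \<in> cone (a + set_mon (insert u H)) F \<union> cone ?a (F - {u})"
      proof (cases "u \<in> keys b")
        case True
        then obtain b' where b': "b = set_mon {u} + b'" "keys b' \<subseteq> keys b"
          using mon_decomp_set_mon[of "{u}" b] by auto
        have "m = (a + set_mon (insert u H)) + b'"
          using H by (simp add: b b' set_mon_insert set_mon_empty ac_simps)
        moreover have "b' \<in> mons F" using b b' by (auto simp: mons_def)
        ultimately show ?thesis by (simp add: cone_def)
      next
        case False
        then have "b \<in> mons (F - {u})" using b by (auto simp: mons_def)
        then show ?thesis using b by (simp add: cone_def)
      qed
    next
      fix m assume m: "m \<in> cone (a + set_mon (insert u H)) F \<union> cone ?a (F - {u})"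
      have "a + set_mon (insert u H) = ?a + single u 1" using H by (simp add: set_mon_insert ac_simps)
      then have "cone (a + set_mon (insert u H)) F \<subseteq> cone ?a F"
        using cone_shift_subset[of "single u 1" F ?a] H by simp
      moreover have "cone ?a (F - {u}) \<subseteq> cone ?a F" by (auto simp: cone_def mons_def)
      ultimately show "m \<in> cone ?a F" using m by blast
    qed
    have disj2: "cone (a + set_mon (insert u H)) F \<inter> cone ?a (F - {u}) = {}"
    proof (rule ccontr)
      assume "cone (a + set_mon (insert u H)) F \<inter> cone ?a (F - {u}) \<noteq> {}"
      then obtain b c where "(a + set_mon (insert u H)) + b = ?a + c" "keys c \<subseteq> F - {u}"
        by (auto simp: cone_def mons_def)
      then have "?a + (single u 1 + b) = ?a + c" "u \<notin> keys c" using H by (auto simp: set_mon_insert ac_simps)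
      then have "single u 1 + b = c" by simp
      then have "u \<in> keys c" by (auto simp: keys_add_nat)
      then show False using \<open>u \<notin> keys c\<close> by blast
    qed
    have sub: "cone ?a F \<subseteq> cone a F" using H by (intro cone_shift_subset) (simp add: keys_set_mon)
    show ?case unfolding H_def[symmetric]
    proof (rule cone_filtration.add_cone)
      show "cone_filtration V d (U1 \<union> cone (a + set_mon F) F) (U1 \<union> cone (a + set_mon (F - K)) F)"
        using insert by simp
      show "upset V (U1 \<union> cone ?a F)"
        using H by (intro upset_add_subcone[OF U1 U2 disj]) (simp add: keys_set_mon)
      show "F - {u} \<subseteq> V" using F by blast
      show "card (F - {u}) = d" using F H by simp
      show "(U1 \<union> cone (a + set_mon (F - K)) F) \<inter> cone ?a (F - {u}) = {}"
        using disj disj2 sub split unfolding H(1) by blast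
      show "U1 \<union> cone ?a F = U1 \<union> cone (a + set_mon (F - K)) F \<union> cone ?a (F - {u})"
        using split unfolding H(1) by blast
    qed
  qed
  from this[of F] show ?thesis using F by (simp add: set_mon_empty)
qed

section \<open>Elementary symmetric polynomials as a regular sequence\<close>

text \<open>The \<open>j\<close>-th elementary symmetric polynomial in the variables \<open>V\<close>; meaningful for finite \<open>V\<close>.\<close>

definition elem_sym :: "'v set \<Rightarrow> nat \<Rightarrow> ('v, 'k::field) mpoly" where
  "elem_sym V j = (\<Sum>A | A \<subseteq> V \<and> card A = j. single (set_mon A) 1)"

text \<open>The list of \<open>e\<^sub>d, \<dots>, e\<^sub>1\<close>, with the highest degree first.\<close>

fun elem_syms :: "'v set \<Rightarrow> nat \<Rightarrow> ('v, 'k::field) mpoly list" where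
  "elem_syms V 0 = []"
| "elem_syms V (Suc d) = elem_sym V (Suc d) # elem_syms V d"

lemma length_elem_syms: "length (elem_syms V d) = d"
  by (induction d) auto

lemma set_elem_syms: "set (elem_syms V d) = elem_sym V ` {1..d}"
  by (induction d) (auto simp: atLeastAtMostSuc_conv)

lemma keys_elem_sym:
  assumes "finite V" "m \<in> keys (elem_sym V j :: ('v, 'k::field) mpoly)"
  obtains A where "A \<subseteq> V" "card A = j" "m = set_mon A"
proof -
  have "keys (elem_sym V j :: ('v, 'k) mpoly) \<subseteq> (\<Union>A\<in>{A. A \<subseteq> V \<and> card A = j}. keys (single (set_mon A) (1::'k)))"
    unfolding elem_sym_def by (rule keys_sum)
  then show thesis using assms that by auto
qed

lemma elem_sym_in_mon_span: "finite V \<Longrightarrow> elem_sym V j \<in> mon_span (mons V)"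
  unfolding elem_sym_def
  by (intro add_subgroup_sum[OF add_subgroup_mon_span] single_in_mon_span)
    (auto simp: mons_def keys_set_mon finite_subset)

context
  fixes V F :: "'v set" and U1 U2 :: "('v \<Rightarrow>\<^sub>0 nat) set" and a :: "'v \<Rightarrow>\<^sub>0 nat"
  assumes V: "finite V" and U1: "upset V U1" and U2: "upset V U2" and U2_eq: "U2 = U1 \<union> cone a F"
    and disj: "U1 \<inter> cone a F = {}" and F: "F \<subseteq> V"
begin

text \<open>Modulo \<open>U\<^sub>1\<close>, the polynomial \<open>e\<close> of degree \<open>|F|\<close> acts on the cone as the monomial \<open>x\<^sup>F\<close>: any other
  squarefree monomial of this degree involves a variable outside \<open>F\<close> and so leads out of the cone.\<close>

lemma elem_sym_mult_cone:
  fixes x :: "('v, 'k::field) mpoly"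
  assumes x: "x \<in> mon_span (cone a F)"
  shows "elem_sym V (card F) * x - single (set_mon F) 1 * x \<in> mon_span U1"
proof -
  let ?S = "{A. A \<subseteq> V \<and> card A = card F}"
  have fin: "finite ?S" using V by simp
  have "elem_sym V (card F) * x - single (set_mon F) 1 * x = (\<Sum>A\<in>?S - {F}. single (set_mon A) 1 * x)"
    using F fin by (simp add: elem_sym_def sum_distrib_right sum.remove[of ?S F] distrib_right)
  moreover have "single (set_mon A) 1 * x \<in> mon_span U1" if A: "A \<in> ?S - {F}" for A
  proof -
    have fA: "finite A" using A V finite_subset by blast
    have "set_mon A + m \<in> U1" if m: "m \<in> keys x" for m
    proof -
      have mc: "m \<in> cone a F" using m x by (auto simp: mon_span_def)
      have "set_mon A \<in> mons V" using A fA by (simp add: mons_def keys_set_mon)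
      then have "set_mon A + m \<in> U2" using U2 U2_eq mc unfolding upset_def by blast
      moreover have "\<not> A \<subseteq> F"
        using A F V card_subset_eq[of F A] finite_subset by auto
      then have "set_mon A + m \<notin> cone a F" using add_in_cone_iff[OF mc] fA by (simp add: keys_set_mon)
      ultimately show ?thesis using U2_eq by blast
    qed
    then show ?thesis using keys_single_mult[of "set_mon A" 1 x] by (auto simp: mon_span_def)
  qed
  then have "(\<Sum>A\<in>?S - {F}. single (set_mon A) 1 * x) \<in> mon_span U1"
    by (rule add_subgroup_sum[OF add_subgroup_mon_span])
  ultimately show ?thesis by simp
qed

lemma elem_sym_nonzerodivisor:
  fixes x :: "('v, 'k::field) mpoly"
  assumes x: "x \<in> mon_span U2" and ex: "elem_sym V (card F) * x \<in> mon_span U1"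
  shows "x \<in> mon_span U1"
proof -
  let ?e = "elem_sym V (card F) :: ('v, 'k) mpoly" and ?f = "single (set_mon F) 1 :: ('v, 'k) mpoly"
  let ?y = "mon_restrict (- cone a F) x" and ?z = "mon_restrict (cone a F) x"
  note sg = add_subgroupD[OF add_subgroup_mon_span[of U1]]
  have fF: "finite F" using F V finite_subset by blast
  have split: "x = ?y + ?z" by (rule mon_restrict_split)
  have y: "?y \<in> mon_span U1"
    using x U2_eq by (auto simp: mon_span_def keys_mon_restrict)
  have z: "?z \<in> mon_span (cone a F)" by (simp add: mon_span_def keys_mon_restrict)
  have "?e * ?y \<in> mon_span U1" by (rule mult_in_mon_span[OF U1 elem_sym_in_mon_span[OF V] y])
  then have "?e * x - ?e * ?y - (?e * ?z - ?f * ?z) \<in> mon_span U1"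
    by (rule sg(4)[OF sg(4)[OF ex] elem_sym_mult_cone[OF z]])
  moreover have "?e * x = ?e * ?y + ?e * ?z" by (subst split) (rule distrib_left)
  ultimately have fz: "?f * ?z \<in> mon_span U1" by simp
  have "keys ?z = {}"
  proof (rule ccontr)
    assume "keys ?z \<noteq> {}"
    then obtain m where m: "m \<in> keys ?z" by blast
    then have mc: "m \<in> cone a F" using z by (auto simp: mon_span_def)
    have "lookup (?f * ?z) (set_mon F + m) \<noteq> 0"
      using m by (simp only: lookup_single_mult in_keys_iff) simp
    then have "set_mon F + m \<in> U1" using fz by (auto simp: mon_span_def in_keys_iff)
    moreover have "set_mon F + m \<in> cone a F" using add_in_cone_iff[OF mc] fF by (simp add: keys_set_mon)
    ultimately show False using disj by blast
  qed
  then have "?z = 0" by simp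
  then show ?thesis using y split by simp
qed

lemma elem_sym_quotient:
  "mon_span U1 + elem_sym V (card F) *o mon_span U2 =
    (mon_span (U1 \<union> cone (a + set_mon F) F) :: ('v, 'k::field) mpoly set)"
proof -
  let ?e = "elem_sym V (card F) :: ('v, 'k) mpoly" and ?f = "single (set_mon F) 1 :: ('v, 'k) mpoly"
  let ?T = "cone (a + set_mon F) F"
  note sg1 = add_subgroupD[OF add_subgroup_mon_span[of U1]]
  note sgT = add_subgroupD[OF add_subgroup_mon_span[of "U1 \<union> ?T"]]
  have T: "mon_span ?T = ?f *o mon_span (cone a F)"
    unfolding mon_span_translate[symmetric] cone_translate ..
  have sub1: "mon_span U1 \<subseteq> mon_span (U1 \<union> ?T)" and sub2: "mon_span ?T \<subseteq> mon_span (U1 \<union> ?T)"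
    by (intro mon_span_mono; blast)+
  show ?thesis
  proof (intro equalityI subsetI)
    fix p assume "p \<in> mon_span U1 + ?e *o mon_span U2"
    then obtain c x where p: "p = c + ?e * x" "c \<in> mon_span U1" "x \<in> mon_span U2"
      by (auto simp: set_plus_def elt_set_times_def)
    let ?y = "mon_restrict (- cone a F) x" and ?z = "mon_restrict (cone a F) x"
    have split: "x = ?y + ?z" by (rule mon_restrict_split)
    have y: "?y \<in> mon_span U1"
      using p U2_eq by (auto simp: mon_span_def keys_mon_restrict)
    have z: "?z \<in> mon_span (cone a F)" by (simp add: mon_span_def keys_mon_restrict)
    have ey: "?e * ?y \<in> mon_span U1" by (rule mult_in_mon_span[OF U1 elem_sym_in_mon_span[OF V] y])
    have "?e * x = ?e * ?y + ?e * ?z" by (subst split) (rule distrib_left)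
    then have "p = c + ?e * ?y + (?e * ?z - ?f * ?z) + ?f * ?z" by (simp add: p(1))
    moreover have "c + ?e * ?y + (?e * ?z - ?f * ?z) \<in> mon_span U1"
      by (intro sg1(2) p(2) ey elem_sym_mult_cone z)
    moreover have "?f * ?z \<in> mon_span ?T" unfolding T using z by (rule set_times_intro2)
    ultimately show "p \<in> mon_span (U1 \<union> ?T)" using sgT(2) sub1 sub2 by blast
  next
    fix p :: "('v, 'k) mpoly" assume p: "p \<in> mon_span (U1 \<union> ?T)"
    let ?y = "mon_restrict (- ?T) p" and ?z = "mon_restrict ?T p"
    have y: "?y \<in> mon_span U1" using p by (auto simp: mon_span_def keys_mon_restrict)
    have "?z \<in> mon_span ?T" by (simp add: mon_span_def keys_mon_restrict)
    then obtain w where w: "?z = ?f * w" "w \<in> mon_span (cone a F)"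
      unfolding T by (auto simp: elt_set_times_def)
    have "p = ?y + ?z" by (rule mon_restrict_split)
    also have "\<dots> = (?y - (?e * w - ?f * w)) + ?e * w" by (simp add: w(1))
    finally have eq: "p = (?y - (?e * w - ?f * w)) + ?e * w" .
    have "?y - (?e * w - ?f * w) \<in> mon_span U1"
      by (intro sg1(4) y elem_sym_mult_cone w)
    moreover have "w \<in> mon_span U2" using w(2) mon_span_mono[of "cone a F" U2] U2_eq by blast
    then have "?e * w \<in> ?e *o mon_span U2" by (rule set_times_intro2)
    ultimately show "p \<in> mon_span U1 + ?e *o mon_span U2"
      by (subst eq) (rule set_plus_intro)
  qed
qed

end

theorem weakly_regular_elem_syms:
  assumes "finite V" "cone_filtration V d U U'"
  shows "weakly_regular (elem_syms V d :: ('v, 'k::field) mpoly list) (mon_span U) (mon_span U')"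
  using assms(2)
proof (induction d arbitrary: U U')
  case (Suc d)
  have stab: "f *o mon_span W \<subseteq> mon_span W"
    if "upset V W" "f \<in> set (elem_syms V (Suc d))" for W and f :: "('v, 'k) mpoly"
    using that mult_set_mon_span[OF that(1)] elem_sym_in_mon_span[OF assms(1)] unfolding set_elem_syms by blast
  from Suc.prems show ?case
  proof (induction rule: cone_filtration.induct)
    case (base U)
    have "weakly_regular fs (mon_span U) (mon_span U)"
      if "\<And>f. f \<in> set fs \<Longrightarrow> f *o mon_span U \<subseteq> mon_span U" for fs :: "('v, 'k) mpoly list"
      using that
    proof (induction fs)
      case (Cons f fs)
      have "mon_span U + f *o mon_span U = mon_span U"
        by (rule plus_absorb(2)[OF add_subgroup_mon_span])
          (simp_all add: Cons.prems add_subgroupD(1)[OF add_subgroup_mult[OF add_subgroup_mon_span]])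
      then show ?case using Cons by simp
    qed simp
    then show ?case using stab[OF base] by blast
  next
    case (add_cone U U1 U2 F a)
    note up = cone_filtration_upset[OF add_cone.hyps(1)]
    have fin: "finite F" using add_cone.hyps(3) assms(1) finite_subset by blast
    note piece = assms(1) conjunct1[OF conjunct2[OF up]] add_cone.hyps(2) add_cone.hyps(6,5,3)
    have "weakly_regular (elem_syms V d) (mon_span (U1 \<union> cone (a + set_mon F) F)) (mon_span U2 :: ('v, 'k) mpoly set)"
      unfolding add_cone.hyps(6)
      using up add_cone.hyps fin by (intro Suc.IH cone_filtration_subcone) auto
    moreover have "mon_span U1 + elem_sym V (Suc d) *o mon_span U2 =
        (mon_span (U1 \<union> cone (a + set_mon F) F) :: ('v, 'k) mpoly set)"
      using elem_sym_quotient[OF piece] unfolding add_cone.hyps(4) .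
    moreover have "x \<in> mon_span U1" if "x \<in> mon_span U2" "elem_sym V (Suc d) * x \<in> mon_span U1"
      for x :: "('v, 'k) mpoly"
      using elem_sym_nonzerodivisor[OF piece that(1)] that(2) unfolding add_cone.hyps(4) by blast
    ultimately have reg: "weakly_regular (elem_syms V (Suc d)) (mon_span U1) (mon_span U2 :: ('v, 'k) mpoly set)"
      by simp
    show ?case
    proof (rule weakly_regular_trans[OF _ _ _ _ _ _ _ _ add_cone.IH reg])
      show "mon_span U \<subseteq> mon_span U1" "mon_span U1 \<subseteq> mon_span U2"
        using up add_cone.hyps(6) by (intro mon_span_mono; blast)+
    qed (use up add_cone.hyps(2) stab in \<open>simp_all only: add_subgroup_mon_span\<close>)
  qed
qed simp

section \<open>The polynomial ring\<close>

lemma carrier_poly_ring: "carrier (poly_ring V) = mon_span (mons V)"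
  by (auto simp: poly_ring_def mon_span_def mons_def)

lemma poly_ring_ops:
  "monoid.mult (poly_ring V) = (*)" "add (poly_ring V) = (+)" "one (poly_ring V) = 1" "zero (poly_ring V) = 0"
  by (simp_all add: poly_ring_def)

lemma one_in_mon_span: "(1 :: ('v, 'k::field) mpoly) \<in> mon_span (mons V)"
  by (simp add: mon_span_def mons_def)

lemma cring_poly_ring: "cring (poly_ring V :: ('v, 'k::field) mpoly ring)"
proof (rule cringI)
  note sg = add_subgroupD[OF add_subgroup_mon_span[of "mons V"]]
  show "abelian_group (poly_ring V :: ('v, 'k) mpoly ring)"
  proof (rule abelian_groupI; unfold poly_ring_ops carrier_poly_ring)
    show "\<exists>y\<in>mon_span (mons V). y + x = 0" if "x \<in> mon_span (mons V)" for x :: "('v, 'k) mpoly"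
      using sg(3)[OF that] by (intro bexI[of _ "- x"]) auto
  qed (auto intro: sg(1) sg(2) simp: algebra_simps)
  show "comm_monoid (poly_ring V :: ('v, 'k) mpoly ring)"
    by (rule comm_monoidI; unfold poly_ring_ops carrier_poly_ring)
      (auto intro: mult_in_mon_span[OF upset_mons] one_in_mon_span simp: algebra_simps)
  show "(x \<oplus>\<^bsub>poly_ring V\<^esub> y) \<otimes>\<^bsub>poly_ring V\<^esub> z = x \<otimes>\<^bsub>poly_ring V\<^esub> z \<oplus>\<^bsub>poly_ring V\<^esub> y \<otimes>\<^bsub>poly_ring V\<^esub> z"
    for x y z :: "('v, 'k) mpoly"
    by (simp add: poly_ring_ops algebra_simps)
qed

lemma ideal_poly_ringD:
  assumes "ideal I (poly_ring V :: ('v, 'k::field) mpoly ring)"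
  shows "add_subgroup I" "I \<subseteq> mon_span (mons V)"
    "x \<in> I \<Longrightarrow> a \<in> mon_span (mons V) \<Longrightarrow> a * x \<in> I"
proof -
  interpret R: cring "poly_ring V :: ('v, 'k) mpoly ring" by (rule cring_poly_ring)
  interpret I: ideal I "poly_ring V" by (rule assms)
  show sub: "I \<subseteq> mon_span (mons V)" using I.a_subset by (simp add: carrier_poly_ring)
  show mult: "a * x \<in> I" if "x \<in> I" "a \<in> mon_span (mons V)" for a x
    using I.I_l_closed[of x a] that by (simp add: poly_ring_ops carrier_poly_ring)
  have "- x \<in> I" if "x \<in> I" for x
    using mult[OF that add_subgroupD(3)[OF add_subgroup_mon_span one_in_mon_span]] by simp
  moreover have "0 \<in> I" using I.zero_closed by (simp add: poly_ring_ops)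
  moreover have "x + y \<in> I" if "x \<in> I" "y \<in> I" for x y
    using I.a_closed[OF that] by (simp add: poly_ring_ops)
  ultimately show "add_subgroup I" by (simp add: add_subgroup_def)
qed

lemma primeideal_poly_ringD:
  assumes "primeideal P (poly_ring V :: ('v, 'k::field) mpoly ring)"
  shows "add_subgroup P" "P \<subseteq> mon_span (mons V)"
    "x \<in> P \<Longrightarrow> a \<in> mon_span (mons V) \<Longrightarrow> a * x \<in> P"
    "a \<in> mon_span (mons V) \<Longrightarrow> b \<in> mon_span (mons V) \<Longrightarrow> a * b \<in> P \<Longrightarrow> a \<in> P \<or> b \<in> P"
    "1 \<notin> P"
proof -
  interpret P: primeideal P "poly_ring V" by (rule assms)
  show "add_subgroup P" "P \<subseteq> mon_span (mons V)"
    "x \<in> P \<Longrightarrow> a \<in> mon_span (mons V) \<Longrightarrow> a * x \<in> P"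
    using ideal_poly_ringD[OF P.is_ideal] by blast+
  show "a \<in> mon_span (mons V) \<Longrightarrow> b \<in> mon_span (mons V) \<Longrightarrow> a * b \<in> P \<Longrightarrow> a \<in> P \<or> b \<in> P"
    using P.I_prime[of a b] by (simp add: poly_ring_ops carrier_poly_ring)
  show "1 \<notin> P" using P.one_imp_carrier P.I_notcarr by (auto simp: poly_ring_ops)
qed

lemma const_in_mon_span: "single 0 c \<in> mon_span (mons V)"
  by (simp add: single_in_mon_span zero_in_mons)

lemma Var_in_mon_span: "v \<in> V \<Longrightarrow> Var v \<in> mon_span (mons V)"
  by (simp add: Var_def single_in_mon_span mons_def)

section \<open>Algebraic dependence\<close>

text \<open>The product \<open>y\<^sub>1^\<alpha>\<^sub>1 \<cdots> y\<^sub>N^\<alpha>\<^sub>N\<close>; meaningful for lists of equal length.\<close>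

fun power_prod :: "'r::comm_ring_1 list \<Rightarrow> nat list \<Rightarrow> 'r" where
  "power_prod (y # ys) (n # ns) = y ^ n * power_prod ys ns"
| "power_prod _ _ = 1"

text \<open>Monomials in the variables \<open>F\<close> with all exponents at most \<open>b\<close>.\<close>

definition bounded_mons :: "'v set \<Rightarrow> nat \<Rightarrow> ('v \<Rightarrow>\<^sub>0 nat) set" where
  "bounded_mons F b = {m \<in> mons F. \<forall>v. lookup m v \<le> b}"

lemma card_bounded_mons:
  assumes F: "finite F"
  shows "finite (bounded_mons F b) \<and> card (bounded_mons F b) \<le> (b + 1) ^ card F"
proof -
  let ?h = "\<lambda>m. restrict (lookup m) F" and ?T = "F \<rightarrow>\<^sub>E {..b}"
  have "inj_on ?h (bounded_mons F b)"
  proof (rule inj_onI)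
    fix m n assume mn: "m \<in> bounded_mons F b" "n \<in> bounded_mons F b" "?h m = ?h n"
    have "lookup m v = lookup n v" for v
    proof (cases "v \<in> F")
      case True
      then show ?thesis using fun_cong[OF mn(3), of v] by simp
    next
      case False
      then have "v \<notin> keys m" "v \<notin> keys n" using mn(1,2) by (auto simp: bounded_mons_def mons_def)
      then show ?thesis by (simp add: in_keys_iff)
    qed
    then show "m = n" by (rule poly_mapping_eqI)
  qed
  moreover have "?h ` bounded_mons F b \<subseteq> ?T" by (auto simp: bounded_mons_def)
  moreover have "finite ?T" using F by (intro finite_PiE) auto
  moreover have "card ?T = (b + 1) ^ card F" using F by (simp add: card_PiE)
  ultimately show ?thesis using card_inj_on_le inj_on_finite by metis
qed

lemma mult_bounded_mons:
  assumes "p \<in> mon_span (bounded_mons F b)" "q \<in> mon_span (bounded_mons F c)"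
  shows "p * q \<in> mon_span (bounded_mons F (b + c))"
proof -
  have "keys (p * q) \<subseteq> {m + n | m n. m \<in> keys p \<and> n \<in> keys q}" by (rule keys_mult)
  also have "\<dots> \<subseteq> bounded_mons F (b + c)"
  proof clarify
    fix m n assume "m \<in> keys p" "n \<in> keys q"
    then have "m \<in> bounded_mons F b" "n \<in> bounded_mons F c" using assms by (auto simp: mon_span_def)
    then show "m + n \<in> bounded_mons F (b + c)"
      by (simp add: bounded_mons_def mons_add_iff lookup_add add_mono)
  qed
  finally show ?thesis by (simp add: mon_span_def)
qed

lemma bounded_mons_mono: "b \<le> c \<Longrightarrow> bounded_mons F b \<subseteq> bounded_mons F c"
  by (auto simp: bounded_mons_def intro: order_trans)

lemma one_bounded_mons: "(1 :: ('v, 'k::field) mpoly) \<in> mon_span (bounded_mons F b)"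
  by (simp add: mon_span_def bounded_mons_def mons_def)

lemma power_bounded_mons:
  "p \<in> mon_span (bounded_mons F b) \<Longrightarrow> p ^ n \<in> mon_span (bounded_mons F (n * b))"
  by (induction n) (auto intro: mult_bounded_mons one_bounded_mons)

lemma power_prod_bounded_mons:
  "set ys \<subseteq> mon_span (bounded_mons F b) \<Longrightarrow> set ns \<subseteq> {..D} \<Longrightarrow>
    power_prod ys ns \<in> mon_span (bounded_mons F (length ys * (D * b)))"
proof (induction ys ns rule: power_prod.induct)
  case (1 y ys n ns)
  have "y ^ n \<in> mon_span (bounded_mons F (n * b))" using 1 by (intro power_bounded_mons) auto
  moreover have "n * b \<le> D * b" using 1 by simp
  ultimately have "y ^ n \<in> mon_span (bounded_mons F (D * b))"
    using mon_span_mono[OF bounded_mons_mono] by blast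
  then show ?case using mult_bounded_mons 1 by fastforce
qed (auto intro: one_bounded_mons)

lemma vector_space_mpoly: "vector_space (\<lambda>c (p :: ('v, 'k::field) mpoly). single 0 c * p)"
  by (unfold_locales) (simp_all add: algebra_simps single_add mult_single)

lemma exists_bounded_mons:
  assumes "set ys \<subseteq> mon_span (mons F)"
  shows "\<exists>b. set ys \<subseteq> mon_span (bounded_mons F b)"
proof -
  let ?B = "\<Union>y\<in>set ys. \<Union>m\<in>keys y. lookup m ` keys m"
  have fin: "finite ?B" by simp
  have "lookup m v \<le> Max ?B" if "y \<in> set ys" "m \<in> keys y" for y m v
  proof (cases "v \<in> keys m")
    case True
    then have "lookup m v \<in> ?B" using that by blast
    then show ?thesis by (rule Max_ge[OF fin])
  next
    case False
    then show ?thesis by (simp add: in_keys_iff)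
  qed
  then have "y \<in> mon_span (bounded_mons F (Max ?B))" if "y \<in> set ys" for y
    using assms that by (auto simp: mon_span_def bounded_mons_def)
  then show ?thesis by blast
qed

text \<open>More than \<open>|F|\<close> polynomials in the variables \<open>F\<close> are algebraically dependent. The relation is given by
  a finite nonempty set \<open>E\<close> of exponent lists and nonzero coefficients \<open>c\<close>. The proof compares the number of
  power products having exponents at most \<open>D\<close> with the dimension of the space that contains them.\<close>

lemma algebraically_dependent:
  fixes ys :: "('v, 'k::field) mpoly list"
  assumes F: "finite F" and ys: "set ys \<subseteq> mon_span (mons F)" and len: "card F < length ys"
  shows "\<exists>E c. finite E \<and> E \<noteq> {} \<and> (\<forall>\<alpha>\<in>E. length \<alpha> = length ys \<and> c \<alpha> \<noteq> 0) \<and>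
    (\<Sum>\<alpha>\<in>E. single 0 (c \<alpha>) * power_prod ys \<alpha>) = 0"
proof -
  interpret vs: vector_space "\<lambda>c (p :: ('v, 'k) mpoly). single 0 c * p" by (rule vector_space_mpoly)
  obtain b where b: "set ys \<subseteq> mon_span (bounded_mons F b)" using exists_bounded_mons[OF ys] by blast
  define N where "N = length ys"
  \<comment> \<open>large enough for \<open>(D + 1)^N\<close> to exceed \<open>(N D b + 1)^|F|\<close>\<close>
  define D where "D = (N * b + 1) ^ card F"
  define A where "A = {\<alpha>. set \<alpha> \<subseteq> {..D} \<and> length \<alpha> = N}"
  define T where "T = (\<lambda>m. single m (1::'k)) ` bounded_mons F (N * (D * b))"
  have finA: "finite A" unfolding A_def by (rule finite_lists_length_eq) simp
  have cardA: "card A = (D + 1) ^ N" unfolding A_def by (subst card_lists_length_eq) auto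
  have finT: "finite T" and cardT: "card T \<le> (N * (D * b) + 1) ^ card F"
    using card_bounded_mons[OF F, of "N * (D * b)"] card_image_le unfolding T_def
    by (auto intro: order_trans)
  have "N * (D * b) + 1 \<le> (N * b + 1) * (D + 1)" by (simp add: algebra_simps)
  then have "(N * (D * b) + 1) ^ card F \<le> ((N * b + 1) * (D + 1)) ^ card F" by (rule power_mono) simp
  also have "\<dots> = D * (D + 1) ^ card F" by (simp only: power_mult_distrib D_def)
  also have "\<dots> < (D + 1) * (D + 1) ^ card F" by simp
  also have "\<dots> = (D + 1) ^ Suc (card F)" by simp
  also have "\<dots> \<le> (D + 1) ^ N" using len by (intro power_increasing) (auto simp: N_def)
  finally have less: "card T < card A" using cardT cardA by simp
  have inT: "power_prod ys \<alpha> \<in> vs.span T" if "\<alpha> \<in> A" for \<alpha>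
  proof -
    let ?p = "power_prod ys \<alpha>"
    have "?p \<in> mon_span (bounded_mons F (N * (D * b)))"
      using power_prod_bounded_mons[OF b] that unfolding A_def N_def by blast
    then have "single 0 (lookup ?p m) * single m 1 \<in> vs.span T" if "m \<in> keys ?p" for m
      using that unfolding T_def mon_span_def by (intro vs.span_scale vs.span_base) blast
    then have "(\<Sum>m\<in>keys ?p. single m (lookup ?p m)) \<in> vs.span T"
      by (intro vs.span_sum) (simp add: mult_single)
    then show ?thesis by (simp only: poly_eq_sum_single[symmetric])
  qed
  show ?thesis
  proof (cases "inj_on (power_prod ys) A")
    case True
    have "vs.dependent (power_prod ys ` A)"
    proof (rule ccontr)
      assume "vs.independent (power_prod ys ` A)"
      then have "card (power_prod ys ` A) \<le> card T"
        using vs.independent_span_bound[OF finT] inT by blast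
      then show False using less card_image[OF True] by simp
    qed
    then obtain u where u: "\<exists>v\<in>power_prod ys ` A. u v \<noteq> 0"
      "(\<Sum>v\<in>power_prod ys ` A. single 0 (u v) * v) = 0"
      using vs.dependent_finite[OF finite_imageI[OF finA]] by auto
    let ?E = "{\<alpha>\<in>A. u (power_prod ys \<alpha>) \<noteq> 0}"
    have "(\<Sum>\<alpha>\<in>?E. single 0 (u (power_prod ys \<alpha>)) * power_prod ys \<alpha>) =
        (\<Sum>\<alpha>\<in>A. single 0 (u (power_prod ys \<alpha>)) * power_prod ys \<alpha>)"
      using finA by (intro sum.mono_neutral_left) auto
    also have "\<dots> = 0" using u(2) by (simp add: sum.reindex[OF True])
    finally have "(\<Sum>\<alpha>\<in>?E. single 0 (u (power_prod ys \<alpha>)) * power_prod ys \<alpha>) = 0" .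
    moreover have "finite ?E" using finA by simp
    ultimately show ?thesis
      using u(1) by (intro exI[of _ ?E] exI[of _ "\<lambda>\<alpha>. u (power_prod ys \<alpha>)"]) (auto simp: A_def N_def)
  next
    case False
    then obtain \<alpha> \<beta> where ab: "\<alpha> \<in> A" "\<beta> \<in> A" "\<alpha> \<noteq> \<beta>" "power_prod ys \<alpha> = power_prod ys \<beta>"
      by (auto simp: inj_on_def)
    have "single 0 (1::'k) * p + single 0 (- 1) * p = 0" for p :: "('v, 'k) mpoly"
      by (simp add: distrib_right[symmetric] single_add[symmetric])
    then show ?thesis
      using ab by (intro exI[of _ "{\<alpha>, \<beta>}"] exI[of _ "\<lambda>\<gamma>. if \<gamma> = \<alpha> then 1 else - 1"])
        (auto simp: A_def N_def)
  qed
qed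

section \<open>Chains of primes containing variables\<close>

text \<open>Cancel from the relation the largest power of \<open>y\<^sub>0\<close> dividing all of its terms, which is possible as
  \<open>y\<^sub>0 \<notin> P\<^sub>0\<close>. The terms still divisible by \<open>y\<^sub>0\<close> lie in \<open>P\<^sub>1\<close>, and the other ones form a nontrivial relation
  between \<open>y\<^sub>1, y\<^sub>2, \<dots>\<close> modulo \<open>P\<^sub>1\<close>. In the end a nonzero constant lies in the last prime.\<close>

lemma no_relation_along_prime_chain:
  fixes ys :: "('v, 'k::field) mpoly list"
  assumes "\<And>i. i \<le> length ys \<Longrightarrow> primeideal (P i) (poly_ring V)"
    and "\<And>i. i < length ys \<Longrightarrow> P i \<subseteq> P (Suc i)"
    and "\<And>i. i < length ys \<Longrightarrow> ys ! i \<in> P (Suc i) \<and> ys ! i \<notin> P i"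
    and "finite E" "E \<noteq> {}" "\<And>\<alpha>. \<alpha> \<in> E \<Longrightarrow> length \<alpha> = length ys \<and> c \<alpha> \<noteq> 0"
    and "(\<Sum>\<alpha>\<in>E. single 0 (c \<alpha>) * power_prod ys \<alpha>) \<in> P 0"
  shows False
  using assms
proof (induction ys arbitrary: P E c)
  case Nil
  then have "E = {[]}" by auto
  then have "single 0 (c []) \<in> P 0" "c [] \<noteq> 0" using Nil.prems(6,7) by auto
  then have "single 0 (inverse (c [])) * single 0 (c []) \<in> P 0"
    by (intro primeideal_poly_ringD(3)[OF Nil.prems(1)[of 0]] const_in_mon_span) simp_all
  then have "1 \<in> P 0" using \<open>c [] \<noteq> 0\<close> by (simp add: mult_single)
  then show False using primeideal_poly_ringD(5)[OF Nil.prems(1)[of 0]] by simp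
next
  case (Cons y ys)
  note prime0 = primeideal_poly_ringD[OF Cons.prems(1)[of 0, simplified]]
  note prime1 = primeideal_poly_ringD[OF Cons.prems(1)[of "Suc 0", simplified]]
  have y: "y \<in> P (Suc 0)" "y \<notin> P 0" using Cons.prems(3)[of 0] by auto
  have yS: "y \<in> mon_span (mons V)" using prime1(2) y by blast
  have ysS: "set ys \<subseteq> mon_span (mons V)"
  proof
    fix z assume "z \<in> set ys"
    then obtain i where "i < length ys" "z = ys ! i" by (auto simp: in_set_conv_nth)
    then have "z \<in> P (Suc (Suc i))" "Suc (Suc i) \<le> length (y # ys)" using Cons.prems(3)[of "Suc i"] by auto
    then show "z \<in> mon_span (mons V)" using primeideal_poly_ringD(2)[OF Cons.prems(1)] by blast
  qed
  have pow: "x ^ n \<in> mon_span (mons V)" if "x \<in> mon_span (mons V)" for x :: "('v, 'k) mpoly" and n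
    using that by (induction n) (auto intro: one_in_mon_span mult_in_mon_span[OF upset_mons])
  have pp: "set zs \<subseteq> mon_span (mons V) \<Longrightarrow> power_prod zs ns \<in> mon_span (mons V)" for zs :: "('v, 'k) mpoly list" and ns
    by (induction zs ns rule: power_prod.induct) (auto intro: one_in_mon_span mult_in_mon_span[OF upset_mons] pow)
  define k where "k = Min (hd ` E)"
  have kle: "k \<le> hd \<alpha>" if "\<alpha> \<in> E" for \<alpha> using that Cons.prems(4) by (simp add: k_def)
  have "k \<in> hd ` E" unfolding k_def using Cons.prems(4,5) by (intro Min_in) auto
  then obtain \<alpha>0 where a0: "\<alpha>0 \<in> E" "hd \<alpha>0 = k" by blast
  have shape: "\<alpha> = hd \<alpha> # tl \<alpha>" "length (tl \<alpha>) = length ys" if "\<alpha> \<in> E" for \<alpha>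
    using Cons.prems(6)[OF that] by (cases \<alpha>; simp)+
  let ?t = "\<lambda>\<alpha>. single 0 (c \<alpha>) * (y ^ (hd \<alpha> - k) * power_prod ys (tl \<alpha>))"
  have tS: "?t \<alpha> \<in> mon_span (mons V)" for \<alpha>
    by (intro mult_in_mon_span[OF upset_mons] const_in_mon_span pow yS pp ysS)
  have "single 0 (c \<alpha>) * power_prod (y # ys) \<alpha> = y ^ k * ?t \<alpha>" if "\<alpha> \<in> E" for \<alpha>
  proof -
    have "power_prod (y # ys) \<alpha> = y ^ (k + (hd \<alpha> - k)) * power_prod ys (tl \<alpha>)"
      using kle[OF that] by (subst shape(1)[OF that]) simp
    then show ?thesis by (simp add: power_add mult_ac)
  qed
  then have "y ^ k * (\<Sum>\<alpha>\<in>E. ?t \<alpha>) \<in> P 0"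
    using Cons.prems(7) by (simp add: sum_distrib_left)
  moreover have "y ^ n \<notin> P 0" for n
    using y(2) prime0(4)[OF yS pow[OF yS]] prime0(5) by (induction n) auto
  moreover have "(\<Sum>\<alpha>\<in>E. ?t \<alpha>) \<in> mon_span (mons V)"
    using tS by (rule add_subgroup_sum[OF add_subgroup_mon_span])
  ultimately have "(\<Sum>\<alpha>\<in>E. ?t \<alpha>) \<in> P 0" using prime0(4)[OF pow[OF yS]] by blast
  then have sum1: "(\<Sum>\<alpha>\<in>E. ?t \<alpha>) \<in> P (Suc 0)" using subsetD[OF Cons.prems(2)[of 0]] by simp
  let ?E0 = "{\<alpha>\<in>E. hd \<alpha> = k}"
  have "?t \<alpha> \<in> P (Suc 0)" if "\<alpha> \<in> E - ?E0" for \<alpha>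
  proof -
    have "k < hd \<alpha>" using that kle[of \<alpha>] by (auto simp: order_less_le)
    then obtain n where n: "hd \<alpha> - k = Suc n" using Suc_diff_Suc by metis
    have "?t \<alpha> = (single 0 (c \<alpha>) * (y ^ n * power_prod ys (tl \<alpha>))) * y" by (simp add: n mult_ac)
    also have "\<dots> \<in> P (Suc 0)"
      by (intro prime1(3) y mult_in_mon_span[OF upset_mons] const_in_mon_span pow yS pp ysS)
    finally show ?thesis .
  qed
  then have "(\<Sum>\<alpha>\<in>E - ?E0. ?t \<alpha>) \<in> P (Suc 0)" by (rule add_subgroup_sum[OF prime1(1)])
  then have "(\<Sum>\<alpha>\<in>E. ?t \<alpha>) - (\<Sum>\<alpha>\<in>E - ?E0. ?t \<alpha>) \<in> P (Suc 0)" by (rule add_subgroupD(4)[OF prime1(1) sum1])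
  moreover have "(\<Sum>\<alpha>\<in>E. ?t \<alpha>) = (\<Sum>\<alpha>\<in>E - ?E0. ?t \<alpha>) + (\<Sum>\<alpha>\<in>?E0. ?t \<alpha>)"
    using Cons.prems(4) by (intro sum.subset_diff) auto
  ultimately have "(\<Sum>\<alpha>\<in>?E0. ?t \<alpha>) \<in> P (Suc 0)" by simp
  moreover have "(\<Sum>\<alpha>\<in>?E0. ?t \<alpha>) = (\<Sum>\<beta>\<in>tl ` ?E0. single 0 (c (k # \<beta>)) * power_prod ys \<beta>)"
  proof -
    have "inj_on tl ?E0" using shape(1) by (auto simp: inj_on_def) metis
    moreover have "k # tl \<alpha> = \<alpha>" if "\<alpha> \<in> ?E0" for \<alpha> using shape(1)[of \<alpha>] that by auto
    ultimately show ?thesis by (simp add: sum.reindex)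
  qed
  ultimately have rel: "(\<Sum>\<beta>\<in>tl ` ?E0. single 0 (c (k # \<beta>)) * power_prod ys \<beta>) \<in> P (Suc 0)" by simp
  show False
  proof (rule Cons.IH[of "\<lambda>i. P (Suc i)" "tl ` ?E0" "\<lambda>\<beta>. c (k # \<beta>)"])
    show "primeideal (P (Suc i)) (poly_ring V)" if "i \<le> length ys" for i using Cons.prems(1)[of "Suc i"] that by simp
    show "P (Suc i) \<subseteq> P (Suc (Suc i))" if "i < length ys" for i using Cons.prems(2)[of "Suc i"] that by simp
    show "ys ! i \<in> P (Suc (Suc i)) \<and> ys ! i \<notin> P (Suc i)" if "i < length ys" for i
      using Cons.prems(3)[of "Suc i"] that by simp
    show "finite (tl ` ?E0)" using Cons.prems(4) by simp
    show "tl ` ?E0 \<noteq> {}" using a0 by blast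
    show "length \<beta> = length ys \<and> c (k # \<beta>) \<noteq> 0" if "\<beta> \<in> tl ` ?E0" for \<beta>
    proof -
      obtain \<alpha> where a: "\<alpha> \<in> E" "hd \<alpha> = k" "\<beta> = tl \<alpha>" using \<open>\<beta> \<in> tl ` ?E0\<close> by blast
      have "\<alpha> = k # \<beta>" using shape(1)[OF a(1)] a(2,3) by simp
      then show ?thesis using Cons.prems(6)[OF a(1)] by simp
    qed
  qed (rule rel)
qed

lemma prime_chain_length_le:
  fixes P :: "nat \<Rightarrow> ('v, 'k::field) mpoly set"
  assumes V: "finite V" and F: "F \<subseteq> V" and vars: "\<And>v. v \<in> V - F \<Longrightarrow> Var v \<in> P 0"
    and prime: "\<And>i. i \<le> n \<Longrightarrow> primeideal (P i) (poly_ring V)"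
    and chain: "\<And>i. i < n \<Longrightarrow> P i \<subset> P (Suc i)"
  shows "n \<le> card F"
proof (rule ccontr)
  assume "\<not> n \<le> card F"
  note prime0 = primeideal_poly_ringD[OF prime[of 0, simplified]]
  have mono: "P 0 \<subseteq> P i" if "i \<le> n" for i
    using that by (induction i) (use chain in \<open>auto simp: Suc_le_eq\<close>)
  \<comment> \<open>modulo \<open>P\<^sub>0\<close>, every polynomial equals its part in the variables of \<open>F\<close>\<close>
  have low: "mon_restrict (- mons F) y \<in> P 0" if "y \<in> mon_span (mons V)" for y
    unfolding mon_restrict_def
  proof (rule add_subgroup_sum[OF prime0(1)])
    fix m assume m: "m \<in> keys y \<inter> - mons F"
    then obtain v where v: "v \<in> keys m" "v \<notin> F" by (auto simp: mons_def)
    have mV: "keys m \<subseteq> V" using m that by (auto simp: mon_span_def mons_def)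
    obtain b where b: "m = set_mon {v} + b" "keys b \<subseteq> keys m"
      using mon_decomp_set_mon[of "{v}" m] v by auto
    have "single m (lookup y m) = single b (lookup y m) * Var v"
      by (simp add: Var_def mult_single b(1) set_mon_def add.commute)
    moreover have "single b (lookup y m) \<in> mon_span (mons V)"
      using b(2) mV by (intro single_in_mon_span) (auto simp: mons_def)
    ultimately show "single m (lookup y m) \<in> P 0"
      using prime0(3)[OF vars[of v]] v mV by auto
  qed
  have "\<exists>z. z \<in> P (Suc i) \<and> z \<notin> P i \<and> z \<in> mon_span (mons F)" if i: "i < n" for i
  proof -
    obtain y where y: "y \<in> P (Suc i)" "y \<notin> P i" using chain[OF i] by blast
    note pi = primeideal_poly_ringD[OF prime[of i]] and ps = primeideal_poly_ringD[OF prime[of "Suc i"]]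
    have "y \<in> mon_span (mons V)" using ps(2) i y by auto
    then have l: "mon_restrict (- mons F) y \<in> P i" "mon_restrict (- mons F) y \<in> P (Suc i)"
      using low mono[of i] mono[of "Suc i"] i by auto
    have "y = mon_restrict (- mons F) y + mon_restrict (mons F) y" by (rule mon_restrict_split)
    then have "mon_restrict (mons F) y = y - mon_restrict (- mons F) y" by (simp add: algebra_simps)
    then have "mon_restrict (mons F) y \<in> P (Suc i)"
      using add_subgroupD(4)[OF ps(1) y(1) l(2)] i by simp
    moreover have "mon_restrict (mons F) y \<notin> P i"
      using add_subgroupD(2)[OF pi(1) l(1), of "mon_restrict (mons F) y"] mon_restrict_split[of y "mons F"] y(2) i by auto
    moreover have "mon_restrict (mons F) y \<in> mon_span (mons F)" by (simp add: mon_span_def keys_mon_restrict)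
    ultimately show ?thesis by blast
  qed
  then obtain z where z: "\<And>i. i < n \<Longrightarrow> z i \<in> P (Suc i) \<and> z i \<notin> P i \<and> z i \<in> mon_span (mons F)"
    by metis
  let ?ys = "map z [0..<n]"
  have "finite F" using F V finite_subset by blast
  moreover have "set ?ys \<subseteq> mon_span (mons F)" using z by auto
  moreover have "card F < length ?ys" using \<open>\<not> n \<le> card F\<close> by simp
  ultimately obtain E c where Ec: "finite E" "E \<noteq> {}" "\<And>\<alpha>. \<alpha> \<in> E \<Longrightarrow> length \<alpha> = length ?ys \<and> c \<alpha> \<noteq> 0"
    "(\<Sum>\<alpha>\<in>E. single 0 (c \<alpha>) * power_prod ?ys \<alpha>) = 0"
    using algebraically_dependent[of F ?ys] by blast
  show False
  proof (rule no_relation_along_prime_chain[OF _ _ _ Ec(1-3)])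
    show "(\<Sum>\<alpha>\<in>E. single 0 (c \<alpha>) * power_prod ?ys \<alpha>) \<in> P 0"
      unfolding Ec(4) by (rule add_subgroupD(1)[OF prime0(1)])
  qed (use prime chain z in auto)
qed

section \<open>Cohen--Macaulayness of subquotients with a cone filtration\<close>

lemma elem_sym_in_irrelevant_ideal:
  assumes V: "finite V" and j: "0 < j"
  shows "(elem_sym V j :: ('v, 'k::field) mpoly) \<in> irrelevant_ideal V"
proof -
  interpret R: cring "poly_ring V :: ('v, 'k) mpoly ring" by (rule cring_poly_ring)
  have sub: "Var ` V \<subseteq> carrier (poly_ring V :: ('v, 'k) mpoly ring)"
    by (auto simp: carrier_poly_ring Var_in_mon_span)
  have idl: "ideal (irrelevant_ideal V) (poly_ring V :: ('v, 'k) mpoly ring)"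
    unfolding irrelevant_ideal_def by (rule R.genideal_ideal[OF sub])
  note D = ideal_poly_ringD[OF idl]
  show ?thesis unfolding elem_sym_def
  proof (rule add_subgroup_sum[OF D(1)])
    fix A assume "A \<in> {A. A \<subseteq> V \<and> card A = j}"
    then have A: "A \<subseteq> V" "card A = j" by auto
    have fA: "finite A" using A V finite_subset by blast
    obtain v where v: "v \<in> A" using A j by (cases "A = {}") auto
    have "set_mon A = single v 1 + set_mon (A - {v})"
      using set_mon_insert[of "A - {v}" v] fA v by (simp add: insert_absorb)
    then have "single (set_mon A) (1::'k) = single (set_mon (A - {v})) 1 * Var v"
      by (simp add: Var_def mult_single add.commute)
    moreover have "Var v \<in> (irrelevant_ideal V :: ('v, 'k) mpoly set)"
      unfolding irrelevant_ideal_def using R.genideal_self[OF sub] v A by blast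
    moreover have "single (set_mon (A - {v})) (1::'k) \<in> mon_span (mons V)"
      using A fA by (intro single_in_mon_span) (auto simp: mons_def keys_set_mon)
    ultimately show "single (set_mon A) (1::'k) \<in> irrelevant_ideal V" using D(3) by metis
  qed
qed

lemma mon_degree_eq_sum:
  assumes "finite W" "keys m \<subseteq> W"
  shows "mon_degree m = (\<Sum>v\<in>W. lookup m v)"
  unfolding mon_degree_def using assms by (intro sum.mono_neutral_left) (auto simp: in_keys_iff)

lemma mon_degree_add: "mon_degree (a + b) = mon_degree a + mon_degree b"
proof -
  let ?W = "keys a \<union> keys b"
  have "mon_degree m = (\<Sum>v\<in>?W. lookup m v)" if "keys m \<subseteq> ?W" for m
    by (rule mon_degree_eq_sum) (use that in simp_all)
  then show ?thesis by (simp add: keys_add_nat lookup_add sum.distrib)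
qed

lemma mon_degree_pos: "a \<noteq> 0 \<Longrightarrow> 0 < mon_degree a"
proof -
  assume "a \<noteq> 0"
  then obtain v where v: "v \<in> keys a" using keys_eq_empty by blast
  then have "0 < lookup a v" by (simp add: in_keys_iff)
  also have "\<dots> \<le> mon_degree a" unfolding mon_degree_def using v by (intro member_le_sum) auto
  finally show ?thesis .
qed

text \<open>A monomial of least degree in \<open>U'\<close> outside \<open>U\<close> is not reached by multiples of polynomials without
  constant term.\<close>

lemma plus_multiples_proper:
  fixes fs :: "('v, 'k::field) mpoly list"
  assumes U: "upset V U" and ne: "\<not> U' \<subseteq> U"
    and fs: "\<And>f. f \<in> set fs \<Longrightarrow> f \<in> mon_span (mons V - {0})"
  shows "\<not> mon_span U' \<subseteq> plus_multiples (mon_span U') (mon_span U) fs"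
proof -
  obtain m where m: "m \<in> U'" "m \<notin> U" and min: "\<And>n. n \<in> U' - U \<Longrightarrow> mon_degree m \<le> mon_degree n"
    using ne ex_has_least_nat[of "\<lambda>m. m \<in> U' - U" _ mon_degree] by blast
  have "lookup x m = 0" if "x \<in> plus_multiples (mon_span U') (mon_span U) fs" for x
    using that fs
  proof (induction fs arbitrary: x rule: rev_induct)
    case Nil
    then show ?case using m(2) by (auto simp: plus_multiples_simps mon_span_def in_keys_iff)
  next
    case (snoc f fs)
    then obtain y z where x: "x = y + f * z" "y \<in> plus_multiples (mon_span U') (mon_span U) fs" "z \<in> mon_span U'"
      by (auto simp: plus_multiples_simps set_plus_def elt_set_times_def)
    have "lookup (f * z) m = 0"
    proof (rule ccontr)
      assume "lookup (f * z) m \<noteq> 0"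
      then have "m \<in> keys (f * z)" by (simp add: in_keys_iff)
      then obtain a b where ab: "m = a + b" "a \<in> keys f" "b \<in> keys z" using keys_mult[of f z] by blast
      then have a: "a \<in> mons V" "a \<noteq> 0" using snoc.prems(2)[of f] by (auto simp: mon_span_def)
      have "b \<in> U'" using ab(3) x(3) by (auto simp: mon_span_def)
      moreover have "b \<notin> U" using U a(1) ab(1) m(2) by (auto simp: upset_def)
      ultimately have "mon_degree m \<le> mon_degree b" using min by blast
      then show False using mon_degree_pos[OF a(2)] by (simp add: ab(1) mon_degree_add)
    qed
    moreover have "lookup y m = 0" using snoc.IH[OF x(2)] snoc.prems(2) by simp
    ultimately show ?case by (simp add: x(1) lookup_add)
  qed
  moreover have "single m (1::'k) \<in> mon_span U'" by (rule single_in_mon_span[OF m(1)])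
  moreover have "lookup (single m (1::'k)) m \<noteq> 0" by simp
  ultimately show ?thesis by blast
qed

text \<open>Let \<open>F\<close> belong to the last cone. If some variable \<open>v\<close> outside \<open>F\<close> is not in \<open>P\<close>, then multiplication by
  \<open>v\<close> kills the last factor of the filtration, so \<open>P\<close> contains the annihilator of the remaining part.\<close>

lemma prime_contains_cofacet:
  fixes P :: "('v, 'k::field) mpoly set"
  assumes "cone_filtration V d U U'" and P: "primeideal P (poly_ring V)"
    and "{s \<in> mon_span (mons V). \<forall>x\<in>mon_span U'. s * x \<in> mon_span U} \<subseteq> P"
  shows "\<exists>F\<subseteq>V. card F = d \<and> (\<forall>v\<in>V - F. Var v \<in> P)"
  using assms(1,3)
proof (induction rule: cone_filtration.induct)
  case (base U)
  have "(1 :: ('v, 'k) mpoly) \<in> {s \<in> mon_span (mons V). \<forall>x\<in>mon_span U. s * x \<in> mon_span U}"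
    by (simp add: one_in_mon_span)
  then show ?case using base.prems primeideal_poly_ringD(5)[OF P] by blast
next
  case (add_cone U U1 U2 F a)
  show ?case
  proof (cases "\<forall>v\<in>V - F. Var v \<in> P")
    case True
    then show ?thesis using add_cone.hyps by blast
  next
    case False
    then obtain v where v: "v \<in> V" "v \<notin> F" "Var v \<notin> P" by blast
    have VS: "Var v \<in> mon_span (mons V)" by (rule Var_in_mon_span[OF v(1)])
    have U1: "upset V U1" using cone_filtration_upset[OF add_cone.hyps(1)] by blast
    have down: "Var v * x \<in> mon_span U1" if x: "x \<in> mon_span U2" for x :: "('v, 'k) mpoly"
    proof -
      have "single v 1 + m \<in> U1" if m: "m \<in> keys x" for m
      proof -
        have mU: "m \<in> U2" using m x by (auto simp: mon_span_def)
        have vV: "single v 1 \<in> mons V" using v(1) by (simp add: mons_def)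
        show ?thesis
        proof (cases "m \<in> U1")
          case True
          then show ?thesis using U1 vV by (auto simp: upset_def)
        next
          case False
          then have "m \<in> cone a F" using mU add_cone.hyps(6) by blast
          then have "single v 1 + m \<notin> cone a F" using add_in_cone_iff[of m a F] v(2) by simp
          moreover have "single v 1 + m \<in> U2" using add_cone.hyps(2) vV mU by (auto simp: upset_def)
          ultimately show ?thesis using add_cone.hyps(6) by blast
        qed
      qed
      then show ?thesis using keys_single_mult[of "single v 1" 1 x] unfolding mon_span_def Var_def by blast
    qed
    have "s \<in> P" if s: "s \<in> mon_span (mons V)" "\<And>x. x \<in> mon_span U1 \<Longrightarrow> s * x \<in> mon_span U" for s
    proof -
      have "(s * Var v) * x \<in> mon_span U" if "x \<in> mon_span U2" for x
        using s(2)[OF down[OF that]] by (simp add: mult.assoc)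
      moreover have "s * Var v \<in> mon_span (mons V)" by (rule mult_in_mon_span[OF upset_mons s(1) VS])
      ultimately have "s * Var v \<in> P" using add_cone.prems by blast
      then show ?thesis using primeideal_poly_ringD(4)[OF P s(1) VS] v(3) by blast
    qed
    then show ?thesis using add_cone.IH by blast
  qed
qed

text \<open>The apexes of the cones generate.\<close>

lemma cone_filtration_generators:
  assumes "cone_filtration V d U U'"
  shows "\<exists>A. finite A \<and> A \<subseteq> U' \<and> (\<forall>m\<in>U' - U. \<exists>a\<in>A. \<exists>t\<in>mons V. m = t + a)"
  using assms
proof (induction rule: cone_filtration.induct)
  case (base U)
  then show ?case by (intro exI[of _ "{}"]) auto
next
  case (add_cone U U1 U2 F a)
  then obtain A where A: "finite A" "A \<subseteq> U1" "\<forall>m\<in>U1 - U. \<exists>a\<in>A. \<exists>t\<in>mons V. m = t + a" by blast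
  have "a \<in> cone a F" using zero_in_mons[of F] by (auto simp: cone_def image_iff intro!: bexI[of _ 0])
  then have "insert a A \<subseteq> U2" using A add_cone.hyps(6) by blast
  moreover have "\<exists>t\<in>mons V. m = t + a" if "m \<in> cone a F" for m
    using that mons_mono[OF add_cone.hyps(3)] by (auto simp: cone_def add.commute)
  then have "\<forall>m\<in>U2 - U. \<exists>a\<in>insert a A. \<exists>t\<in>mons V. m = t + a" using A(3) add_cone.hyps(6) by blast
  ultimately show ?case using A(1) by (intro exI[of _ "insert a A"]) simp
qed

lemma monomial_combination:
  fixes x :: "('v, 'k::field) mpoly"
  assumes A: "finite A" and gen: "\<And>m. m \<in> keys x - U \<Longrightarrow> \<exists>a\<in>A. \<exists>t\<in>mons V. m = t + a"
  shows "\<exists>c. (\<forall>p\<in>(\<lambda>a. single a 1) ` A. c p \<in> mon_span (mons V)) \<and>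
    x - (\<Sum>p\<in>(\<lambda>a. single a 1) ` A. c p * p) \<in> mon_span U"
proof -
  obtain g t where gt: "\<And>m. m \<in> keys x - U \<Longrightarrow> g m \<in> A \<and> t m \<in> mons V \<and> m = t m + g m"
    using gen by metis
  let ?K = "keys x \<inter> - U" and ?s = "\<lambda>a. single a (1::'k)"
  define c where "c p = (\<Sum>m\<in>{m\<in>?K. ?s (g m) = p}. single (t m) (lookup x m))" for p
  have "c p \<in> mon_span (mons V)" for p
    unfolding c_def using gt by (intro add_subgroup_sum[OF add_subgroup_mon_span] single_in_mon_span) auto
  moreover have "(\<Sum>p\<in>?s ` A. c p * p) = mon_restrict (- U) x"
  proof -
    have "(\<Sum>p\<in>?s ` A. c p * p) = (\<Sum>p\<in>?s ` A. \<Sum>m\<in>{m\<in>?K. ?s (g m) = p}. single m (lookup x m))"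
      unfolding c_def sum_distrib_right
    proof (rule sum.cong[OF refl], rule sum.cong[OF refl])
      fix p m assume "m \<in> {m\<in>?K. ?s (g m) = p}"
      then have "p = ?s (g m)" "m = t m + g m" using gt[of m] by auto
      then show "single (t m) (lookup x m) * p = single m (lookup x m)"
        by (metis mult.right_neutral mult_single)
    qed
    also have "\<dots> = (\<Sum>m\<in>?K. single m (lookup x m))"
      using A gt by (intro sum.group) auto
    finally show ?thesis by (simp add: mon_restrict_def)
  qed
  moreover have "x - mon_restrict (- U) x \<in> mon_span U"
  proof -
    have "x - mon_restrict (- U) x = mon_restrict U x"
      using mon_restrict_split[of x U] by (simp add: algebra_simps)
    then show ?thesis by (simp add: mon_span_def keys_mon_restrict)
  qed
  ultimately show ?thesis by (intro exI[of _ c]) simp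
qed

theorem cohen_macaulay_cone_filtration:
  fixes Q :: "(('v, 'k::field) mpoly, 'm, 'y) module_scheme"
  assumes V: "finite V" and cf: "cone_filtration V d U U'" and ne: "U \<noteq> U'"
    and Q: "presented_module (poly_ring V) Q (mon_span U') (mon_span U) \<phi>"
  shows "cohen_macaulay (poly_ring V) (irrelevant_ideal V) Q" "module_dim (poly_ring V) Q = ereal (real d)"
proof -
  interpret Q: presented_module "poly_ring V :: ('v, 'k) mpoly ring" Q "mon_span U'" "mon_span U" \<phi>
    by (rule Q)
  let ?R = "poly_ring V :: ('v, 'k) mpoly ring" and ?es = "elem_syms V d :: ('v, 'k) mpoly list"
  note up = cone_filtration_upset[OF cf]
  have "regular_sequence ?R Q ?es"
  proof (rule Q.regular_sequenceI)
    show "set ?es \<subseteq> carrier ?R"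
      using elem_sym_in_mon_span[OF V] by (auto simp: set_elem_syms carrier_poly_ring)
    show "weakly_regular ?es (mon_span U) (mon_span U')" by (rule weakly_regular_elem_syms[OF V cf])
    show "\<not> mon_span U' \<subseteq> plus_multiples (mon_span U') (mon_span U) ?es"
    proof (rule plus_multiples_proper)
      show "upset V U" "\<not> U' \<subseteq> U" using up ne by blast+
      fix f assume "f \<in> set ?es"
      then obtain j where f: "f = elem_sym V j" "0 < j" by (auto simp: set_elem_syms)
      have "m \<noteq> 0" if m: "m \<in> keys f" for m
      proof -
        obtain A where A: "A \<subseteq> V" "card A = j" "m = set_mon A"
          by (rule keys_elem_sym[OF V m[unfolded f(1)]])
        then have "keys m = A" using V finite_subset keys_set_mon by metis
        then show ?thesis using A f(2) by auto
      qed
      moreover have "f \<in> mon_span (mons V)" unfolding f(1) by (rule elem_sym_in_mon_span[OF V])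
      ultimately show "f \<in> mon_span (mons V - {0})" by (auto simp: mon_span_def)
    qed
  qed
  moreover have "set ?es \<subseteq> irrelevant_ideal V"
    by (auto simp: set_elem_syms intro!: elem_sym_in_irrelevant_ideal[OF V])
  ultimately have "ereal (real (length ?es)) \<le> depth ?R (irrelevant_ideal V) Q"
    unfolding depth_def by (intro Sup_upper) blast
  then have d_le: "ereal (real d) \<le> depth ?R (irrelevant_ideal V) Q" by (simp add: length_elem_syms)
  have ann: "ideal (annihilator ?R Q) ?R"
    unfolding Q.annihilator_eq_colon by (rule Q.ideal_colon[OF Q.submodule_zero])
  have le_d: "module_dim ?R Q \<le> ereal (real d)"
    unfolding module_dim_def cring.krull_dim_quot[OF cring_poly_ring ann]
  proof (rule Sup_least, clarify)
    fix n P
    assume P: "\<forall>i\<le>n. primeideal (P i) ?R \<and> annihilator ?R Q \<subseteq> P i" and chain: "\<forall>i<n. P i \<subset> P (Suc i)"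
    have "annihilator ?R Q \<subseteq> P 0" using P by simp
    then have sub: "{s \<in> mon_span (mons V). \<forall>x\<in>mon_span U'. s * x \<in> mon_span U} \<subseteq> P 0"
      unfolding Q.annihilator_eq carrier_poly_ring .
    have P0: "primeideal (P 0) ?R" using P by simp
    obtain F where F: "F \<subseteq> V" "card F = d" "\<And>v. v \<in> V - F \<Longrightarrow> Var v \<in> P 0"
      using prime_contains_cofacet[OF cf P0 sub] by blast
    have "n \<le> card F" 
      by (rule prime_chain_length_le[where P = P, OF V F(1,3)]) (use P chain in auto)
    then show "ereal (real n) \<le> ereal (real d)" using F(2) by simp
  qed
  have depth_le: "depth ?R (irrelevant_ideal V) Q \<le> module_dim ?R Q" by (rule Q.depth_le_module_dim)
  show dim: "module_dim ?R Q = ereal (real d)" using d_le depth_le le_d by (meson order_antisym order_trans)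
  have "finitely_generated ?R Q"
  proof -
    obtain A where A: "finite A" "A \<subseteq> U'" "\<forall>m\<in>U' - U. \<exists>a\<in>A. \<exists>t\<in>mons V. m = t + a"
      using cone_filtration_generators[OF cf] by blast
    show ?thesis
    proof (rule Q.finitely_generatedI)
      show "finite ((\<lambda>a. single a (1::'k)) ` A)" using A(1) by simp
      show "(\<lambda>a. single a (1::'k)) ` A \<subseteq> mon_span U'" using A(2) single_in_mon_span by blast
      fix x :: "('v, 'k) mpoly" assume "x \<in> mon_span U'"
      then have "\<exists>a\<in>A. \<exists>t\<in>mons V. m = t + a" if "m \<in> keys x - U" for m
        using A(3) that by (auto simp: mon_span_def)
      then show "\<exists>c. (\<forall>a\<in>(\<lambda>a. single a (1::'k)) ` A. c a \<in> carrier ?R) \<and>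
          x - (\<Sum>a\<in>(\<lambda>a. single a 1) ` A. c a * a) \<in> mon_span U"
        using monomial_combination[OF A(1), of x U V] by (simp only: carrier_poly_ring)
    qed
  qed
  then show "cohen_macaulay ?R (irrelevant_ideal V) Q"
    unfolding cohen_macaulay_def using Q.module_axioms d_le depth_le le_d by (auto intro: order_antisym order_trans)
qed

section \<open>Images and subquotients of a presented module\<close>

context presented_module
begin

lemma phi_minus:
  assumes x: "x \<in> B"
  shows "\<phi> (- x) = \<ominus>\<^bsub>Q\<^esub> \<phi> x"
proof -
  have mx: "- x \<in> B" by (rule add_subgroupD(3)[OF add_subgroups(1) x])
  have "\<phi> (- x) \<oplus>\<^bsub>Q\<^esub> \<phi> x = \<zero>\<^bsub>Q\<^esub>" using hom_add[OF mx x] phi_zero by simp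
  then show ?thesis using M.minus_equality phi_closed x mx by metis
qed

lemma phi_in_image_iff:
  assumes B1: "add_subgroup B1" "C \<subseteq> B1" "B1 \<subseteq> B" and x: "x \<in> B"
  shows "\<phi> x \<in> \<phi> ` B1 \<longleftrightarrow> x \<in> B1"
proof
  assume "\<phi> x \<in> \<phi> ` B1"
  then obtain y where y: "y \<in> B1" "\<phi> x = \<phi> y" by blast
  then have "x - y \<in> B1" using phi_eqD[OF x] B1 by blast
  then have "x - y + y \<in> B1" using add_subgroupD(2)[OF B1(1)] y(1) by blast
  then show "x \<in> B1" by simp
qed simp

lemma additive_subgroup_image:
  assumes A: "add_subgroup A" "A \<subseteq> B"
  shows "additive_subgroup (\<phi> ` A) Q"
proof (rule additive_subgroupI, rule subgroup.intro)
  note sub = subsetD[OF A(2)]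
  show "\<phi> ` A \<subseteq> carrier (add_monoid Q)" using sub phi_closed by auto
  show "\<one>\<^bsub>add_monoid Q\<^esub> \<in> \<phi> ` A"
    using add_subgroupD(1)[OF A(1)] phi_zero by (metis image_eqI monoid.select_convs(2))
next
  note sub = subsetD[OF A(2)]
  fix x y assume "x \<in> \<phi> ` A" "y \<in> \<phi> ` A"
  then obtain a b where ab: "a \<in> A" "b \<in> A" "x = \<phi> a" "y = \<phi> b" by blast
  have "x \<oplus>\<^bsub>Q\<^esub> y = \<phi> (a + b)" using ab hom_add sub by simp
  then show "x \<otimes>\<^bsub>add_monoid Q\<^esub> y \<in> \<phi> ` A" using add_subgroupD(2)[OF A(1) ab(1,2)] by simp
next
  note sub = subsetD[OF A(2)]
  fix x assume "x \<in> \<phi> ` A"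
  then obtain a where a: "a \<in> A" "x = \<phi> a" by blast
  have "\<ominus>\<^bsub>Q\<^esub> x = \<phi> (- a)" using phi_minus[OF sub[OF a(1)]] a(2) by simp
  then show "inv\<^bsub>add_monoid Q\<^esub> x \<in> \<phi> ` A" using add_subgroupD(3)[OF A(1) a(1)] by (simp add: a_inv_def)
qed

lemma submodule_image:
  assumes A: "add_subgroup A" "A \<subseteq> B" and mult: "\<And>a x. a \<in> carrier R \<Longrightarrow> x \<in> A \<Longrightarrow> a * x \<in> A"
  shows "submodule (\<phi> ` A) R Q"
proof (intro submodule.intro submodule_axioms.intro)
  show "subgroup (\<phi> ` A) (add_monoid Q)"
    by (rule additive_subgroup.a_subgroup[OF additive_subgroup_image[OF A]])
  fix a x assume a: "a \<in> carrier R" and "x \<in> \<phi> ` A"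
  then obtain y where y: "y \<in> A" "x = \<phi> y" by blast
  have "a \<odot>\<^bsub>Q\<^esub> x = \<phi> (a * y)" using hom_smult[OF a subsetD[OF A(2) y(1)]] y(2) by simp
  then show "a \<odot>\<^bsub>Q\<^esub> x \<in> \<phi> ` A" using mult[OF a y(1)] by simp
qed

text \<open>If \<open>C \<subseteq> B\<^sub>1 \<subseteq> B\<^sub>2 \<subseteq> B\<close>, then \<open>B\<^sub>2/B\<^sub>1\<close> presents the quotient of the image of \<open>B\<^sub>2\<close> by that of \<open>B\<^sub>1\<close>.\<close>

lemma presented_subquotient:
  assumes B1: "add_subgroup B1" "\<And>a x. a \<in> carrier R \<Longrightarrow> x \<in> B1 \<Longrightarrow> a * x \<in> B1"
    and B2: "add_subgroup B2" "\<And>a x. a \<in> carrier R \<Longrightarrow> x \<in> B2 \<Longrightarrow> a * x \<in> B2"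
    and incl: "C \<subseteq> B1" "B1 \<subseteq> B2" "B2 \<subseteq> B"
  shows "presented_module R (subquotient Q (\<phi> ` B2) (\<phi> ` B1)) B2 B1
    (\<lambda>x. \<phi> ` B1 +>\<^bsub>Q\<lparr>carrier := \<phi> ` B2\<rparr>\<^esub> \<phi> x)"
proof -
  let ?Q2 = "Q\<lparr>carrier := \<phi> ` B2\<rparr>" and ?N = "\<phi> ` B1"
  have B1B: "B1 \<subseteq> B" using incl by blast
  have s1: "submodule ?N R Q" by (rule submodule_image[OF B1(1) B1B B1(2)])
  have s2: "submodule (\<phi> ` B2) R Q" by (rule submodule_image[OF B2(1) incl(3) B2(2)])
  have M2: "module R ?Q2" by (rule submodule.submodule_is_module[OF s2 module_axioms])
  interpret M2: module R ?Q2 by (rule M2)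
  have N: "submodule ?N R ?Q2"
  proof (rule M2.module_incl_imp_submodule)
    show "?N \<subseteq> carrier ?Q2" using incl by auto
    show "module R (?Q2\<lparr>carrier := ?N\<rparr>)" using submodule.submodule_is_module[OF s1 module_axioms] by simp
  qed
  have mem: "\<phi> x \<in> carrier ?Q2" if "x \<in> B2" for x using that by simp
  note sub = subsetD[OF incl(3)]
  have Qq: "module R (quot_module ?Q2 ?N)" by (rule M2.module_quot_module[OF N])
  show ?thesis
  proof (intro presented_module.intro presented_module_axioms.intro Qq)
    show "(\<lambda>x. ?N +>\<^bsub>?Q2\<^esub> \<phi> x) ` B2 = carrier (quot_module ?Q2 ?N)"
      by (simp add: M2.carrier_quot_module image_image)
  next
    fix x y assume xy: "x \<in> B2" "y \<in> B2"
    show "?N +>\<^bsub>?Q2\<^esub> \<phi> (x + y) =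
        (?N +>\<^bsub>?Q2\<^esub> \<phi> x) \<oplus>\<^bsub>quot_module ?Q2 ?N\<^esub> (?N +>\<^bsub>?Q2\<^esub> \<phi> y)"
      unfolding M2.add_quot_module[OF N mem[OF xy(1)] mem[OF xy(2)]] hom_add[OF sub[OF xy(1)] sub[OF xy(2)]]
      by simp
  next
    fix a x assume a: "a \<in> carrier R" and x: "x \<in> B2"
    show "?N +>\<^bsub>?Q2\<^esub> \<phi> (a * x) = a \<odot>\<^bsub>quot_module ?Q2 ?N\<^esub> (?N +>\<^bsub>?Q2\<^esub> \<phi> x)"
      unfolding M2.smult_quot_module[OF N a mem[OF x]] hom_smult[OF a sub[OF x]] by simp
  next
    fix x assume x: "x \<in> B2"
    show "(?N +>\<^bsub>?Q2\<^esub> \<phi> x = \<zero>\<^bsub>quot_module ?Q2 ?N\<^esub>) = (x \<in> B1)"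
      unfolding M2.zero_quot_module M2.rcos_eq_self_iff[OF N mem[OF x]]
      by (rule phi_in_image_iff[OF B1(1) incl(1) B1B sub[OF x]])
  qed (use B1 B2 incl ring_ops in auto)
qed

end

section \<open>The edge ideal and the quotient by it\<close>

lemma ideal_mon_span:
  assumes U: "upset V U"
  shows "ideal (mon_span U) (poly_ring V :: ('v, 'k::field) mpoly ring)"
proof -
  let ?R = "poly_ring V :: ('v, 'k) mpoly ring"
  interpret R: cring ?R by (rule cring_poly_ring)
  note sg = add_subgroupD[OF add_subgroup_mon_span[of U]]
  have sub: "mon_span U \<subseteq> carrier ?R"
    using U mon_span_mono[of U "mons V"] by (auto simp: upset_def carrier_poly_ring)
  show ?thesis
  proof (rule idealI)
    show "ring ?R" by (rule R.ring_axioms)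
    show "subgroup (mon_span U) (add_monoid ?R)"
    proof (rule subgroup.intro)
      fix x :: "('v, 'k) mpoly" assume x: "x \<in> mon_span U"
      have "x \<oplus>\<^bsub>?R\<^esub> - x = \<zero>\<^bsub>?R\<^esub>" by (simp add: poly_ring_ops)
      moreover have "x \<in> carrier ?R" "- x \<in> carrier ?R" using x sg(3)[OF x] sub by blast+
      ultimately have "\<ominus>\<^bsub>?R\<^esub> x = - x"
        using R.sum_zero_eq_neg[of "- x" x] by (simp add: poly_ring_ops)
      then show "inv\<^bsub>add_monoid ?R\<^esub> x \<in> mon_span U" using sg(3)[OF x] by (simp add: a_inv_def)
    qed (use sub sg in \<open>auto simp: poly_ring_ops\<close>)
  next
    fix a x :: "('v, 'k) mpoly" assume "a \<in> mon_span U" "x \<in> carrier ?R"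
    then show "x \<otimes>\<^bsub>?R\<^esub> a \<in> mon_span U" "a \<otimes>\<^bsub>?R\<^esub> x \<in> mon_span U"
      using mult_in_mon_span[OF U, of x a] by (simp_all add: poly_ring_ops carrier_poly_ring mult.commute)
  qed
qed

text \<open>Monomials whose support is independent; they represent a basis of the quotient by the edge ideal.\<close>

definition good_mons :: "'v graph \<Rightarrow> ('v \<Rightarrow>\<^sub>0 nat) set" where
  "good_mons G = {m \<in> mons (verts G). indep (keys m) (edges G)}"

abbreviation bad_mons :: "'v graph \<Rightarrow> ('v \<Rightarrow>\<^sub>0 nat) set" where
  "bad_mons G \<equiv> mons (verts G) - good_mons G"

lemma upset_bad_mons: "upset (verts G) (bad_mons G)"
  unfolding upset_def
proof (intro conjI ballI)
  fix t m assume "t \<in> mons (verts G)" "m \<in> bad_mons G"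
  then show "t + m \<in> bad_mons G"
    using smaller_indep[of "keys (t + m)" "edges G" "keys m"] by (auto simp: good_mons_def mons_add_iff keys_add_nat)
qed auto

lemma edge_ideal_eq_mon_span:
  fixes G :: "'v graph"
  assumes G: "finite_simple_graph G"
  shows "edge_ideal G = (mon_span (bad_mons G) :: ('v, 'k::field) mpoly set)"
proof
  let ?V = "verts G"
  let ?R = "poly_ring ?V :: ('v, 'k) mpoly ring"
  let ?S = "{Var u * Var v | u v. {u, v} \<in> edges G} :: ('v, 'k) mpoly set"
  interpret R: cring ?R by (rule cring_poly_ring)
  have ends: "u \<in> ?V" "v \<in> ?V" "u \<noteq> v" if "{u, v} \<in> edges G" for u v
    using G that by (auto simp: finite_simple_graph_def)
  have VarVar: "Var u * Var v = (single (single u 1 + single v 1) 1 :: ('v, 'k) mpoly)" for u v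
    by (simp add: Var_def mult_single)
  have S: "?S \<subseteq> mon_span (bad_mons G)"
  proof clarify
    fix u v assume uv: "{u, v} \<in> edges G"
    have "keys (single u 1 + single v (1::nat)) = {u, v}" by (auto simp: keys_add_nat)
    then have "single u 1 + single v (1::nat) \<in> bad_mons G"
      using ends[OF uv] uv by (auto simp: good_mons_def mons_def indep_def)
    then show "Var u * Var v \<in> (mon_span (bad_mons G) :: ('v, 'k) mpoly set)"
      unfolding VarVar by (rule single_in_mon_span)
  qed
  show "edge_ideal G \<subseteq> (mon_span (bad_mons G) :: ('v, 'k) mpoly set)"
    unfolding edge_ideal_def by (rule R.genideal_minimal[OF ideal_mon_span[OF upset_bad_mons] S])
  have SR: "?S \<subseteq> carrier ?R" using S mon_span_mono[of "bad_mons G" "mons ?V"] by (auto simp: carrier_poly_ring)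
  have idl: "ideal (edge_ideal G) ?R"
    unfolding edge_ideal_def by (rule R.genideal_ideal[OF SR])
  note D = ideal_poly_ringD[OF idl]
  show "mon_span (bad_mons G) \<subseteq> (edge_ideal G :: ('v, 'k) mpoly set)"
  proof
    fix p :: "('v, 'k) mpoly" assume p: "p \<in> mon_span (bad_mons G)"
    have "single m (lookup p m) \<in> edge_ideal G" if m: "m \<in> keys p" for m
    proof -
      have "m \<in> bad_mons G" using p m by (auto simp: mon_span_def)
      then obtain u v where uv: "u \<in> keys m" "v \<in> keys m" "{u, v} \<in> edges G" and mV: "m \<in> mons ?V"
        by (auto simp: good_mons_def indep_def)
      obtain b where b: "m = set_mon {u, v} + b" "keys b \<subseteq> keys m"
        using mon_decomp_set_mon[of "{u, v}" m] uv by auto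
      have "single m (lookup p m) = single b (lookup p m) * (Var u * Var v)"
        using ends(3)[OF uv(3)] by (simp add: VarVar mult_single b(1) set_mon_def add.commute)
      moreover have "Var u * Var v \<in> (edge_ideal G :: ('v, 'k) mpoly set)"
        unfolding edge_ideal_def using R.genideal_self[OF SR] uv(3) by blast
      moreover have "single b (lookup p m) \<in> mon_span (mons ?V)"
        using b(2) mV by (intro single_in_mon_span) (auto simp: mons_def)
      ultimately show ?thesis using D(3) by metis
    qed
    then have "(\<Sum>m\<in>keys p. single m (lookup p m)) \<in> edge_ideal G" by (rule add_subgroup_sum[OF D(1)])
    then show "p \<in> edge_ideal G" by (simp only: poly_eq_sum_single[symmetric])
  qed
qed

lemma presented_self_module:
  "presented_module (poly_ring V) (self_module (poly_ring V)) (mon_span (mons V)) {0} (\<lambda>x :: ('v, 'k::field) mpoly. x)"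
proof -
  let ?R = "poly_ring V :: ('v, 'k) mpoly ring"
  interpret R: cring ?R by (rule cring_poly_ring)
  have ops: "carrier (self_module ?R) = mon_span (mons V)" "add (self_module ?R) = (+)"
    "zero (self_module ?R) = 0" "smult (self_module ?R) = (*)"
    by (simp_all add: self_module_def carrier_poly_ring poly_ring_ops)
  note sg = add_subgroupD[OF add_subgroup_mon_span[of "mons V"]]
  have "abelian_group (self_module ?R)"
  proof (rule abelian_groupI; unfold ops)
    show "\<exists>y\<in>mon_span (mons V). y + x = 0" if "x \<in> mon_span (mons V)" for x :: "('v, 'k) mpoly"
      using sg(3)[OF that] by (intro bexI[of _ "- x"]) auto
  qed (auto intro: sg(1) sg(2) simp: algebra_simps)
  then have "module ?R (self_module ?R)"
    by (intro moduleI R.cring_axioms)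
      (auto intro: mult_in_mon_span[OF upset_mons] simp: ops poly_ring_ops carrier_poly_ring algebra_simps)
  then show ?thesis
    by (intro presented_module.intro presented_module_axioms.intro)
      (auto intro: mult_in_mon_span[OF upset_mons] sg(1)
        simp: ops poly_ring_ops carrier_poly_ring add_subgroup_mon_span add_subgroup_def[of "{0}"])
qed

lemma presented_edge_module:
  fixes G :: "'v graph"
  assumes G: "finite_simple_graph G"
  shows "presented_module (poly_ring (verts G)) (edge_module G) (mon_span (mons (verts G))) (mon_span (bad_mons G))
    (\<lambda>p :: ('v, 'k::field) mpoly. edge_ideal G +>\<^bsub>poly_ring (verts G)\<^esub> p)"
proof -
  let ?V = "verts G"
  let ?R = "poly_ring ?V :: ('v, 'k) mpoly ring"
  interpret S: presented_module ?R "self_module ?R" "mon_span (mons ?V)" "{0}" "\<lambda>x. x"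
    by (rule presented_self_module)
  have car: "(self_module ?R)\<lparr>carrier := mon_span (mons ?V)\<rparr> = self_module ?R"
    by (simp add: self_module_def carrier_poly_ring)
  have coset: "I +>\<^bsub>self_module ?R\<^esub> x = I +>\<^bsub>?R\<^esub> x" for I x
    by (simp add: a_r_coset_def r_coset_def self_module_def)
  have "presented_module ?R (subquotient (self_module ?R) ((\<lambda>x. x) ` mon_span (mons ?V)) ((\<lambda>x. x) ` mon_span (bad_mons G)))
      (mon_span (mons ?V)) (mon_span (bad_mons G))
      (\<lambda>x. (\<lambda>x. x) ` mon_span (bad_mons G) +>\<^bsub>(self_module ?R)\<lparr>carrier := (\<lambda>x. x) ` mon_span (mons ?V)\<rparr>\<^esub> x)"
    by (rule S.presented_subquotient)
      (auto simp: add_subgroup_mon_span carrier_poly_ring add_subgroupD(1)[OF add_subgroup_mon_span]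
        intro: mult_in_mon_span[OF upset_mons] mult_in_mon_span[OF upset_bad_mons] subsetD[OF mon_span_mono])
  then show ?thesis
    by (simp only: image_ident car coset edge_module_def edge_ideal_eq_mon_span[OF G])
qed

section \<open>The grading of the edge module\<close>

text \<open>The homogeneous component of degree \<open>d\<close>.\<close>

abbreviation degree_part :: "int \<Rightarrow> ('v, 'k::field) mpoly \<Rightarrow> ('v, 'k) mpoly" where
  "degree_part d \<equiv> mon_restrict {m. int (mon_degree m) = d}"

lemma poly_grading_eq: "poly_grading V d = mon_span (mons V \<inter> {m. int (mon_degree m) = d})"
  by (auto simp: poly_grading_def carrier_poly_ring mon_span_def)

lemma sum_degree_parts: "(\<Sum>d\<in>(\<lambda>m. int (mon_degree m)) ` keys p. degree_part d p) = p"
proof (rule poly_mapping_eqI)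
  fix m
  have "lookup (\<Sum>d\<in>(\<lambda>m. int (mon_degree m)) ` keys p. degree_part d p) m =
      (\<Sum>d\<in>(\<lambda>m. int (mon_degree m)) ` keys p. if d = int (mon_degree m) then lookup p m else 0)"
    by (simp add: lookup_sum lookup_mon_restrict eq_commute)
  also have "\<dots> = lookup p m"
    by (auto simp: in_keys_iff)
  finally show "lookup (\<Sum>d\<in>(\<lambda>m. int (mon_degree m)) ` keys p. degree_part d p) m = lookup p m" .
qed

lemma degree_part_sum:
  assumes "finite D" "\<And>d. d \<in> D \<Longrightarrow> q d \<in> poly_grading V d"
  shows "degree_part e (sum q D) = (if e \<in> D then q e else 0)"
proof (rule poly_mapping_eqI)
  fix m
  have q: "lookup (q d) m = (if int (mon_degree m) = d then lookup (q d) m else 0)" if "d \<in> D" for d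
    using assms(2)[OF that] by (auto simp: poly_grading_eq mon_span_def in_keys_iff)
  have "(\<Sum>d\<in>D. lookup (q d) m) = (\<Sum>d\<in>D. if int (mon_degree m) = d then lookup (q d) m else 0)"
    by (rule sum.cong[OF refl q])
  also have "\<dots> = (if int (mon_degree m) \<in> D then lookup (q (int (mon_degree m))) m else 0)"
    using assms(1) by simp
  finally have "lookup (degree_part e (sum q D)) m =
      (if int (mon_degree m) = e then if int (mon_degree m) \<in> D then lookup (q (int (mon_degree m))) m else 0 else 0)"
    by (simp add: lookup_mon_restrict lookup_sum)
  also have "\<dots> = lookup (if e \<in> D then q e else 0) m"
    using q[of e] by auto
  finally show "lookup (degree_part e (sum q D)) m = lookup (if e \<in> D then q e else 0) m" .
qed

lemma mon_restrict_diff: "mon_restrict X (p - q) = mon_restrict X p - mon_restrict X q"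
  by (rule poly_mapping_eqI) (simp add: lookup_mon_restrict lookup_minus)

text \<open>The homogeneous components of a polynomial have monomials among those of the polynomial. With \<open>W\<close> the
  set of all monomials this is the decomposition of the whole module.\<close>

lemma edge_module_homogeneous_decomposition:
  fixes G :: "'v graph"
  assumes G: "finite_simple_graph G" and W: "W \<subseteq> mons (verts G)" and x: "x \<in> mon_span W"
  defines "\<phi> \<equiv> \<lambda>p :: ('v, 'k::field) mpoly. edge_ideal G +>\<^bsub>poly_ring (verts G)\<^esub> p"
    and "c \<equiv> \<lambda>d. edge_ideal G +>\<^bsub>poly_ring (verts G)\<^esub> degree_part d x"
  shows "c d \<in> \<phi> ` mon_span W \<inter> edge_module_grading G d"
    and "finite {d. c d \<noteq> \<zero>\<^bsub>edge_module G\<^esub>}"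
    and "\<phi> x = (\<Oplus>\<^bsub>edge_module G\<^esub>d\<in>{d. c d \<noteq> \<zero>\<^bsub>edge_module G\<^esub>}. c d)"
proof -
  let ?V = "verts G" and ?M = "edge_module G :: (('v, 'k) mpoly, ('v, 'k) mpoly set) module"
  interpret M: presented_module "poly_ring ?V :: ('v, 'k) mpoly ring" ?M "mon_span (mons ?V)" "mon_span (bad_mons G)" \<phi>
    unfolding \<phi>_def by (rule presented_edge_module[OF G])
  have c: "c d = \<phi> (degree_part d x)" for d by (simp add: c_def \<phi>_def)
  have part: "degree_part d x \<in> mon_span (W \<inter> {m. int (mon_degree m) = d})" for d
    by (rule mon_restrict_in_mon_span[OF x])
  have partW: "degree_part d x \<in> mon_span W" for d using part mon_span_mono[of "W \<inter> _" W] by blast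
  have partV: "degree_part d x \<in> mon_span (mons ?V)" for d using partW mon_span_mono[OF W] by blast
  show "c d \<in> \<phi> ` mon_span W \<inter> edge_module_grading G d"
  proof
    show "c d \<in> \<phi> ` mon_span W" using c partW by blast
    have "degree_part d x \<in> poly_grading ?V d"
      unfolding poly_grading_eq using part[of d] W mon_span_mono[of "W \<inter> _" "mons ?V \<inter> _"] by blast
    then show "c d \<in> edge_module_grading G d" unfolding edge_module_grading_def c_def by (rule imageI)
  qed
  let ?D = "(\<lambda>m. int (mon_degree m)) ` keys x"
  have zero: "c d = \<zero>\<^bsub>?M\<^esub>" if "d \<notin> ?D" for d
  proof -
    have "keys (degree_part d x) = {}" using that by (auto simp: keys_mon_restrict)
    then have "degree_part d x = 0" by simp
    then show ?thesis using c M.phi_zero by simp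
  qed
  then have sub: "{d. c d \<noteq> \<zero>\<^bsub>?M\<^esub>} \<subseteq> ?D" by blast
  then show "finite {d. c d \<noteq> \<zero>\<^bsub>?M\<^esub>}" by (rule finite_subset) simp
  have "\<phi> (\<Sum>d\<in>?D. degree_part d x) = (\<Oplus>\<^bsub>?M\<^esub>d\<in>?D. \<phi> (degree_part d x))"
    using M.hom_sum[of ?D "\<lambda>d. degree_part d x"] partV by simp
  then have "\<phi> x = (\<Oplus>\<^bsub>?M\<^esub>d\<in>?D. c d)" by (simp add: sum_degree_parts c)
  also have "\<dots> = (\<Oplus>\<^bsub>?M\<^esub>d\<in>{d. c d \<noteq> \<zero>\<^bsub>?M\<^esub>}. c d)"
    using sub M.phi_closed[OF partV] by (intro M.M.add.finprod_mono_neutral_cong_right) (auto simp: c)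
  finally show "\<phi> x = (\<Oplus>\<^bsub>?M\<^esub>d\<in>{d. c d \<noteq> \<zero>\<^bsub>?M\<^esub>}. c d)" .
qed

lemma graded_edge_module:
  fixes G :: "'v graph"
  assumes G: "finite_simple_graph G"
  shows "graded_module (poly_ring (verts G)) (poly_grading (verts G))
    (edge_module G :: (('v, 'k::field) mpoly, ('v, 'k) mpoly set) module) (edge_module_grading G)"
proof -
  let ?V = "verts G" and ?M = "edge_module G :: (('v, 'k) mpoly, ('v, 'k) mpoly set) module"
  define \<phi> where "\<phi> = (\<lambda>p :: ('v, 'k) mpoly. edge_ideal G +>\<^bsub>poly_ring (verts G)\<^esub> p)"
  interpret M: presented_module "poly_ring ?V :: ('v, 'k) mpoly ring" ?M "mon_span (mons ?V)" "mon_span (bad_mons G)" \<phi>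
    unfolding \<phi>_def by (rule presented_edge_module[OF G])
  have gr: "edge_module_grading G d = \<phi> ` poly_grading ?V d" for d
    by (simp add: edge_module_grading_def \<phi>_def)
  have sub: "poly_grading ?V d \<subseteq> (mon_span (mons ?V) :: ('v, 'k) mpoly set)" for d
    unfolding poly_grading_eq by (rule mon_span_mono) simp
  show ?thesis unfolding graded_module_def
  proof (intro conjI allI ballI)
    show "module (poly_ring ?V) ?M" by (rule M.module_axioms)
    show "additive_subgroup (edge_module_grading G d) ?M" for d
      unfolding gr by (rule M.additive_subgroup_image[OF _ sub]) (simp add: poly_grading_eq add_subgroup_mon_span)
  next
    fix d e and a :: "('v, 'k) mpoly" and x assume a: "a \<in> poly_grading ?V d" 
      and "x \<in> (edge_module_grading G e :: ('v, 'k) mpoly set set)"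
    then obtain p where p: "p \<in> poly_grading ?V e" "x = \<phi> p" unfolding gr by blast
    have "a * p \<in> poly_grading ?V (d + e)"
    proof -
      have "keys (a * p) \<subseteq> {m + n | m n. m \<in> keys a \<and> n \<in> keys p}" by (rule keys_mult)
      also have "\<dots> \<subseteq> mons ?V \<inter> {m. int (mon_degree m) = d + e}"
      proof clarify
        fix m n assume "m \<in> keys a" "n \<in> keys p"
        then have "m \<in> mons ?V \<inter> {m. int (mon_degree m) = d}" "n \<in> mons ?V \<inter> {m. int (mon_degree m) = e}"
          using a p(1) unfolding poly_grading_eq mon_span_def by blast+
        then show "m + n \<in> mons ?V \<inter> {m. int (mon_degree m) = d + e}"
          by (simp add: mons_add_iff mon_degree_add)
      qed
      finally show ?thesis by (simp add: poly_grading_eq mon_span_def)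
    qed
    moreover have "a \<odot>\<^bsub>?M\<^esub> x = \<phi> (a * p)"
      using M.hom_smult[of a p] a p sub by (auto simp: carrier_poly_ring)
    ultimately show "a \<odot>\<^bsub>?M\<^esub> x \<in> edge_module_grading G (d + e)" unfolding gr by blast
  next
    fix x assume "x \<in> carrier ?M"
    then obtain p where p: "p \<in> mon_span (mons ?V)" "x = \<phi> p" using M.surj by blast
    note dec = edge_module_homogeneous_decomposition[OF G subset_refl p(1), folded \<phi>_def]
    show "\<exists>!c. (\<forall>d. c d \<in> edge_module_grading G d) \<and> finite {d. c d \<noteq> \<zero>\<^bsub>?M\<^esub>} \<and>
        x = (\<Oplus>\<^bsub>?M\<^esub>d\<in>{d. c d \<noteq> \<zero>\<^bsub>?M\<^esub>}. c d)"
    proof (rule ex1I[of _ "\<lambda>d. \<phi> (degree_part d p)"])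
      show "(\<forall>d. \<phi> (degree_part d p) \<in> edge_module_grading G d) \<and>
          finite {d. \<phi> (degree_part d p) \<noteq> \<zero>\<^bsub>?M\<^esub>} \<and>
          x = (\<Oplus>\<^bsub>?M\<^esub>d\<in>{d. \<phi> (degree_part d p) \<noteq> \<zero>\<^bsub>?M\<^esub>}. \<phi> (degree_part d p))"
        using dec p(2) by blast
    next
      fix c assume c: "(\<forall>d. c d \<in> edge_module_grading G d) \<and> finite {d. c d \<noteq> \<zero>\<^bsub>?M\<^esub>} \<and>
        x = (\<Oplus>\<^bsub>?M\<^esub>d\<in>{d. c d \<noteq> \<zero>\<^bsub>?M\<^esub>}. c d)"
      let ?D = "{d. c d \<noteq> \<zero>\<^bsub>?M\<^esub>}"
      have "\<exists>q. q \<in> poly_grading ?V d \<and> c d = \<phi> q" for d using c unfolding gr by blast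
      then obtain q where q: "\<And>d. q d \<in> poly_grading ?V d" "\<And>d. c d = \<phi> (q d)" by metis
      have qV: "q d \<in> mon_span (mons ?V)" for d using q(1) sub by blast
      have hs: "sum q ?D \<in> mon_span (mons ?V) \<and> \<phi> (sum q ?D) = (\<Oplus>\<^bsub>?M\<^esub>d\<in>?D. \<phi> (q d))"
        using M.hom_sum[of ?D q] c qV by simp
      then have "\<phi> p = \<phi> (sum q ?D)" using c p(2) by (simp add: q(2))
      then have diff: "p - sum q ?D \<in> mon_span (bad_mons G)" using M.phi_eqD[OF p(1)] hs by blast
      show "c = (\<lambda>d. \<phi> (degree_part d p))"
      proof
        fix e
        let ?r = "if e \<in> ?D then q e else 0"
        have "degree_part e (p - sum q ?D) \<in> mon_span (bad_mons G)"
          using mon_restrict_in_mon_span[OF diff] mon_span_mono[of "bad_mons G \<inter> _" "bad_mons G"] by blast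
        then have d1: "degree_part e p - ?r \<in> mon_span (bad_mons G)"
          using degree_part_sum[of ?D q ?V e] c q(1) by (simp add: mon_restrict_diff)
        have rV: "?r \<in> mon_span (mons ?V)" by (simp add: qV add_subgroupD(1)[OF add_subgroup_mon_span])
        have dV: "degree_part e p - ?r \<in> mon_span (mons ?V)" using d1 M.CB by blast
        have "\<phi> (degree_part e p - ?r + ?r) = \<phi> (degree_part e p - ?r) \<oplus>\<^bsub>?M\<^esub> \<phi> ?r"
          by (rule M.hom_add[OF dV rV])
        also have "\<phi> (degree_part e p - ?r) = \<zero>\<^bsub>?M\<^esub>" using M.kernel[OF dV] d1 by blast
        also have "\<zero>\<^bsub>?M\<^esub> \<oplus>\<^bsub>?M\<^esub> \<phi> ?r = \<phi> ?r" using M.phi_closed[OF rV] by (rule M.M.l_zero)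
        also have "\<phi> ?r = c e" using q(2)[of e] M.phi_zero by auto
        finally show "c e = \<phi> (degree_part e p)" by simp
      qed
    qed
  qed
qed

section \<open>Graphs whose independence complex is partitioned into intervals\<close>

text \<open>The independence complex is partitioned into the intervals between \<open>A\<close> and \<open>facet_of A\<close>, where \<open>A\<close> ranges over
  the cores of independent sets: \<open>core S\<close> is the bottom of the interval that contains \<open>S\<close>. Enlarging the
  independent set enlarges the core and does not increase the size of the top of the interval. The set
  \<open>facet_of A\<close> is a face, but need not be a maximal one.\<close>

locale partitioned_graph =
  fixes G :: "'v graph" and core facet_of :: "'v set \<Rightarrow> 'v set"
  assumes graph: "finite_simple_graph G"
    and core_subset: "S \<in> independence_complex G \<Longrightarrow> core S \<subseteq> S"
    and subset_facet: "S \<in> independence_complex G \<Longrightarrow> S \<subseteq> facet_of (core S)"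
    and facet_verts: "S \<in> independence_complex G \<Longrightarrow> facet_of (core S) \<subseteq> verts G"
    and interval: "S \<in> independence_complex G \<Longrightarrow> core S \<subseteq> T \<Longrightarrow> T \<subseteq> facet_of (core S) \<Longrightarrow>
      T \<in> independence_complex G \<and> core T = core S"
    and core_mono: "T \<in> independence_complex G \<Longrightarrow> S \<subseteq> T \<Longrightarrow> core S \<subseteq> core T"
    and card_facet_antimono: "T \<in> independence_complex G \<Longrightarrow> S \<subseteq> T \<Longrightarrow>
      card (facet_of (core T)) \<le> card (facet_of (core S))"
begin

abbreviation "V \<equiv> verts G"

lemma finite_V: "finite V"
  using graph by (simp add: finite_simple_graph_def)

lemma finite_core: "S \<in> independence_complex G \<Longrightarrow> finite (core S)"
  by (rule finite_subset[OF core_subset])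
    (auto simp: independence_complex_def intro: finite_subset[OF _ finite_V])

lemma good_mons_iff: "m \<in> good_mons G \<longleftrightarrow> keys m \<in> independence_complex G"
  by (simp add: good_mons_def mons_def independence_complex_def)

lemma good_summand:
  assumes "t + m \<in> good_mons G"
  shows "m \<in> good_mons G" "core (keys m) \<subseteq> core (keys (t + m))"
    "card (facet_of (core (keys (t + m)))) \<le> card (facet_of (core (keys m)))"
proof -
  have tm: "keys (t + m) \<in> independence_complex G" and sub: "keys m \<subseteq> keys (t + m)"
    using assms by (simp_all add: good_mons_iff keys_add_nat)
  show "m \<in> good_mons G"
    using tm sub smaller_indep[of "keys (t + m)" "edges G" "keys m"]
    by (auto simp: good_mons_iff independence_complex_def)
  show "core (keys m) \<subseteq> core (keys (t + m))" by (rule core_mono[OF tm sub])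
  show "card (facet_of (core (keys (t + m)))) \<le> card (facet_of (core (keys m)))"
    by (rule card_facet_antimono[OF tm sub])
qed

text \<open>The size of the top of the interval that contains the support of \<open>m\<close>, that is, the dimension of the cone that
  contains \<open>m\<close>; only used for \<open>m\<close> with independent support.\<close>

definition level :: "('v \<Rightarrow>\<^sub>0 nat) \<Rightarrow> nat" where
  "level m = card (facet_of (core (keys m)))"

text \<open>The monomials of the edge ideal and those on levels below \<open>k\<close>. The images of their spans
  in the quotient by the edge ideal form the filtration.\<close>

definition stage :: "nat \<Rightarrow> ('v \<Rightarrow>\<^sub>0 nat) set" where
  "stage k = bad_mons G \<union> {m \<in> good_mons G. level m < k}"

lemma upset_union_good:
  assumes "\<And>t m. t + m \<in> good_mons G \<Longrightarrow> m \<in> good_mons G \<Longrightarrow> P m \<Longrightarrow> P (t + m)"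
  shows "upset V (bad_mons G \<union> {m \<in> good_mons G. P m})"
  unfolding upset_def
proof (intro conjI ballI)
  show "bad_mons G \<union> {m \<in> good_mons G. P m} \<subseteq> mons V" by (auto simp: good_mons_def)
  fix t m assume t: "t \<in> mons V" and m: "m \<in> bad_mons G \<union> {m \<in> good_mons G. P m}"
  show "t + m \<in> bad_mons G \<union> {m \<in> good_mons G. P m}"
  proof (cases "t + m \<in> good_mons G")
    case True
    then show ?thesis using assms[OF True good_summand(1)[OF True]] m good_summand(1)[OF True] by blast
  next
    case False
    have "m \<in> mons V" using m by (auto simp: good_mons_def)
    then show ?thesis using False t by (simp add: mons_add_iff)
  qed
qed

lemma upset_stage: "upset V (stage k)"
  unfolding stage_def
  by (rule upset_union_good) (use good_summand(3) in \<open>auto simp: level_def intro: order_le_less_trans\<close>)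

text \<open>The monomials whose support has core \<open>A\<close> form the cone with apex \<open>x\<^sup>A\<close> over \<open>facet_of A\<close>.\<close>

lemma cone_core:
  assumes S: "S \<in> independence_complex G"
  shows "cone (set_mon (core S)) (facet_of (core S)) = {m \<in> good_mons G. core (keys m) = core S}"
proof -
  have fin: "finite (core S)" by (rule finite_core[OF S])
  have sub: "core S \<subseteq> facet_of (core S)" using core_subset[OF S] subset_facet[OF S] by blast
  show ?thesis
  proof (intro equalityI subsetI)
    fix m assume "m \<in> cone (set_mon (core S)) (facet_of (core S))"
    then obtain b where b: "m = set_mon (core S) + b" "keys b \<subseteq> facet_of (core S)"
      by (auto simp: cone_def mons_def)
    then have "keys m = core S \<union> keys b" using fin by (simp add: keys_add_nat keys_set_mon)
    then show "m \<in> {m \<in> good_mons G. core (keys m) = core S}"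
      using interval[OF S, of "keys m"] sub b(2) by (auto simp: good_mons_iff)
  next
    fix m assume "m \<in> {m \<in> good_mons G. core (keys m) = core S}"
    then have m: "keys m \<in> independence_complex G" "core (keys m) = core S" by (auto simp: good_mons_iff)
    then have "core S \<subseteq> keys m" "keys m \<subseteq> facet_of (core S)"
      using core_subset[OF m(1)] subset_facet[OF m(1)] by auto
    then obtain b where "m = set_mon (core S) + b" "keys b \<subseteq> facet_of (core S)"
      using mon_decomp_set_mon[OF fin, of m] by (metis order_trans)
    then show "m \<in> cone (set_mon (core S)) (facet_of (core S))" by (auto simp: cone_def mons_def)
  qed
qed

text \<open>The cones on level \<open>d\<close> are added one by one, those with larger cores first.\<close>

lemma cone_filtration_stage: "cone_filtration V d (stage d) (stage (Suc d))"
proof -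
  \<comment> \<open>the sets \<open>\<B>\<close> below run through the families of cores that are upward closed in \<open>\<A>\<close>\<close>
  define \<A> where "\<A> = {A \<in> core ` independence_complex G. card (facet_of A) = d}"
  define U where "U \<B> = bad_mons G \<union> {m \<in> good_mons G. level m < d \<or> core (keys m) \<in> \<B>}" for \<B>
  have finI: "finite (independence_complex G)"
    using finite_V by (auto simp: independence_complex_def intro: finite_subset[of _ "Pow V"])
  then have finA: "finite \<A>" by (simp add: \<A>_def)
  have fin: "finite A" if "A \<in> \<A>" for A using that finite_core by (auto simp: \<A>_def)
  have up: "upset V (U \<B>)" if \<B>: "\<B> \<subseteq> \<A>" "\<And>A B. A \<in> \<B> \<Longrightarrow> B \<in> \<A> \<Longrightarrow> A \<subseteq> B \<Longrightarrow> B \<in> \<B>" for \<B>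
    unfolding U_def
  proof (rule upset_union_good)
    fix t m assume tm: "t + m \<in> good_mons G" and m: "level m < d \<or> core (keys m) \<in> \<B>"
    note g = good_summand[OF tm]
    have le: "level (t + m) \<le> level m" using g(3) by (simp add: level_def)
    show "level (t + m) < d \<or> core (keys (t + m)) \<in> \<B>"
    proof (cases "level (t + m) < d")
      case False
      then have core: "core (keys m) \<in> \<B>" using m le by linarith
      then have "level m = d" using \<B>(1) by (auto simp: \<A>_def level_def)
      then have "level (t + m) = d" using le False by linarith
      then have "core (keys (t + m)) \<in> \<A>" using tm by (auto simp: \<A>_def level_def good_mons_iff)
      then show ?thesis using \<B>(2)[OF core _ g(2)] by blast
    qed simp
  qed
  have "cone_filtration V d (stage d) (U \<B>)"
    if "finite \<B>" "\<B> \<subseteq> \<A>" "\<And>A B. A \<in> \<B> \<Longrightarrow> B \<in> \<A> \<Longrightarrow> A \<subseteq> B \<Longrightarrow> B \<in> \<B>" for \<B>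
    using that
  proof (induction \<B> rule: finite_psubset_induct)
    case (psubset \<B>)
    show ?case
    proof (cases "\<B> = {}")
      case True
      have "U {} = stage d" by (auto simp: U_def stage_def)
      then show ?thesis using True upset_stage by (simp add: cone_filtration.base)
    next
      case False
      then obtain A where A: "A \<in> \<B>" and min: "\<And>B. B \<in> \<B> \<Longrightarrow> card A \<le> card B"
        using ex_has_least_nat[of "\<lambda>A. A \<in> \<B>" _ card] by blast
      let ?\<B> = "\<B> - {A}"
      have closed: "C \<in> ?\<B>" if "B \<in> ?\<B>" "C \<in> \<A>" "B \<subseteq> C" for B C
      proof -
        have "C \<in> \<B>" using psubset.prems(2) that by blast
        moreover have "C \<noteq> A"
        proof
          assume "C = A"
          then have "B \<subset> A" using that by blast
          then have "card B < card A" using fin A psubset.prems(1) by (intro psubset_card_mono) auto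
          then show False using min[of B] that(1) by auto
        qed
        ultimately show ?thesis by blast
      qed
      obtain S where S: "S \<in> independence_complex G" "A = core S" and cA: "card (facet_of A) = d"
        using A psubset.prems(1) by (auto simp: \<A>_def)
      have cone: "cone (set_mon A) (facet_of A) = {m \<in> good_mons G. core (keys m) = A}"
        unfolding S(2) by (rule cone_core[OF S(1)])
      show ?thesis
      proof (rule cone_filtration.add_cone)
        show "cone_filtration V d (stage d) (U ?\<B>)"
          using A psubset.prems(1) closed by (intro psubset.IH) blast+
        show "upset V (U \<B>)" by (rule up[OF psubset.prems])
        show "facet_of A \<subseteq> V" unfolding S(2) by (rule facet_verts[OF S(1)])
        show "card (facet_of A) = d" by (rule cA)
        show "U ?\<B> \<inter> cone (set_mon A) (facet_of A) = {}"
          unfolding cone using cA by (auto simp: U_def level_def)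
        show "U \<B> = U ?\<B> \<union> cone (set_mon A) (facet_of A)"
          unfolding cone using A by (auto simp: U_def)
      qed
    qed
  qed
  from this[OF finA] have "cone_filtration V d (stage d) (U \<A>)" by blast
  moreover have "U \<A> = stage (Suc d)"
    by (auto simp: U_def stage_def \<A>_def level_def good_mons_iff less_Suc_eq)
  ultimately show ?thesis by simp
qed

theorem sequentially_cohen_macaulay: "sequentially_cohen_macaulay_graph TYPE('k::field) G"
proof -
  let ?R = "poly_ring V :: ('v, 'k) mpoly ring"
  let ?M = "edge_module G :: (('v, 'k) mpoly, ('v, 'k) mpoly set) module"
  define \<phi> where "\<phi> = (\<lambda>p :: ('v, 'k) mpoly. edge_ideal G +>\<^bsub>?R\<^esub> p)"
  interpret M: presented_module ?R ?M "mon_span (mons V)" "mon_span (bad_mons G)" \<phi>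
    unfolding \<phi>_def by (rule presented_edge_module[OF graph])
  define ds where "ds = sorted_list_of_set (level ` good_mons G)"
  have "level m \<le> card V" if "m \<in> good_mons G" for m
    using that facet_verts[of "keys m"] card_mono[OF finite_V] by (simp add: level_def good_mons_iff)
  then have "level ` good_mons G \<subseteq> {..card V}" by auto
  then have fin: "finite (level ` good_mons G)" by (rule finite_subset) simp
  have ds: "set ds = level ` good_mons G" "sorted_wrt (<) ds"
    using fin by (simp_all add: ds_def strict_sorted_list_of_set)
  \<comment> \<open>strictly increasing dimensions require that only levels that occur are used as steps\<close>
  define N where "N i = bad_mons G \<union> {m \<in> good_mons G. level m \<in> set (take i ds)}" for i
  have less: "ds ! i < ds ! j" if "i < j" "j < length ds" for i j
    using sorted_wrt_nth_less[OF ds(2) that] .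
  have take_iff: "x \<in> set (take i ds) \<longleftrightarrow> x < ds ! i" if x: "x \<in> set ds" and i: "i < length ds" for x i
  proof -
    obtain j where j: "j < length ds" "x = ds ! j" using x by (auto simp: in_set_conv_nth)
    show ?thesis
    proof
      assume "x \<in> set (take i ds)"
      then obtain l where "l < i" "x = ds ! l" using i by (auto simp: in_set_conv_nth)
      then show "x < ds ! i" using less i by blast
    next
      assume "x < ds ! i"
      then have "j < i" using less[of i j] j by (metis linorder_neqE_nat not_less_iff_gr_or_eq)
      then show "x \<in> set (take i ds)" using j i by (auto simp: in_set_conv_nth intro!: exI[of _ j])
    qed
  qed
  have N_stage: "N i = stage (ds ! i)" "N (Suc i) = stage (Suc (ds ! i))" if i: "i < length ds" for i
  proof -
    have mem: "level m \<in> set ds" if "m \<in> good_mons G" for m using that ds(1) by blast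
    show "N i = stage (ds ! i)"
      using take_iff[OF mem i] by (auto simp: N_def stage_def)
    show "N (Suc i) = stage (Suc (ds ! i))"
      using take_iff[OF mem i] by (auto simp: N_def stage_def take_Suc_conv_app_nth[OF i] less_Suc_eq)
  qed
  have N_0: "N 0 = bad_mons G" by (simp add: N_def)
  have N_top: "N (length ds) = mons V"
    using ds(1) by (auto simp: N_def good_mons_def)
  have N_upset: "upset V (N i)" if "i \<le> length ds" for i
  proof (cases "i < length ds")
    case True
    then show ?thesis using N_stage(1) upset_stage by simp
  next
    case False
    then show ?thesis using that N_top upset_mons[of V] by simp
  qed
  have N_sub: "bad_mons G \<subseteq> N i" "N i \<subseteq> mons V" for i by (auto simp: N_def good_mons_def)
  have N_proper: "N i \<subseteq> N (Suc i)" "\<exists>m. m \<in> N (Suc i) \<and> m \<notin> N i" if i: "i < length ds" for i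
  proof -
    show "N i \<subseteq> N (Suc i)" unfolding N_stage[OF i] by (auto simp: stage_def)
    have "ds ! i \<in> level ` good_mons G" using i ds(1) nth_mem by blast
    then obtain m where "m \<in> good_mons G" "level m = ds ! i" by auto
    then have "m \<in> N (Suc i) \<and> m \<notin> N i" unfolding N_stage[OF i] by (auto simp: stage_def)
    then show "\<exists>m. m \<in> N (Suc i) \<and> m \<notin> N i" ..
  qed
  define F where "F i = \<phi> ` mon_span (N i)" for i
  have span: "mon_span (bad_mons G) \<subseteq> (mon_span (N i) :: ('v, 'k) mpoly set)"
    "mon_span (N i) \<subseteq> (mon_span (mons V) :: ('v, 'k) mpoly set)" for i
    by (intro mon_span_mono N_sub)+
  have stable: "a * x \<in> mon_span (N i)" if "i \<le> length ds" "a \<in> carrier ?R" "x \<in> mon_span (N i)" for i and a x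
    using mult_in_mon_span[OF N_upset[OF that(1)] _ that(3)] that(2) by (simp add: carrier_poly_ring)
  have sub_F: "graded_submodule (F i) ?R ?M (edge_module_grading G)" if i: "i \<le> length ds" for i
    unfolding graded_submodule_def
  proof (intro conjI ballI)
    show "submodule (F i) ?R ?M"
      unfolding F_def by (rule M.submodule_image[OF add_subgroup_mon_span span(2) stable[OF i]])
    fix x assume "x \<in> F i"
    then obtain p where p: "p \<in> mon_span (N i)" "x = \<phi> p" by (auto simp: F_def)
    note dec = edge_module_homogeneous_decomposition[OF graph N_sub(2) p(1), folded \<phi>_def F_def]
    show "\<exists>c. (\<forall>d. c d \<in> F i \<inter> edge_module_grading G d) \<and> finite {d. c d \<noteq> \<zero>\<^bsub>?M\<^esub>} \<and>
        x = (\<Oplus>\<^bsub>?M\<^esub>d\<in>{d. c d \<noteq> \<zero>\<^bsub>?M\<^esub>}. c d)"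
      unfolding p(2) by (intro exI conjI allI) (rule dec)+
  qed
  have quot: "cohen_macaulay ?R (irrelevant_ideal V) (subquotient ?M (F (Suc i)) (F i)) \<and>
      module_dim ?R (subquotient ?M (F (Suc i)) (F i)) = ereal (real (ds ! i))" if i: "i < length ds" for i
  proof -
    have "presented_module ?R (subquotient ?M (F (Suc i)) (F i)) (mon_span (N (Suc i))) (mon_span (N i))
        (\<lambda>x. F i +>\<^bsub>?M\<lparr>carrier := F (Suc i)\<rparr>\<^esub> \<phi> x)"
      unfolding F_def
      using i N_proper(1)[OF i]
      by (intro M.presented_subquotient add_subgroup_mon_span span mon_span_mono stable) auto
    moreover have "cone_filtration V (ds ! i) (N i) (N (Suc i))"
      unfolding N_stage[OF i] by (rule cone_filtration_stage)
    moreover have "N i \<noteq> N (Suc i)" using N_proper(2)[OF i] by blast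
    ultimately show ?thesis using cohen_macaulay_cone_filtration[OF finite_V] by blast
  qed
  have "sequentially_cohen_macaulay ?R (poly_grading V) (irrelevant_ideal V) ?M (edge_module_grading G)"
    unfolding sequentially_cohen_macaulay_def
  proof (intro conjI exI[of _ "length ds"] exI[of _ F] allI impI)
    show "graded_module ?R (poly_grading V) ?M (edge_module_grading G)" by (rule graded_edge_module[OF graph])
    show "finitely_generated ?R ?M"
    proof (rule M.finitely_generatedI)
      show "finite {1 :: ('v, 'k) mpoly}" "{1 :: ('v, 'k) mpoly} \<subseteq> mon_span (mons V)"
        by (simp_all add: one_in_mon_span)
      fix x :: "('v, 'k) mpoly" assume x: "x \<in> mon_span (mons V)"
      then show "\<exists>c. (\<forall>a\<in>{1}. c a \<in> carrier ?R) \<and> x - (\<Sum>a\<in>{1}. c a * a) \<in> mon_span (bad_mons G)"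
        by (intro exI[of _ "\<lambda>_. x"]) (simp add: carrier_poly_ring add_subgroupD(1)[OF add_subgroup_mon_span])
    qed
    have "\<phi> p = \<zero>\<^bsub>?M\<^esub>" if "p \<in> mon_span (bad_mons G)" for p using M.kernel[of p] M.CB that by blast
    moreover have "(0 :: ('v, 'k) mpoly) \<in> mon_span (bad_mons G)" by (rule add_subgroupD(1)[OF add_subgroup_mon_span])
    ultimately show "F 0 = {\<zero>\<^bsub>?M\<^esub>}" unfolding F_def N_0 by blast
    show "F (length ds) = carrier ?M" unfolding F_def N_top by (rule M.surj)
    show "graded_submodule (F i) ?R ?M (edge_module_grading G)" if "i \<le> length ds" for i by (rule sub_F[OF that])
  next
    fix i assume i: "i < length ds"
    obtain m where m: "m \<in> N (Suc i)" "m \<notin> N i" using N_proper(2)[OF i] by blast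
    have "single m (1::'k) \<in> mon_span (mons V)"
      using m(1) N_sub(2) by (intro single_in_mon_span) blast
    moreover have "single m (1::'k) \<notin> mon_span (N i)" using m(2) by (simp add: single_in_mon_span_iff)
    ultimately have "\<phi> (single m 1) \<notin> F i"
      unfolding F_def using M.phi_in_image_iff[OF add_subgroup_mon_span span] by blast
    moreover have "\<phi> (single m 1) \<in> F (Suc i)" unfolding F_def by (intro imageI single_in_mon_span m(1))
    moreover have "F i \<subseteq> F (Suc i)" unfolding F_def by (intro image_mono mon_span_mono N_proper(1)[OF i])
    ultimately show "F i \<subset> F (Suc i)" by blast
    show "cohen_macaulay ?R (irrelevant_ideal V) (subquotient ?M (F (Suc i)) (F i))" using quot[OF i] by blast
  next
    fix i assume i: "Suc i < length ds"
    then show "module_dim ?R (subquotient ?M (F (Suc i)) (F i)) < module_dim ?R (subquotient ?M (F (Suc (Suc i))) (F (Suc i)))"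
      using quot[of i] quot[of "Suc i"] less[of i "Suc i"] by simp
  qed
  then show ?thesis unfolding sequentially_cohen_macaulay_graph_def .
qed

end

section \<open>Multi-clique-whiskered graphs\<close>

lemma image_Inl_eq_iff: "{Inl x, Inl y} = Inl ` e \<longleftrightarrow> {x, y} = e"
proof -
  have "{Inl x, Inl y} = Inl ` {x, y}" by simp
  then show ?thesis using inj_image_eq_iff[OF inj_Inl, of "{x, y}" e] by simp
qed

lemma whiskered_edges:
  fixes G :: "'a graph" and W :: "nat \<Rightarrow> 'a set" and n :: "nat \<Rightarrow> nat" and r :: nat
  defines "\<Gamma> \<equiv> multi_clique_whiskered G r W n"
  shows "{Inl x, Inl y} \<in> edges \<Gamma> \<longleftrightarrow> {x, y} \<in> edges G"
    and "{Inl x, Inr (i, k)} \<in> edges \<Gamma> \<longleftrightarrow> i \<in> {1..r} \<and> x \<in> W i \<and> k \<in> {1..n i}"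
    and "{Inr (i, k), Inl x} \<in> edges \<Gamma> \<longleftrightarrow> i \<in> {1..r} \<and> x \<in> W i \<and> k \<in> {1..n i}"
    and "{Inr p, Inr q} \<notin> edges \<Gamma>"
proof -
  show "{Inl x, Inl y} \<in> edges \<Gamma> \<longleftrightarrow> {x, y} \<in> edges G"
    by (auto simp: \<Gamma>_def multi_clique_whiskered_def image_iff image_Inl_eq_iff doubleton_eq_iff)
  show 1: "{Inl x, Inr (i, k)} \<in> edges \<Gamma> \<longleftrightarrow> i \<in> {1..r} \<and> x \<in> W i \<and> k \<in> {1..n i}"
    by (auto simp: \<Gamma>_def multi_clique_whiskered_def doubleton_eq_iff)
  then show "{Inr (i, k), Inl x} \<in> edges \<Gamma> \<longleftrightarrow> i \<in> {1..r} \<and> x \<in> W i \<and> k \<in> {1..n i}"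
    by (simp add: insert_commute)
  show "{Inr p, Inr q} \<notin> edges \<Gamma>"
    by (auto simp: \<Gamma>_def multi_clique_whiskered_def doubleton_eq_iff)
qed

lemma clique_partitionD:
  assumes "clique_partition G r W"
  shows "x \<in> verts G \<Longrightarrow> \<exists>i. i \<in> {1..r} \<and> x \<in> W i"
    and "i \<in> {1..r} \<Longrightarrow> x \<in> W i \<Longrightarrow> x \<in> verts G"
    and "i \<in> {1..r} \<Longrightarrow> x \<in> W i \<Longrightarrow> y \<in> W i \<Longrightarrow> x \<noteq> y \<Longrightarrow> {x, y} \<in> edges G"
  using assms unfolding clique_partition_def clique_def by blast+

lemma finite_simple_graph_whiskered:
  assumes G: "finite_simple_graph G" and W: "clique_partition G r W"
  shows "finite_simple_graph (multi_clique_whiskered G r W n)"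
  unfolding finite_simple_graph_def
proof (intro conjI ballI)
  have "{Inr (i, k) | i k. i \<in> {1..r} \<and> k \<in> {1..n i}} = Inr ` (SIGMA i:{1..r}. {1..n i})" by auto
  then have "finite {Inr (i, k) | i k. i \<in> {1..r} \<and> k \<in> {1..n i}}"
    by (rule ssubst) (intro finite_imageI finite_SigmaI finite_atLeastAtMost)
  then show "finite (verts (multi_clique_whiskered G r W n))"
    using G unfolding multi_clique_whiskered_def finite_simple_graph_def by simp
next
  fix e assume "e \<in> edges (multi_clique_whiskered G r W n)"
  then consider d where "d \<in> edges G" "e = Inl ` d"
    | x i k where "i \<in> {1..r}" "x \<in> W i" "k \<in> {1..n i}" "e = {Inl x, Inr (i, k)}"
    by (auto simp: multi_clique_whiskered_def)
  then show "e \<subseteq> verts (multi_clique_whiskered G r W n)" and "card e = 2"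
  proof (atomize(full), cases)
    case 1
    then have "d \<subseteq> verts G" "card d = 2" using G by (simp_all add: finite_simple_graph_def)
    then show "e \<subseteq> verts (multi_clique_whiskered G r W n) \<and> card e = 2"
      unfolding 1(2) by (auto simp: multi_clique_whiskered_def card_image)
  next
    case 2
    then have "x \<in> verts G" using clique_partitionD(2)[OF W] by blast
    then show "e \<subseteq> verts (multi_clique_whiskered G r W n) \<and> card e = 2"
      using 2 by (auto simp: multi_clique_whiskered_def)
  qed
qed

subsection \<open>Vertex decomposability\<close>

text \<open>Elements of the ambient set that are not faces can be shed, since their link is void.\<close>

lemma vertex_decomposable_superset:
  assumes "vertex_decomposable V \<Delta>" "simplicial_complex V \<Delta>" "finite V'" "V \<subseteq> V'"
  shows "vertex_decomposable V' \<Delta>"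
proof -
  have "vertex_decomposable (V \<union> X) \<Delta>" if "finite X" for X
    using that
  proof (induction X)
    case (insert v X)
    show ?case
    proof (cases "v \<in> V \<union> X")
      case True
      then show ?thesis using insert.IH by (simp add: insert_absorb)
    next
      case False
      have sub: "\<Delta> \<subseteq> Pow V" and finV: "finite V" using assms(2) by (auto simp: simplicial_complex_def)
      have eq: "V \<union> insert v X - {v} = V \<union> X" using False by auto
      have nov: "v \<notin> F" if "F \<in> \<Delta>" for F using that sub False by blast
      have link: "link \<Delta> v = {}" using nov by (auto simp: link_def)
      have del: "deletion \<Delta> v = \<Delta>" using nov by (auto simp: deletion_def)
      show ?thesis
      proof (rule vertex_decomposable.shed[where x = v])
        show "simplicial_complex (V \<union> insert v X) \<Delta>"
          using assms(2) insert.hyps by (auto simp: simplicial_complex_def)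
        show "vertex_decomposable (V \<union> insert v X - {v}) (link \<Delta> v)"
          unfolding link eq using finV insert.hyps by (intro vertex_decomposable.void) simp
        show "vertex_decomposable (V \<union> insert v X - {v}) (deletion \<Delta> v)"
          unfolding del eq by (rule insert.IH)
      qed (simp_all add: del)
    qed
  qed (simp add: assms(1))
  from this[of "V' - V"] show ?thesis using assms(3,4) by (simp add: Un_absorb1)
qed

lemma indep_insert:
  "indep (insert a F) E \<longleftrightarrow> indep F E \<and> (\<forall>w\<in>F. w \<noteq> a \<longrightarrow> {a, w} \<notin> E)"
  by (auto simp: indep_def insert_commute)

text \<open>For the induction, \<open>X\<close> is the set of remaining old vertices and \<open>T\<close> the set of remaining whiskers; all
  parts that contain an element of \<open>X\<close> must retain a whisker.\<close>

lemma vertex_decomposable_whiskered_part: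
  fixes G :: "'a graph"
  assumes G: "finite_simple_graph G" and W: "clique_partition G r W"
    and "finite X" "finite T" "X \<subseteq> verts G" "T \<subseteq> (SIGMA i:{1..r}. {1..n i})"
    and "\<And>x i. x \<in> X \<Longrightarrow> i \<in> {1..r} \<Longrightarrow> x \<in> W i \<Longrightarrow> \<exists>k. (i, k) \<in> T"
  shows "vertex_decomposable (Inl ` X \<union> Inr ` T)
    {F. F \<subseteq> Inl ` X \<union> Inr ` T \<and> indep F (edges (multi_clique_whiskered G r W n))}"
  using assms(3-)
proof (induction X arbitrary: T rule: finite_psubset_induct)
  case (psubset X)
  let ?E = "edges (multi_clique_whiskered G r W n)"
  let ?\<Delta> = "\<lambda>X T. {F. F \<subseteq> Inl ` X \<union> Inr ` T \<and> indep F ?E}"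
  note ed = whiskered_edges[where G = G and r = r and W = W and n = n]
  have complex: "simplicial_complex (Inl ` X \<union> Inr ` T) (?\<Delta> X T)" if "finite X" "finite T" for X T
    using that smaller_indep unfolding simplicial_complex_def by blast
  show ?case
  proof (cases "X = {}")
    case True
    have "indep F ?E" if F: "F \<subseteq> Inr ` T" for F
      unfolding indep_def
    proof (intro ballI impI)
      fix v w assume "v \<in> F" "w \<in> F"
      then obtain p q where "v = Inr p" "w = Inr q" using F by blast
      then show "{v, w} \<notin> ?E" using ed(4) by simp
    qed
    then have "?\<Delta> X T = Pow (Inl ` X \<union> Inr ` T)" using True by auto
    then show ?thesis using psubset.hyps psubset.prems(1) by (simp add: vertex_decomposable.simplex)
  next
    case False
    then obtain x where x: "x \<in> X" by blast
    then have "x \<in> verts G" using psubset.prems(2) by blast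
    then obtain i where i: "i \<in> {1..r}" "x \<in> W i" using clique_partitionD(1)[OF W] by blast
    obtain k where k: "(i, k) \<in> T" using psubset.prems(4)[OF x i] by blast
    have kn: "k \<in> {1..n i}" using k psubset.prems(3) by auto
    have block: "{x, y} \<in> edges G" if "y \<in> W i" "y \<noteq> x" for y
      by (rule clique_partitionD(3)[OF W i that(1)]) (use that in auto)
    let ?X = "{y \<in> X. y \<noteq> x \<and> {x, y} \<notin> edges G}" and ?T = "{p \<in> T. x \<notin> W (fst p)}"
    have eq: "Inl ` X \<union> Inr ` T - {Inl x} = Inl ` (X - {x}) \<union> Inr ` T" by auto
    have link: "link (?\<Delta> X T) (Inl x) = ?\<Delta> ?X ?T"
    proof (intro equalityI subsetI)
      fix F assume "F \<in> link (?\<Delta> X T) (Inl x)"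
      then have F: "F \<subseteq> Inl ` X \<union> Inr ` T" "Inl x \<notin> F" "indep F ?E"
        "\<And>w. w \<in> F \<Longrightarrow> {Inl x, w} \<notin> ?E" by (auto simp: link_def indep_insert)
      have "w \<in> Inl ` ?X \<union> Inr ` ?T" if w: "w \<in> F" for w
      proof (cases w)
        case (Inl y)
        then show ?thesis using F(1,2) F(4)[OF w] w ed(1) by auto
      next
        case (Inr p)
        obtain j l where p: "p = (j, l)" by (cases p)
        have "p \<in> T" using Inr F(1) w by auto
        moreover have "x \<notin> W j"
          using F(4)[OF w] ed(2) Inr p \<open>p \<in> T\<close> psubset.prems(3) by auto
        ultimately show ?thesis using Inr p by auto
      qed
      then show "F \<in> ?\<Delta> ?X ?T" using F(3) by blast
    next
      fix F assume F: "F \<in> ?\<Delta> ?X ?T"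
      have "{Inl x, w} \<notin> ?E" if "w \<in> F" for w
      proof (cases w)
        case (Inl y)
        then show ?thesis using F that ed(1) by auto
      next
        case (Inr p)
        then have "p \<in> ?T" using F that by auto
        then show ?thesis using ed(2)[of x "fst p" "snd p"] Inr by simp
      qed
      then show "F \<in> link (?\<Delta> X T) (Inl x)" using F x by (auto simp: link_def indep_insert)
    qed
    have del: "deletion (?\<Delta> X T) (Inl x) = ?\<Delta> (X - {x}) T" by (auto simp: deletion_def)
    have fX: "finite ?X" "finite ?T" "finite (X - {x})" using psubset.hyps psubset.prems(1) by auto
    show ?thesis
    proof (rule vertex_decomposable.shed[of _ _ "Inl x"])
      show "simplicial_complex (Inl ` X \<union> Inr ` T) (?\<Delta> X T)" by (rule complex[OF psubset.hyps psubset.prems(1)])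
      show "Inl x \<in> Inl ` X \<union> Inr ` T" using x by blast
      have "vertex_decomposable (Inl ` ?X \<union> Inr ` ?T) (?\<Delta> ?X ?T)"
      proof (rule psubset.IH)
        show "?X \<subset> X" using x by blast
        show "\<exists>l. (j, l) \<in> ?T" if y: "y \<in> ?X" "j \<in> {1..r}" "y \<in> W j" for y j
        proof -
          obtain l where "(j, l) \<in> T" using psubset.prems(4)[of y j] y by blast
          moreover have "x \<notin> W j"
          proof
            assume "x \<in> W j"
            then have "{x, y} \<in> edges G" using clique_partitionD(3)[OF W y(2) _ y(3)] y(1) by blast
            then show False using y(1) by blast
          qed
          ultimately show ?thesis by auto
        qed
      qed (use fX psubset.prems in auto)
      then have "vertex_decomposable (Inl ` X \<union> Inr ` T - {Inl x}) (?\<Delta> ?X ?T)"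
        by (rule vertex_decomposable_superset[OF _ complex[OF fX(1,2)]]) (use psubset.hyps psubset.prems(1) in auto)
      then show "vertex_decomposable (Inl ` X \<union> Inr ` T - {Inl x}) (link (?\<Delta> X T) (Inl x))"
        by (simp only: link)
      show "vertex_decomposable (Inl ` X \<union> Inr ` T - {Inl x}) (deletion (?\<Delta> X T) (Inl x))"
        unfolding del eq
        by (rule psubset.IH) (use x psubset.prems in auto)
      show "facets (deletion (?\<Delta> X T) (Inl x)) \<subseteq> facets (?\<Delta> X T)"
      proof
        fix F assume "F \<in> facets (deletion (?\<Delta> X T) (Inl x))"
        then have F: "F \<in> ?\<Delta> (X - {x}) T" and max: "\<And>F'. F' \<in> ?\<Delta> (X - {x}) T \<Longrightarrow> F \<subseteq> F' \<Longrightarrow> F' = F"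
          unfolding del facets_def by blast+
        have "F' = F" if F': "F' \<in> ?\<Delta> X T" "F \<subseteq> F'" for F'
        proof (cases "Inl x \<in> F'")
          case True
          let ?w = "Inr (i, k) :: 'a + nat \<times> nat"
          have adj: "{Inl x, w} \<notin> ?E" if "w \<in> F" "w \<noteq> Inl x" for w
            using F' True that by (auto simp: indep_def)
          have "?w \<notin> F" using adj[of ?w] ed(2) i kn by auto
          have "{?w, w} \<notin> ?E" if w: "w \<in> F" for w
          proof (cases w)
            case (Inl y)
            then have "y \<noteq> x" using w F by auto
            then have "{x, y} \<notin> edges G" using adj[OF w] Inl ed(1) by auto
            then have "y \<notin> W i" using block \<open>y \<noteq> x\<close> by blast
            then show ?thesis using Inl ed(3) by simp
          qed (simp add: ed(4))
          then have "insert ?w F \<in> ?\<Delta> (X - {x}) T" using F k by (auto simp: indep_insert)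
          then have "insert ?w F = F" by (rule max) blast
          then show ?thesis using \<open>?w \<notin> F\<close> by blast
        next
          case False
          then have "F' \<in> ?\<Delta> (X - {x}) T" using F' by auto
          then show ?thesis using max F' by blast
        qed
        then show "F \<in> facets (?\<Delta> X T)" using F unfolding facets_def by blast
      qed
    qed
  qed
qed

theorem vertex_decomposable_graph_whiskered:
  fixes G :: "'a graph"
  assumes G: "finite_simple_graph G" and W: "clique_partition G r W" and n: "\<forall>i\<in>{1..r}. 0 < n i"
  shows "vertex_decomposable_graph (multi_clique_whiskered G r W n)"
proof -
  let ?T = "SIGMA i:{1..r}. {1..n i}"
  have verts: "verts (multi_clique_whiskered G r W n) = Inl ` verts G \<union> Inr ` ?T"
    by (auto simp: multi_clique_whiskered_def)
  have "\<exists>k. (i, k) \<in> ?T" if "i \<in> {1..r}" for i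
    using that n by (intro exI[of _ 1]) (auto simp: Suc_le_eq)
  then show ?thesis
    unfolding vertex_decomposable_graph_def independence_complex_def verts
    using G by (intro vertex_decomposable_whiskered_part[OF G W]) (auto simp: finite_simple_graph_def)
qed

subsection \<open>The partition of the independence complex\<close>

text \<open>The core of an independent set consists of its old vertices, and the interval above \<open>A\<close> is obtained by adding
  whiskers of parts that do not meet \<open>A\<close>.\<close>

lemma partitioned_graph_whiskered:
  fixes G :: "'a graph"
  assumes G: "finite_simple_graph G" and W: "clique_partition G r W" and n: "\<forall>i\<in>{1..r}. 0 < n i"
  shows "partitioned_graph (multi_clique_whiskered G r W n) (\<lambda>S. S \<inter> range Inl)
    (\<lambda>A. A \<union> {Inr (i, k) | i k. i \<in> {1..r} \<and> k \<in> {1..n i} \<and> (\<forall>x\<in>W i. Inl x \<notin> A)})"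
proof -
  let ?G = "multi_clique_whiskered G r W n"
  let ?E = "edges ?G" and ?I = "independence_complex ?G"
  let ?c = "\<lambda>S :: ('a + nat \<times> nat) set. S \<inter> range Inl"
  let ?w = "\<lambda>A :: ('a + nat \<times> nat) set. {Inr (i, k) | i k. i \<in> {1..r} \<and> k \<in> {1..n i} \<and> (\<forall>x\<in>W i. Inl x \<notin> A)}"
  note ed = whiskered_edges[where G = G and r = r and W = W and n = n]
  have simple: "finite_simple_graph ?G" by (rule finite_simple_graph_whiskered[OF G W])
  have verts: "verts ?G = Inl ` verts G \<union> {Inr (i, k) | i k. i \<in> {1..r} \<and> k \<in> {1..n i}}"
    by (simp add: multi_clique_whiskered_def)
  have facet_verts: "?c S \<union> ?w (?c S) \<subseteq> verts ?G" if "S \<in> ?I" for S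
    using that unfolding independence_complex_def verts by auto
  show ?thesis
  proof (rule partitioned_graph.intro)
    show "finite_simple_graph ?G" by (rule simple)
    show "?c S \<subseteq> S" for S by blast
    show "?c S \<union> ?w (?c S) \<subseteq> verts ?G" if "S \<in> ?I" for S by (rule facet_verts[OF that])
    show "?c S \<subseteq> ?c T" if "S \<subseteq> T" for S T using that by blast
  next
    fix S assume S: "S \<in> ?I"
    show "S \<subseteq> ?c S \<union> ?w (?c S)"
    proof
      fix s assume s: "s \<in> S"
      show "s \<in> ?c S \<union> ?w (?c S)"
      proof (cases s)
        case (Inr p)
        obtain i k where p: "p = (i, k)" by (cases p)
        have ik: "i \<in> {1..r}" "k \<in> {1..n i}" using S s Inr p unfolding independence_complex_def verts by auto
        have "Inl x \<notin> S" if "x \<in> W i" for x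
        proof
          assume "Inl x \<in> S"
          then have "{Inl x, Inr (i, k)} \<notin> ?E" using S s Inr p by (auto simp: independence_complex_def indep_def)
          then show False using ed(2) ik that by simp
        qed
        then show ?thesis using Inr p ik by blast
      qed (use s in simp)
    qed
  next
    fix S T assume S: "S \<in> ?I" and T: "?c S \<subseteq> T" "T \<subseteq> ?c S \<union> ?w (?c S)"
    have core: "?c T = ?c S" using T by auto
    have "{v, w} \<notin> ?E" if vw: "v \<in> T" "w \<in> T" "v \<noteq> w" for v w
    proof (cases v)
      case v: (Inl x)
      then have vS: "v \<in> S" using vw(1) core by blast
      show ?thesis
      proof (cases w)
        case w: (Inl y)
        then have "w \<in> S" using vw(2) core by blast
        then show ?thesis using S vS vw(3) by (auto simp: independence_complex_def indep_def)
      next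
        case w: (Inr p)
        then have "w \<in> ?w (?c S)" using vw(2) T(2) by blast
        then show ?thesis using v vS ed(2) by auto
      qed
    next
      case v: (Inr p)
      then have v': "v \<in> ?w (?c S)" using vw(1) T(2) by blast
      show ?thesis
      proof (cases w)
        case w: (Inl y)
        then have "w \<in> S" using vw(2) core by blast
        then show ?thesis using w v' ed(3) by auto
      next
        case w: (Inr q)
        then show ?thesis using v ed(4) by simp
      qed
    qed
    moreover have "T \<subseteq> verts ?G" using T(2) facet_verts[OF S] by blast
    ultimately have "T \<in> ?I" by (auto simp: independence_complex_def indep_def)
    then show "T \<in> ?I \<and> ?c T = ?c S" using core by blast
  next
    fix S T assume T: "T \<in> ?I" and ST: "S \<subseteq> T"
    let ?A = "?c S" and ?B = "?c T"
    have S: "S \<in> ?I"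
      using T ST smaller_indep[of T ?E S] by (auto simp: independence_complex_def)
    define blk where "blk x = (SOME i. i \<in> {1..r} \<and> x \<in> W i)" for x
    have blk: "blk x \<in> {1..r} \<and> x \<in> W (blk x)" if "x \<in> verts G" for x
      unfolding blk_def by (rule someI_ex[OF clique_partitionD(1)[OF W that]])
    \<comment> \<open>an injection of the top above \<open>B\<close> into that above \<open>A\<close>: a vertex of \<open>B\<close> outside \<open>A\<close> goes to the first whisker of its part\<close>
    define f :: "'a + nat \<times> nat \<Rightarrow> 'a + nat \<times> nat" where "f z = (case z of Inl x \<Rightarrow> if Inl x \<in> ?A then Inl x else Inr (blk x, 1) | Inr p \<Rightarrow> Inr p)" for z
    have inB: "x \<in> verts G" if "Inl x \<in> ?B" for x
      using that T unfolding independence_complex_def verts by auto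
    have same: "x = y" if "Inl x \<in> ?B" "Inl y \<in> ?B" "x \<in> W i" "y \<in> W i" "i \<in> {1..r}" for x y i
    proof (rule ccontr)
      assume "x \<noteq> y"
      then have "{x, y} \<in> edges G" using clique_partitionD(3)[OF W that(5,3,4)] by blast
      then have "{Inl x, Inl y} \<in> ?E" using ed(1) by simp
      then show False using T that(1,2) \<open>x \<noteq> y\<close> by (auto simp: independence_complex_def indep_def)
    qed
    have "f z \<in> ?A \<union> ?w ?A" if z: "z \<in> ?B \<union> ?w ?B" for z
    proof (cases z)
      case (Inl x)
      then have xB: "Inl x \<in> ?B" using z by auto
      show ?thesis
      proof (cases "Inl x \<in> ?A")
        case False
        note b = blk[OF inB[OF xB]]
        have "Inl y \<notin> ?A" if "y \<in> W (blk x)" for y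
          using same[OF xB, of y "blk x"] that b False ST by blast
        moreover have "1 \<in> {1..n (blk x)}" using n b by (simp add: Suc_le_eq)
        ultimately have "Inr (blk x, 1) \<in> ?w ?A" using b by blast
        then show ?thesis using False Inl by (simp add: f_def)
      qed (simp add: Inl f_def)
    next
      case (Inr p)
      then have "z \<in> ?w ?B" using z by auto
      then have "z \<in> ?w ?A" using ST by blast
      then show ?thesis using Inr by (simp add: f_def)
    qed
    then have img: "f ` (?B \<union> ?w ?B) \<subseteq> ?A \<union> ?w ?A" by blast
    have inj: "inj_on f (?B \<union> ?w ?B)"
    proof (rule inj_onI)
      have mixed: False if "Inl x \<in> ?B" "Inr p \<in> ?w ?B" "f (Inl x) = f (Inr p)" for x p
      proof -
        have "p = (blk x, 1)" using that(3) by (auto simp: f_def split: if_splits)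
        then show False using that(1,2) blk[OF inB[OF that(1)]] by auto
      qed
      fix z z' assume z: "z \<in> ?B \<union> ?w ?B" "z' \<in> ?B \<union> ?w ?B" and eq: "f z = f z'"
      show "z = z'"
      proof (cases z)
        case 1: (Inl x)
        then have xB: "Inl x \<in> ?B" using z(1) by auto
        show ?thesis
        proof (cases z')
          case 2: (Inl y)
          then have yB: "Inl y \<in> ?B" using z(2) by auto
          have "Inl x = (Inl y :: 'a + nat \<times> nat) \<or> blk x = blk y"
            using eq by (auto simp: f_def 1 2 split: if_splits)
          then show ?thesis
            using same[OF xB yB, of "blk x"] blk[OF inB[OF xB]] blk[OF inB[OF yB]] 1 2 by auto
        next
          case 2: (Inr q)
          then have qB: "Inr q \<in> ?w ?B" using z(2) by auto
          show ?thesis using mixed[OF xB qB eq[unfolded 1 2]] ..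
        qed
      next
        case 1: (Inr p)
        then have pB: "Inr p \<in> ?w ?B" using z(1) by auto
        show ?thesis
        proof (cases z')
          case 2: (Inl y)
          then have yB: "Inl y \<in> ?B" using z(2) by auto
          show ?thesis using mixed[OF yB pB eq[symmetric, unfolded 1 2]] ..
        next
          case 2: (Inr q)
          then show ?thesis using eq 1 by (simp add: f_def)
        qed
      qed
    qed
    have fin: "finite (?A \<union> ?w ?A)"
      using finite_subset[OF facet_verts[OF S]] simple by (simp add: finite_simple_graph_def)
    show "card (?B \<union> ?w ?B) \<le> card (?A \<union> ?w ?A)" by (rule card_inj_on_le[OF inj img fin])
  qed
qed

theorem theorem5p2:
  fixes G :: "'a graph" and r :: nat and W :: "nat \<Rightarrow> 'a set" and n :: "nat \<Rightarrow> nat"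
  assumes "finite_simple_graph G"
    and "clique_partition G r W"
    and "\<forall>i\<in>{1..r}. 0 < n i"
  shows "vertex_decomposable_graph (multi_clique_whiskered G r W n) \<and>
         sequentially_cohen_macaulay_graph TYPE('k::field) (multi_clique_whiskered G r W n)"
proof
  show "vertex_decomposable_graph (multi_clique_whiskered G r W n)"
    by (rule vertex_decomposable_graph_whiskered[OF assms])
  show "sequentially_cohen_macaulay_graph TYPE('k) (multi_clique_whiskered G r W n)"
    by (rule partitioned_graph.sequentially_cohen_macaulay[OF partitioned_graph_whiskered[OF assms]])
qed

end
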